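(* For any $\bar\omega\in\mathbf V$, the orbit $\mathcal O_{\bar\omega}$ is exactly the set of maximizers of $E$ relative to $\mathcal R_{\bar\omega}$, that is, $\mathcal O_{\bar\omega}=\{v\in\mathcal R_{\bar\omega}: E(v)=\sup_{w\in\mathcal R_{\bar\omega}}E(w)\}$.
   Context: $D=\{\mathbf x\in\mathbb R^2: |\mathbf x|<1\}$ is the open unit disk and $(r,\theta)$ are polar coordinates. All functions are real-valued, and functions equal a.e. are identified. $\mathcal G$ is the inverse of $-\Delta$ on $D$ with zero Dirichlet boundary condition: $-\Delta\mathcal Gv=v$ in $D$, $\mathcal Gv=0$ on $\partial D$. The kinetic energy is $E(v)=\frac12\int_D v\,\mathcal Gv\,d\mathbf x$. $J_n$ is the Bessel function of the first kind of order $n$ and $j$ is the first positive zero of $J_1$. $\mathbf V=\mathrm{span}_{\mathbb R}\{J_0(jr),\,J_1(jr)\cos\theta,\,J_1(jr)\sin\theta\}$, a space of functions on $D$. For $\zeta:D\to\mathbb R$, the rotation orbit is $\mathcal O_\zeta=\{\zeta(r,\theta+\beta): \beta\in\mathbb R\}$. The rearrangement class of $\zeta$ is $\mathcal R_\zeta=\{v:D\to\mathbb R : |\{\mathbf x\in D: v(\mathbf x)>s\}|=|\{\mathbf x\in D: \zeta(\mathbf x)>s\}|\ \forall s\in\mathbb R\}$ (measurable functions), $|\cdot|$ being two-dimensional Lebesgue measure. *)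

theory Defs
  imports "HOL-Analysis.Analysis"
begin

text \<open>
  The plane is represented by the type of complex numbers with its Euclidean structure, so that
  polar coordinates are \<open>z = rcis r \<theta>\<close> and rotation by \<open>\<beta>\<close> is multiplication by \<open>cis \<beta>\<close>.
  A function on the disk is a total function on the plane whose values outside the disk are
  irrelevant. Functions equal almost everywhere are identified in the sense that all sets of
  functions below are closed under almost everywhere equality on the disk.
\<close>

abbreviation unit_disk :: "complex set" where
  "unit_disk \<equiv> ball 0 1"


definition bessel_J :: "nat \<Rightarrow> real \<Rightarrow> real" where
  "bessel_J n x = (\<Sum>m. (-1) ^ m / (fact m * fact (m + n)) * (x / 2) ^ (2 * m + n))"

definition bessel_J1_zero :: real where
  "bessel_J1_zero = (LEAST x. 0 < x \<and> bessel_J 1 x = 0)"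

text \<open>The value \<open>Arg 0 = 0\<close> plays no role, since \<open>J\<^sub>1\<close> vanishes at the origin.\<close>

definition V_space :: "(complex \<Rightarrow> real) set" where
  "V_space = {v. \<exists>a b c. AE z in lebesgue_on unit_disk.
      v z = a * bessel_J 0 (bessel_J1_zero * cmod z)
          + b * (bessel_J 1 (bessel_J1_zero * cmod z) * cos (Arg z))
          + c * (bessel_J 1 (bessel_J1_zero * cmod z) * sin (Arg z))}"


definition partial_deriv :: "'a::euclidean_space \<Rightarrow> ('a \<Rightarrow> real) \<Rightarrow> 'a \<Rightarrow> real" where
  "partial_deriv b f x = frechet_derivative f (at x) b"

definition laplacian :: "('a::euclidean_space \<Rightarrow> real) \<Rightarrow> 'a \<Rightarrow> real" where
  "laplacian f x = (\<Sum>b\<in>Basis. partial_deriv b (partial_deriv b f) x)"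

primrec C_k :: "nat \<Rightarrow> ('a::euclidean_space \<Rightarrow> real) \<Rightarrow> bool" where
  "C_k 0 f \<longleftrightarrow> continuous_on UNIV f"
| "C_k (Suc k) f \<longleftrightarrow> (\<forall>x. f differentiable (at x)) \<and> (\<forall>b\<in>Basis. C_k k (partial_deriv b f))"

text \<open>\<open>C\<^sub>c\<^sup>\<infinity>\<close> functions of the disk, extended by zero to the plane.\<close>

definition disk_test_function :: "(complex \<Rightarrow> real) \<Rightarrow> bool" where
  "disk_test_function \<phi> \<longleftrightarrow> (\<forall>k. C_k k \<phi>) \<and> closure {x. \<phi> x \<noteq> 0} \<subseteq> unit_disk"

text \<open>
  \<open>-\<Delta>u = v\<close> in the disk and \<open>u = 0\<close> on its boundary. As \<open>v\<close> need not be continuous, the equation is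
  understood in the sense of distributions; the boundary values are attained continuously.
  For bounded \<open>v\<close>, hence for all members of the rearrangement classes of interest, this is the usual
  solution. Requiring \<open>u\<close> to vanish also outside the closed disk makes it unique as a total function.
\<close>

definition dirichlet_solution :: "(complex \<Rightarrow> real) \<Rightarrow> (complex \<Rightarrow> real) \<Rightarrow> bool" where
  "dirichlet_solution v u \<longleftrightarrow>
     integrable (lebesgue_on unit_disk) v \<and>
     continuous_on (cball 0 1) u \<and>
     (\<forall>x. x \<notin> unit_disk \<longrightarrow> u x = 0) \<and>
     (\<forall>\<phi>. disk_test_function \<phi> \<longrightarrow>
        (LINT x|lebesgue_on unit_disk. u x * (- laplacian \<phi> x)) =
        (LINT x|lebesgue_on unit_disk. v x * \<phi> x))"

definition green_op :: "(complex \<Rightarrow> real) \<Rightarrow> complex \<Rightarrow> real" where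
  "green_op v = (THE u. dirichlet_solution v u)"

definition kinetic_energy :: "(complex \<Rightarrow> real) \<Rightarrow> real" where
  "kinetic_energy v = 1 / 2 * (LINT x|lebesgue_on unit_disk. v x * green_op v x)"


definition rotation_orbit :: "(complex \<Rightarrow> real) \<Rightarrow> (complex \<Rightarrow> real) set" where
  "rotation_orbit \<zeta> = {v. \<exists>\<beta>. AE z in lebesgue_on unit_disk. v z = \<zeta> (cis \<beta> * z)}"

definition rearrangement_class :: "(complex \<Rightarrow> real) \<Rightarrow> (complex \<Rightarrow> real) set" where
  "rearrangement_class \<zeta> = {v \<in> borel_measurable (lebesgue_on unit_disk).
     \<forall>s. measure lebesgue {x \<in> unit_disk. v x > s} = measure lebesgue {x \<in> unit_disk. \<zeta> x > s}}"

end

theory Submission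
  imports Defs
begin

text \<open>
  Write \<open>\<lambda> = j\<^sup>2\<close>. Two functions in the same rearrangement class have the same mean and the same
  \<open>L\<^sup>2\<close> norm, and every member of \<open>V_space\<close> has mean zero. The theorem therefore follows from two facts.
  First, a bounded function \<open>v\<close> of mean zero satisfies \<open>\<lambda> \<integral> v (\<G> v) \<le> \<integral> v\<^sup>2\<close>, with equality exactly when \<open>v\<close>
  belongs to \<open>V_space\<close> (\<open>energy_inequality\<close>, \<open>V_space_props\<close>, \<open>energy_equality_imp_V_space\<close>). Hence
  the maximisers of the energy in the class of \<open>\<omega>\<close> are the members of \<open>V_space\<close> in that class. Second,
  two equimeasurable members of \<open>V_space\<close> differ by a rotation, because their second and third
  moments determine the coefficient of \<open>J\<^sub>0\<close> and the amplitude of the \<open>J\<^sub>1\<close> part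
  (\<open>Vfun_moments_determine\<close>).

  The inequality is proved by separation of variables. In the variable \<open>t = |z|\<^sup>2\<close> the Laplacian maps
  \<open>Re (z\<^sup>n) F(t)\<close> to \<open>4 Re (z\<^sup>n) (t F'' + (n + 1) F')\<close>, so no half-integer powers occur and polynomial
  profiles stay polynomial. With \<open>\<kappa> = \<lambda> / 4\<close>, the inequality in a mode \<open>n \<ge> 1\<close> reduces to
  \<open>\<kappa> \<integral> t\<^sup>n F\<^sup>2 \<le> \<integral> t\<^sup>n\<^sup>+\<^sup>1 F'\<^sup>2\<close> for \<open>F(1) = 0\<close> (\<open>radial_rayleigh\<close>), which is Picone's identity for the
  profile of the Bessel function \<open>J\<^sub>n\<close>; the first positive zero of \<open>J\<^sub>1\<close> enters because the profiles of
  all orders \<open>n \<ge> 1\<close> are positive below it. In mode \<open>0\<close> the mean-zero condition says \<open>F'(1) = 0\<close>, and the inequality for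
  \<open>F\<close> is the one of mode \<open>1\<close> for \<open>F'\<close>: this is why \<open>J\<^sub>0(jr)\<close> and \<open>J\<^sub>1(jr) cos \<theta>\<close> share an eigenvalue.

  The analysis of \<open>\<G>\<close> is done on polynomials, for which Poisson's equation is solved explicitly mode by
  mode. A bound of \<open>sup |\<G> p|\<close> by the \<open>L\<^sup>2\<close> norm of \<open>p\<close> (\<open>poisson_pair_sup_bound\<close>) gives solutions for
  bounded data as uniform limits and carries the inequality over. Conversely a solution in the sense
  of distributions may be tested against polynomials that merely vanish on the circle
  (\<open>transposition\<close>), which yields uniqueness, since polynomials are dense.

  For the equality case, a maximiser satisfies the Euler-Lagrange equation tested against polynomials
  (\<open>euler_lagrange\<close>). Solving the radial equation by a power series turns this equation into a
  recursion that expresses all moments of the maximiser in a given mode by a single one. This one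
  vanishes for \<open>n \<ge> 2\<close>, and for \<open>n \<le> 1\<close> it is the moment of a multiple of the Bessel function.
\<close>

section \<open>Integration on the disk and rotations\<close>

abbreviation (input) disk_area :: "complex measure" where
  "disk_area \<equiv> lebesgue_on unit_disk"

text \<open>
  Radial profiles are functions of the squared modulus rather than of \<open>r\<close>, which keeps the Laplacian
  of a mode polynomial and turns area into \<open>pi\<close> times Lebesgue measure on the unit interval.
\<close>

abbreviation (input) nsq :: "complex \<Rightarrow> real" where
  "nsq z \<equiv> (cmod z)\<^sup>2"

text \<open>
  The identification with \<open>real ^ 2\<close> maps boxes to boxes. Through it the complex plane inherits the
  invariance of Lebesgue measure under orthogonal transformations.
\<close>

lemma lborel_vec2_to_complex:
  "distr (lborel :: (real^2) measure) borel (\<lambda>v. Complex (v $ 1) (v $ 2)) = lborel"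
proof (rule lborel_eqI[symmetric])
  let ?T = "\<lambda>v::real^2. Complex (v $ 1) (v $ 2)"
  have T_meas [measurable]: "?T \<in> borel_measurable borel"
    by (intro borel_measurable_continuous_onI continuous_intros)
  fix l u :: complex
  assume le: "\<And>b. b \<in> Basis \<Longrightarrow> l \<bullet> b \<le> u \<bullet> b"
  have pre: "?T -` box l u = box (vector [Re l, Im l]) (vector [Re u, Im u])"
    by (auto simp: box_def Basis_complex_def Basis_vec_def inner_axis exhaust_2 forall_2 inner_complex_def)
  have "(\<Prod>b\<in>Basis. (vector [Re u, Im u] - vector [Re l, Im l] :: real^2) \<bullet> b)
      = (\<Prod>i\<in>(UNIV::2 set). (vector [Re u, Im u] - vector [Re l, Im l] :: real^2) $ i)"
    by (subst prod.reindex_bij_betw[of "\<lambda>i. axis i 1" UNIV "Basis :: (real^2) set", symmetric])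
       (auto simp: bij_betw_def inj_on_def axis_eq_axis Basis_vec_def inner_axis)
  also have "\<dots> = (\<Prod>b\<in>Basis. (u - l) \<bullet> b)"
    by (simp add: UNIV_2 Basis_complex_def inner_complex_def)
  finally show "emeasure (distr lborel borel ?T) (box l u) = (\<Prod>b\<in>Basis. (u - l) \<bullet> b)"
    using le[of 1] le[of \<i>]
    by (auto simp: emeasure_distr pre emeasure_lborel_box_eq Basis_complex_def inner_complex_def
                   Basis_vec_def inner_axis forall_2)
qed simp

lemma lborel_rotate:
  "distr (lborel :: complex measure) borel (\<lambda>z. cis \<beta> * z) = lborel"
proof (rule lborel_eqI[symmetric])
  let ?T = "\<lambda>v::real^2. Complex (v $ 1) (v $ 2)"
  let ?S = "\<lambda>z::complex. (vector [Re z, Im z] :: real^2)"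
  let ?R = "\<lambda>z::complex. cis \<beta> * z"
  have R_meas [measurable]: "?R \<in> borel_measurable borel"
    by (intro borel_measurable_continuous_onI continuous_intros)
  have T_meas [measurable]: "?T \<in> borel_measurable borel"
    by (intro borel_measurable_continuous_onI continuous_intros)
  have TS: "?T (?S z) = z" and ST: "?S (?T v) = v" for z v
    by (simp_all add: complex_eq_iff vec_eq_iff forall_2)
  fix l u :: complex
  assume le: "\<And>b. b \<in> Basis \<Longrightarrow> l \<bullet> b \<le> u \<bullet> b"
  define Q where "Q v = ?S (cis (-\<beta>) * ?T v)" for v
  have orth: "orthogonal_transformation Q"
    unfolding orthogonal_transformation
  proof
    show "linear Q"
      by (rule linearI) (simp_all add: Q_def vec_eq_iff forall_2 algebra_simps)
    show "\<forall>v. norm (Q v) = norm v"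
    proof
      fix v
      have nT: "norm w = cmod (?T w)" for w :: "real^2"
        by (simp add: norm_vec_def L2_set_def sum_2 cmod_def)
      have "norm (Q v) = cmod (cis (-\<beta>) * ?T v)"
        by (simp only: nT Q_def TS)
      then show "norm (Q v) = norm v"
        by (simp add: norm_mult nT)
    qed
  qed
  let ?B = "box l u :: complex set"
  have lb: "?T -` ?B = box (?S l) (?S u)"
    by (auto simp: box_def Basis_complex_def Basis_vec_def inner_axis forall_2 inner_complex_def)
  have img: "?T -` (?R -` ?B) = Q ` (?T -` ?B)"
  proof (intro subset_antisym subsetI)
    fix v assume "v \<in> ?T -` (?R -` ?B)"
    moreover have "v = Q (?S (?R (?T v)))"
      using ST[of v] by (simp only: Q_def TS) (simp add: mult.assoc[symmetric] cis_mult)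
    ultimately show "v \<in> Q ` (?T -` ?B)"
      by (auto simp only: TS vimage_eq intro!: image_eqI)
  next
    fix v assume "v \<in> Q ` (?T -` ?B)"
    then obtain w where w: "v = Q w" "?T w \<in> ?B" by blast
    have "?R (?T v) = ?T w"
      unfolding w(1) Q_def TS by (simp add: mult.assoc[symmetric] cis_mult)
    with w show "v \<in> ?T -` (?R -` ?B)" by simp
  qed
  have lm: "box (?S l) (?S u) \<in> lmeasurable" by simp
  have bor: "?R -` ?B \<in> sets borel"
    using measurable_sets[OF R_meas, of ?B] by simp
  have "emeasure (distr lborel borel ?R) ?B = emeasure lborel (?R -` ?B)"
    by (simp add: emeasure_distr)
  also have "\<dots> = emeasure (distr lborel borel ?T) (?R -` ?B)"
    by (simp only: lborel_vec2_to_complex)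
  also have "\<dots> = emeasure lborel (Q ` box (?S l) (?S u))"
    using bor by (simp add: emeasure_distr img lb)
  also have "\<dots> = emeasure lebesgue (Q ` box (?S l) (?S u))"
    using measurable_sets[OF T_meas bor] by (simp add: img lb)
  also have "\<dots> = emeasure lebesgue (box (?S l) (?S u))"
    using measurable_orthogonal_image[OF orth lm] measure_orthogonal_image[OF orth lm] lm
    by (simp add: emeasure_eq_measure2)
  also have "\<dots> = emeasure (distr lborel borel ?T) ?B"
    by (simp add: emeasure_distr lb)
  also have "\<dots> = (\<Prod>b\<in>Basis. (u - l) \<bullet> b)"
    using le by (simp add: lborel_vec2_to_complex emeasure_lborel_box_eq)
  finally show "emeasure (distr lborel borel ?R) ?B = (\<Prod>b\<in>Basis. (u - l) \<bullet> b)" .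
qed simp


lemma AE_lebesgue_on_disk_iff:
  "(AE z in disk_area. P z) \<longleftrightarrow> (AE z in lebesgue. z \<in> unit_disk \<longrightarrow> P z)"
  by (simp add: AE_restrict_space_iff)

lemma AE_lebesgue_rotate:
  assumes "AE z in lebesgue. P (z::complex)"
  shows "AE z in lebesgue. P (cis \<beta> * z)"
proof -
  have [measurable]: "(\<lambda>z::complex. cis \<beta> * z) \<in> borel_measurable borel"
    by (intro borel_measurable_continuous_onI continuous_intros)
  have "AE z in lborel. P z"
    using assms by (simp add: AE_completion_iff)
  then have "AE z in distr lborel borel (\<lambda>z::complex. cis \<beta> * z). P z"
    by (subst lborel_rotate)
  then have "AE z in lborel. P (cis \<beta> * z)"
    by (rule AE_distrD[rotated]) simp
  then show ?thesis by (simp add: AE_completion_iff)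
qed

lemma AE_disk_rotate:
  assumes "AE z in disk_area. P z"
  shows "AE z in disk_area. P (cis \<beta> * z)"
  using AE_lebesgue_rotate[of "\<lambda>z. z \<in> unit_disk \<longrightarrow> P z" \<beta>] assms
  by (simp add: AE_lebesgue_on_disk_iff norm_mult)

lemma measure_lebesgue_rotate:
  assumes "S \<in> sets borel"
  shows "measure lebesgue {z::complex. cis \<beta> * z \<in> S} = measure lebesgue S"
proof -
  have [measurable]: "(\<lambda>z::complex. cis \<beta> * z) \<in> borel_measurable borel"
    by (intro borel_measurable_continuous_onI continuous_intros)
  have e: "{z::complex. cis \<beta> * z \<in> S} = (\<lambda>z. cis \<beta> * z) -` S \<inter> space lborel" by auto
  have "{z::complex. cis \<beta> * z \<in> S} \<in> sets borel"
    unfolding e using assms by measurable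
  then have "measure lebesgue {z::complex. cis \<beta> * z \<in> S} = measure lborel {z. cis \<beta> * z \<in> S}"
    by simp
  also have "\<dots> = measure (distr lborel borel (\<lambda>z::complex. cis \<beta> * z)) S"
    using assms by (simp add: measure_distr e)
  finally show ?thesis using assms by (simp add: lborel_rotate)
qed

text \<open>
  Essential boundedness is the regularity of all data below: rearrangements of a member of \<open>V_space\<close>
  have it, it is stable under sums and products, and it implies integrability.
\<close>

definition ess_bdd :: "(complex \<Rightarrow> real) \<Rightarrow> bool" where
  "ess_bdd f \<longleftrightarrow> f \<in> borel_measurable (disk_area) \<and>
     (\<exists>M. AE z in disk_area. \<bar>f z\<bar> \<le> M)"

lemma finite_measure_disk: "finite_measure (disk_area)"
  by (rule finite_measure_lebesgue_on) simp

lemma ess_bdd_integrable: "ess_bdd f \<Longrightarrow> integrable (disk_area) f"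
  using finite_measure.integrable_const_bound[OF finite_measure_disk, of f]
  by (auto simp: ess_bdd_def)

lemma ess_bdd_measurable: "ess_bdd f \<Longrightarrow> f \<in> borel_measurable (disk_area)"
  by (auto simp: ess_bdd_def)

lemma ess_bdd_add: "ess_bdd f \<Longrightarrow> ess_bdd g \<Longrightarrow> ess_bdd (\<lambda>z. f z + g z)"
  unfolding ess_bdd_def
proof (elim conjE exE, intro conjI)
  fix M N assume "AE z in disk_area. \<bar>f z\<bar> \<le> M" "AE z in disk_area. \<bar>g z\<bar> \<le> N"
  then have "AE z in disk_area. \<bar>f z + g z\<bar> \<le> M + N"
    by eventually_elim linarith
  then show "\<exists>M. AE z in disk_area. \<bar>f z + g z\<bar> \<le> M" ..
qed measurable

lemma ess_bdd_mult: "ess_bdd f \<Longrightarrow> ess_bdd g \<Longrightarrow> ess_bdd (\<lambda>z. f z * g z)"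
  unfolding ess_bdd_def
proof (elim conjE exE, intro conjI)
  fix M N assume "AE z in disk_area. \<bar>f z\<bar> \<le> M" "AE z in disk_area. \<bar>g z\<bar> \<le> N"
  then have "AE z in disk_area. \<bar>f z * g z\<bar> \<le> \<bar>M\<bar> * \<bar>N\<bar>"
    by eventually_elim (auto simp: abs_mult intro!: mult_mono)
  then show "\<exists>M. AE z in disk_area. \<bar>f z * g z\<bar> \<le> M" ..
qed measurable

lemma ess_bdd_const: "ess_bdd (\<lambda>z. c)"
  by (auto simp: ess_bdd_def)

lemma ess_bdd_diff: "ess_bdd f \<Longrightarrow> ess_bdd g \<Longrightarrow> ess_bdd (\<lambda>z. f z - g z)"
  using ess_bdd_add[OF _ ess_bdd_mult[OF ess_bdd_const[of "-1"]], of f g] by simp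

lemma ess_bdd_power: "ess_bdd f \<Longrightarrow> ess_bdd (\<lambda>z. f z ^ k)"
  by (induction k) (simp_all add: ess_bdd_const ess_bdd_mult)

lemma ess_bdd_continuous:
  assumes "continuous_on (cball 0 1) f" shows "ess_bdd f"
  unfolding ess_bdd_def
proof
  show "f \<in> borel_measurable (disk_area)"
    by (rule continuous_imp_measurable_on_sets_lebesgue)
       (simp_all add: continuous_on_subset[OF assms ball_subset_cball])
  have "compact (f ` cball 0 1)"
    by (rule compact_continuous_image[OF assms]) simp
  then obtain M where "\<And>z. z \<in> cball 0 1 \<Longrightarrow> \<bar>f z\<bar> \<le> M"
    using compact_imp_bounded bounded_iff by (metis imageI real_norm_def)
  then have "AE z in disk_area. \<bar>f z\<bar> \<le> M"
    by (intro AE_I2) auto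
  then show "\<exists>M. AE z in disk_area. \<bar>f z\<bar> \<le> M" ..
qed

lemma ess_bdd_AE:
  assumes "ess_bdd f" "AE z in disk_area. f z = g z"
  shows "ess_bdd g"
proof -
  obtain M where M: "AE z in disk_area. \<bar>f z\<bar> \<le> M"
    using assms(1) by (auto simp: ess_bdd_def)
  have "f \<in> borel_measurable (disk_area)"
    using assms(1) by (rule ess_bdd_measurable)
  then have "(\<lambda>z. if z \<in> unit_disk then f z else 0) \<in> borel_measurable lebesgue"
    by (subst borel_measurable_if) simp_all
  moreover have "AE z in lebesgue. (if z \<in> unit_disk then f z else 0) = (if z \<in> unit_disk then g z else 0)"
    using assms(2) unfolding AE_lebesgue_on_disk_iff by eventually_elim auto
  ultimately have "(\<lambda>z. if z \<in> unit_disk then g z else 0) \<in> borel_measurable lebesgue"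
    by (rule borel_measurable_AE)
  then have "g \<in> borel_measurable (disk_area)"
    by (subst (asm) borel_measurable_if) simp_all
  moreover have "AE z in disk_area. \<bar>g z\<bar> \<le> M"
    using M assms(2) by eventually_elim simp
  ultimately show ?thesis by (auto simp: ess_bdd_def)
qed

text \<open>
  This replaces integration in polar coordinates. It suffices to compare the measures of the half-lines
  \<open>{x<..}\<close>, which is the area formula for disks.
\<close>

lemma distr_disk_norm_sq:
  "distr (disk_area) borel (\<lambda>z. nsq z)
     = density lborel (\<lambda>t. ennreal pi * indicator {0..<1} t)"
proof (rule measure_eqI_lessThan)
  have m: "(\<lambda>z. nsq z) \<in> borel_measurable (disk_area)"
    by (rule continuous_imp_measurable_on_sets_lebesgue) (auto intro!: continuous_intros)
  fix x :: real
  have area: "emeasure lborel (cball (0::complex) r) = ennreal (pi * r\<^sup>2)" if "r \<ge> 0" for r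
    using emeasure_cball[of r "0::complex"] that by (simp add: unit_ball_vol_2)
  have area1: "emeasure lborel (ball (0::complex) 1) = ennreal pi"
    using emeasure_ball[of 1 "0::complex"] by (simp add: unit_ball_vol_2)
  have eq: "emeasure (distr (disk_area) borel (\<lambda>z. nsq z)) {x<..}
     = emeasure lborel ({z. nsq z > x} \<inter> unit_disk)"
  proof -
    have b: "{z. nsq z > x} \<inter> unit_disk \<in> sets borel"
      by (intro borel_open open_Int open_Collect_less continuous_intros open_ball)
    have "emeasure (distr (disk_area) borel (\<lambda>z. nsq z)) {x<..}
      = emeasure (disk_area) ((\<lambda>z. nsq z) -` {x<..} \<inter> unit_disk)"
      using m by (simp add: emeasure_distr)
    also have "(\<lambda>z. nsq z) -` {x<..} \<inter> unit_disk = {z. nsq z > x} \<inter> unit_disk" by auto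
    finally show ?thesis using b by (simp add: emeasure_restrict_space)
  qed
  have val: "emeasure lborel ({z. nsq z > x} \<inter> unit_disk) =
     ennreal pi * emeasure lborel ({0..<1} \<inter> {x<..})"
  proof (cases "x < 0")
    case True
    then have a: "{z. nsq z > x} \<inter> unit_disk = unit_disk"
      by (auto intro: less_le_trans)
    have b: "{0..<1} \<inter> {x<..} = {0..<1}" using True by auto
    show ?thesis unfolding a b by (simp add: area1)
  next
    case False
    show ?thesis
    proof (cases "x < 1")
      case True
      have r: "sqrt x \<ge> 0" "sqrt x < 1" using False True by auto
      have le: "nsq z \<le> x \<longleftrightarrow> cmod z \<le> sqrt x" for z
        using False by (metis norm_ge_zero not_less real_sqrt_abs2 abs_of_nonneg power2_eq_square real_sqrt_le_iff)
      have a: "{z. nsq z > x} \<inter> unit_disk = unit_disk - cball 0 (sqrt x)"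
        using order.strict_trans1[OF _ r(2)] by (auto simp: not_le[symmetric] le)
      have "emeasure lborel (unit_disk - cball 0 (sqrt x))
          = emeasure lborel unit_disk - emeasure lborel (cball (0::complex) (sqrt x))"
        using r order.strict_trans1[OF _ r(2)] by (intro emeasure_Diff) (auto simp: area)
      also have "\<dots> = ennreal (pi - pi * x)"
        using r False by (simp add: area area1 ennreal_minus)
      finally have 1: "emeasure lborel (unit_disk - cball 0 (sqrt x)) = ennreal (pi * (1 - x))"
        by (simp add: algebra_simps)
      have b: "{0..<1} \<inter> {x<..} = {x<..<1}" using False by auto
      show ?thesis unfolding a b 1 using True by (simp add: ennreal_mult')
    next
      case f: False
      have "cmod z < 1 \<Longrightarrow> nsq z < 1" for z
        by (simp add: power_less_one_iff abs_square_less_1)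
      then have a: "{z. nsq z > x} \<inter> unit_disk = {}" using f by force
      have b: "{0..<1} \<inter> {x<..} = {}" using f by auto
      show ?thesis unfolding a b by simp
    qed
  qed
  have dens: "emeasure (density lborel (\<lambda>t. ennreal pi * indicator {0..<1} t)) {x<..} =
     ennreal pi * emeasure lborel ({0..<1} \<inter> {x<..})"
    by (simp add: emeasure_density nn_integral_cmult mult.assoc indicator_inter_arith[symmetric])
  show "emeasure (distr (disk_area) borel (\<lambda>z. nsq z)) {x<..} =
      emeasure (density lborel (\<lambda>t. ennreal pi * indicator {0..<1} t)) {x<..}"
    by (simp only: eq val dens)
  have "emeasure lborel ({z. nsq z > x} \<inter> unit_disk) \<le> emeasure lborel (ball (0::complex) 1)"
    by (intro emeasure_mono) auto
  then show "emeasure (distr (disk_area) borel (\<lambda>z. nsq z)) {x<..} < \<infinity>"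
    unfolding eq area1 using le_less_trans ennreal_less_top by (metis infinity_ennreal_def)
qed simp_all

lemma integral_disk_radial:
  fixes h :: "real \<Rightarrow> real"
  assumes "continuous_on {0..1} h"
  shows "(LINT z|disk_area. h (nsq z)) = pi * integral {0..1} h"
proof -
  define g where "g t = (if t \<in> {0..1} then h t else 0)" for t
  have g: "g \<in> borel_measurable borel"
    unfolding g_def using borel_measurable_continuous_on_if[of "{0..1}" h "\<lambda>_. 0"] assms by auto
  have m: "(\<lambda>z. nsq z) \<in> borel_measurable (disk_area)"
    by (rule continuous_imp_measurable_on_sets_lebesgue) (auto intro!: continuous_intros)
  have "cmod z < 1 \<Longrightarrow> nsq z \<le> 1" for z by (simp add: power_le_one)
  then have "(LINT z|disk_area. h (nsq z)) = (LINT z|disk_area. g (nsq z))"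
    by (intro Bochner_Integration.integral_cong) (auto simp: g_def)
  also have "\<dots> = integral\<^sup>L (distr (disk_area) borel (\<lambda>z. nsq z)) g"
    by (rule integral_distr[symmetric]) (use m g in auto)
  also have "\<dots> = integral\<^sup>L (density lborel (\<lambda>t. ennreal (pi * indicator {0..<1} t))) g"
    unfolding distr_disk_norm_sq
    by (intro arg_cong2[where f="integral\<^sup>L"] arg_cong[where f="density lborel"] ext)
       (auto simp: indicator_def)
  also have "\<dots> = (LINT t|lborel. (pi * indicator {0..<1} t) * g t)"
    by (subst integral_density) (use g in auto)
  also have "\<dots> = (LINT t|lborel. pi * (indicator {0..1} t * h t))"
  proof (rule integral_cong_AE)
    have "AE t in lborel. t \<noteq> (1::real)" by (rule AE_lborel_singleton)
    then show "AE t in lborel. (pi * indicator {0..<1} t) * g t = pi * (indicator {0..1} t * h t)"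
      by eventually_elim (auto simp: g_def indicator_def)
    have "(\<lambda>t. pi * (indicator {0..1} t * h t)) = (\<lambda>t. pi * g t)"
      by (auto simp: g_def indicator_def)
    then show "(\<lambda>t. pi * (indicator {0..1} t * h t)) \<in> borel_measurable lborel"
      using g by simp
  qed (use g in simp)
  also have "\<dots> = pi * (LINT t:{0..1}|lborel. h t)"
    by (simp add: set_lebesgue_integral_def)
  also have "(LINT t:{0..1}|lborel. h t) = integral {0..1} h"
    by (rule set_borel_integral_eq_integral)
       (use borel_integrable_atLeastAtMost'[OF assms] in simp)
  finally show ?thesis .
qed

section \<open>Angular modes and polynomials on the disk\<close>

lemma integral_disk_rotate:
  fixes f :: "complex \<Rightarrow> real"
  assumes "continuous_on (cball 0 1) f"
  shows "(LINT z|disk_area. f (cis \<beta> * z)) = (LINT z|disk_area. f z)"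
proof -
  let ?g = "\<lambda>z. indicator unit_disk z *\<^sub>R f z"
  have g [measurable]: "?g \<in> borel_measurable borel"
    by (intro borel_measurable_continuous_on_indicator continuous_on_subset[OF assms ball_subset_cball]) simp
  have R [measurable]: "(\<lambda>z::complex. cis \<beta> * z) \<in> borel_measurable borel"
    by (intro borel_measurable_continuous_onI continuous_intros)
  have *: "(LINT z|disk_area. h z) = (LINT z|lebesgue. indicator unit_disk z *\<^sub>R h z)"
    for h :: "complex \<Rightarrow> real"
    by (subst integral_restrict_space) auto
  have "(LINT z|disk_area. f (cis \<beta> * z)) = (LINT z|lebesgue. ?g (cis \<beta> * z))"
    unfolding * by (intro Bochner_Integration.integral_cong) (auto simp: indicator_def norm_mult)
  also have "\<dots> = (LINT z|lborel. ?g (cis \<beta> * z))"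
    by (rule integral_completion) (use measurable_compose[OF R g] in simp)
  also have "\<dots> = integral\<^sup>L (distr lborel borel (\<lambda>z. cis \<beta> * z)) ?g"
    by (rule integral_distr[symmetric]) (use g in simp_all)
  also have "\<dots> = (LINT z|lborel. ?g z)" by (subst lborel_rotate) simp
  also have "\<dots> = (LINT z|disk_area. f z)"
    unfolding * by (rule integral_completion[symmetric]) (use g in simp)
  finally show ?thesis .
qed

lemma continuous_on_radial:
  assumes "continuous_on {0..1} h"
  shows "continuous_on (cball 0 1) (\<lambda>z. h (nsq z))"
  by (rule continuous_on_compose2[OF assms]) (auto intro!: continuous_intros simp: power_le_one)

text \<open>
  The rotation by \<open>pi / k\<close> changes the sign of \<open>z ^ k\<close>, so the integral equals its own negative.
\<close>

lemma integral_disk_harmonic_radial: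
  assumes h: "continuous_on {0..1} h"
  shows "(LINT z|disk_area. Re (z ^ k) * h (nsq z)) =
           (if k = 0 then pi * integral {0..1} h else 0)"
    and "(LINT z|disk_area. Im (z ^ k) * h (nsq z)) = 0"
proof -
  have rot: "(cis (pi / real k) * z) ^ k = - (z ^ k)" if "k \<noteq> 0" for z
    using that Complex.DeMoivre[of "pi / real k" k] by (simp add: power_mult_distrib)
  have c: "continuous_on (cball 0 1) (\<lambda>z. Re (z ^ k) * h (nsq z))"
     "continuous_on (cball 0 1) (\<lambda>z. Im (z ^ k) * h (nsq z))"
    by (intro continuous_intros continuous_on_radial h)+
  show "(LINT z|disk_area. Re (z ^ k) * h (nsq z)) =
           (if k = 0 then pi * integral {0..1} h else 0)"
  proof (cases "k = 0")
    case True then show ?thesis by (simp add: integral_disk_radial[OF h])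
  next
    case False
    then show ?thesis
      using integral_disk_rotate[OF c(1), of "pi / real k"] by (simp add: rot norm_mult)
  qed
  show "(LINT z|disk_area. Im (z ^ k) * h (nsq z)) = 0"
  proof (cases "k = 0")
    case False
    then show ?thesis
      using integral_disk_rotate[OF c(2), of "pi / real k"] by (simp add: rot norm_mult)
  qed simp
qed

text \<open>
  The index pairs a frequency with the choice between \<open>r\<^sup>n cos (n \<theta>)\<close> (\<open>True\<close>) and \<open>r\<^sup>n sin (n \<theta>)\<close>
  (\<open>False\<close>). The index \<open>(0, False)\<close> stands for the zero function.
\<close>

definition harm :: "nat \<times> bool \<Rightarrow> complex \<Rightarrow> real" where
  "harm i z = (if snd i then Re (z ^ fst i) else Im (z ^ fst i))"

text \<open>
  The square norm of \<open>cos (n \<theta>)\<close> or \<open>sin (n \<theta>)\<close> on the circle, halved because \<open>r dr = dt / 2\<close>.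
\<close>

definition harm_weight :: "nat \<times> bool \<Rightarrow> real" where
  "harm_weight i = (if fst i = 0 then (if snd i then pi else 0) else pi / 2)"

abbreviation (input) mode_fun :: "nat \<times> bool \<Rightarrow> real poly \<Rightarrow> complex \<Rightarrow> real" where
  "mode_fun i q z \<equiv> harm i z * poly q ((cmod z)\<^sup>2)"

lemma continuous_on_harm [continuous_intros]: "continuous_on S (harm i)"
proof -
  have "continuous_on S (\<lambda>z. Re (z ^ fst i))" "continuous_on S (\<lambda>z. Im (z ^ fst i))"
    by (intro continuous_intros)+
  then show ?thesis unfolding harm_def by (cases "snd i") auto
qed

lemma harm_le: "\<bar>harm i z\<bar> \<le> cmod z ^ fst i"
  using abs_Re_le_cmod[of "z ^ fst i"] abs_Im_le_cmod[of "z ^ fst i"]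
  by (auto simp: harm_def norm_power)

lemma harm_le_1: "z \<in> cball 0 1 \<Longrightarrow> \<bar>harm i z\<bar> \<le> 1"
  using harm_le[of i z] power_le_one[of "cmod z" "fst i"] by simp

text \<open>
  Addition theorem: a product of two harmonics is a combination of the harmonics of frequencies
  \<open>n + m\<close> and \<open>n - m\<close>. It gives orthogonality as well as closure of \<open>disk_poly\<close> under products.
\<close>

lemma harm_mult:
  assumes "m \<le> n"
  shows "harm (n, b) z * harm (m, c) z =
    (if b = c then (harm (n - m, True) z * nsq z ^ m + (if b then 1 else -1) * harm (n + m, True) z) / 2
     else (harm (n + m, False) z + (if b then -1 else 1) * harm (n - m, False) z * nsq z ^ m) / 2)"
proof -
  let ?A = "z ^ n" and ?B = "z ^ m"
  have AB: "?A * ?B = z ^ (n + m)" by (simp add: power_add)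
  have "?A = z ^ (n - m) * z ^ m" using assms by (simp add: power_add[symmetric])
  then have "?A * cnj ?B = z ^ (n - m) * (z * cnj z) ^ m"
    by (simp add: power_mult_distrib)
  then have AcB: "?A * cnj ?B = z ^ (n - m) * complex_of_real (nsq z ^ m)"
    by (simp only: complex_norm_square[symmetric] of_real_power)
  have "Re (?A * ?B) = Re (z ^ (n + m))" "Im (?A * ?B) = Im (z ^ (n + m))"
    by (simp_all only: AB)
  moreover have "Re (?A * cnj ?B) = Re (z ^ (n - m)) * nsq z ^ m"
    "Im (?A * cnj ?B) = Im (z ^ (n - m)) * nsq z ^ m"
    by (simp_all only: AcB Re_complex_of_real Im_complex_of_real times_complex.simps)
  ultimately show ?thesis
    by (auto simp: harm_def simp del: complex_cnj_power)
qed

lemma harm_orthogonal: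
  assumes h: "continuous_on {0..1} h"
  shows "(LINT z|disk_area. harm i z * harm j z * h (nsq z)) =
    (if i = j then harm_weight i * integral {0..1} (\<lambda>t. t ^ fst i * h t) else 0)"
proof -
  have main: "(LINT z|disk_area. harm (n, b) z * harm (m, c) z * h (nsq z)) =
    (if (n, b) = (m, c) then harm_weight (n, b) * integral {0..1} (\<lambda>t. t ^ n * h t) else 0)"
    if le: "m \<le> n" for n m b c
  proof -
    let ?g = "\<lambda>t. t ^ m * h t"
    have g: "continuous_on {0..1} ?g" by (intro continuous_intros h)
    have int: "integrable (disk_area) (\<lambda>z. harm i z * k (nsq z))"
      if "continuous_on {0..1} k" for i k
      by (intro ess_bdd_integrable ess_bdd_continuous continuous_intros continuous_on_radial that)
    have R: "(LINT z|disk_area. harm (k, True) z * f (nsq z)) =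
           (if k = 0 then pi * integral {0..1} f else 0)"
      and I: "(LINT z|disk_area. harm (k, False) z * f (nsq z)) = 0"
      if "continuous_on {0..1} f" for k f
      using integral_disk_harmonic_radial[OF that] by (simp_all add: harm_def)
    show ?thesis
    proof (cases "b = c")
      case True
      have "(LINT z|disk_area. harm (n, b) z * harm (m, c) z * h (nsq z)) =
         (LINT z|disk_area. (1/2) * (harm (n - m, True) z * ?g (nsq z))
            + (if b then 1/2 else -1/2) * (harm (n + m, True) z * h (nsq z)))"
        using True by (intro Bochner_Integration.integral_cong)
          (simp_all only: harm_mult[OF le], simp_all add: algebra_simps add_divide_distrib diff_divide_distrib)
      also have "\<dots> = (1/2) * (LINT z|disk_area. harm (n - m, True) z * ?g (nsq z))
           + (if b then 1/2 else -1/2) * (LINT z|disk_area. harm (n + m, True) z * h (nsq z))"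
        using int[OF g] int[OF h]
        by (subst Bochner_Integration.integral_add)
           (intro integrable_mult_right | simp only: integral_mult_right_zero)+
      also have "\<dots> = (if (n, b) = (m, c) then harm_weight (n, b) * integral {0..1} (\<lambda>t. t ^ n * h t) else 0)"
        unfolding R[OF g] R[OF h] using True le by (auto simp: harm_weight_def)
      finally show ?thesis .
    next
      case False
      have "(LINT z|disk_area. harm (n, b) z * harm (m, c) z * h (nsq z)) =
         (LINT z|disk_area. (if b then -1/2 else 1/2) * (harm (n - m, False) z * ?g (nsq z))
            + (1/2) * (harm (n + m, False) z * h (nsq z)))"
        using False by (intro Bochner_Integration.integral_cong)
          (simp_all only: harm_mult[OF le], simp_all add: algebra_simps add_divide_distrib diff_divide_distrib)
      also have "\<dots> = (if b then -1/2 else 1/2) * (LINT z|disk_area. harm (n - m, False) z * ?g (nsq z))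
           + (1/2) * (LINT z|disk_area. harm (n + m, False) z * h (nsq z))"
        using int[OF g] int[OF h]
        by (subst Bochner_Integration.integral_add)
           (intro integrable_mult_right | simp only: integral_mult_right_zero)+
      also have "\<dots> = 0" unfolding I[OF g] I[OF h] by simp
      finally show ?thesis using False by simp
    qed
  qed
  obtain n b m c where ij: "i = (n, b)" "j = (m, c)" by (cases i, cases j) auto
  show ?thesis
  proof (cases "m \<le> n")
    case True then show ?thesis using main[of m n b c] by (simp add: ij)
  next
    case False
    then show ?thesis using main[of n m c b]
      by (simp add: ij mult.commute[of "harm (n, b) _"] mult.assoc) 
  qed
qed

text \<open>
  Finite sums of modes with polynomial profiles. These are all real polynomials in the two
  coordinates (\<open>disk_poly_real_polynomial\<close>), hence dense, and the Laplacian acts on each summand separately.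
\<close>

inductive disk_poly :: "(complex \<Rightarrow> real) \<Rightarrow> bool" where
  mode: "disk_poly (\<lambda>z. mode_fun i q z)"
| add: "disk_poly f \<Longrightarrow> disk_poly g \<Longrightarrow> disk_poly (\<lambda>z. f z + g z)"

lemma disk_poly_const: "disk_poly (\<lambda>z. c)"
  using disk_poly.mode[of "(0, True)" "[:c:]"] by (simp add: harm_def)

lemma disk_poly_sum:
  "finite I \<Longrightarrow> disk_poly (\<lambda>z. \<Sum>i\<in>I. mode_fun (\<phi> i) (q i) z)"
proof (induction I rule: finite_induct)
  case empty then show ?case using disk_poly_const[of 0] by simp
next
  case (insert i I)
  then show ?case
    using disk_poly.add[OF disk_poly.mode insert.IH, of "\<phi> i" "q i"] by simp
qed

lemma disk_poly_repr:
  assumes "disk_poly p"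
  obtains N q where "p = (\<lambda>z. \<Sum>i\<in>{..N} \<times> UNIV. mode_fun i (q i) z)"
proof -
  have "\<exists>N q. (\<forall>i. fst i > N \<longrightarrow> q i = 0) \<and> p = (\<lambda>z. \<Sum>i\<in>{..N} \<times> UNIV. mode_fun i (q i) z)"
    using assms
  proof induction
    case (mode i q)
    show ?case
    proof (rule exI[of _ "fst i"], rule exI[of _ "\<lambda>j. if j = i then q else 0"], intro conjI ext)
      fix z
      have "(\<Sum>j\<in>{..fst i} \<times> UNIV. mode_fun j (if j = i then q else 0) z)
        = (\<Sum>j\<in>{..fst i} \<times> UNIV. if j = i then mode_fun i q z else 0)"
        by (intro sum.cong) auto
      also have "\<dots> = mode_fun i q z"
        by (simp add: mem_Times_iff)
      finally show "mode_fun i q z = (\<Sum>j\<in>{..fst i} \<times> UNIV. mode_fun j (if j = i then q else 0) z)" ..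
    qed auto
  next
    case (add f g)
    from add.IH(1) obtain N q where N: "\<forall>i. fst i > N \<longrightarrow> q i = 0"
      "f = (\<lambda>z. \<Sum>i\<in>{..N} \<times> UNIV. mode_fun i (q i) z)"
      by (elim exE conjE)
    from add.IH(2) obtain M r where M: "\<forall>i. fst i > M \<longrightarrow> r i = 0"
      "g = (\<lambda>z. \<Sum>i\<in>{..M} \<times> UNIV. mode_fun i (r i) z)"
      by (elim exE conjE)
    let ?K = "max N M"
    have pad: "(\<Sum>i\<in>{..A} \<times> UNIV. mode_fun i (s i) z)
       = (\<Sum>i\<in>{..?K} \<times> UNIV. mode_fun i (s i) z)"
      if "A \<le> ?K" "\<forall>i. fst i > A \<longrightarrow> s i = 0" for A s z
    proof (rule sum.mono_neutral_left)
      show "\<forall>i\<in>{..?K} \<times> UNIV - {..A} \<times> UNIV. mode_fun i (s i) z = 0"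
      proof
        fix i assume "i \<in> {..?K} \<times> UNIV - {..A} \<times> (UNIV :: bool set)"
        then have "fst i > A" by (cases i) auto
        then show "mode_fun i (s i) z = 0" using that(2)[rule_format, of i] by simp
      qed
    qed (use that(1) in auto)
    show ?case
    proof (rule exI[of _ ?K], rule exI[of _ "\<lambda>i. q i + r i"], intro conjI ext)
      fix z
      show "f z + g z = (\<Sum>i\<in>{..?K} \<times> UNIV. mode_fun i (q i + r i) z)"
        unfolding N(2) M(2) using pad[of N q z] pad[of M r z] N(1) M(1)
        by (simp add: distrib_left sum.distrib)
    qed (use N M in auto)
  qed
  then show ?thesis using that by blast
qed

lemma disk_poly_mult_mode:
  "disk_poly (\<lambda>z. (mode_fun i q z) * (mode_fun j r z))"
proof -
  have main: "disk_poly (\<lambda>z. (mode_fun (n, b) q z) * (mode_fun (m, c) r z))"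
    if le: "m \<le> n" for n m b c q r
  proof (cases "b = c")
    case True
    have eq: "(\<lambda>z. (mode_fun (n, b) q z) * (mode_fun (m, c) r z)) =
      (\<lambda>z. mode_fun (n - m, True) ([:1/2:] * monom 1 m * q * r) z
          + mode_fun (n + m, True) ([:if b then 1/2 else -1/2:] * q * r) z)" (is "?l = ?r")
    proof
      fix z
      have "?l z = harm (n, b) z * harm (m, c) z * (poly q (nsq z) * poly r (nsq z))" by simp
      then show "?l z = ?r z"
        using True by (simp only: harm_mult[OF le]) (simp add: poly_monom algebra_simps add_divide_distrib diff_divide_distrib)
    qed
    show ?thesis unfolding eq by (rule disk_poly.add; rule disk_poly.mode)
  next
    case False
    have eq: "(\<lambda>z. (mode_fun (n, b) q z) * (mode_fun (m, c) r z)) =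
      (\<lambda>z. mode_fun (n + m, False) ([:1/2:] * q * r) z
          + mode_fun (n - m, False) ([:if b then -1/2 else 1/2:] * monom 1 m * q * r) z)" (is "?l = ?r")
    proof
      fix z
      have "?l z = harm (n, b) z * harm (m, c) z * (poly q (nsq z) * poly r (nsq z))" by simp
      then show "?l z = ?r z"
        using False by (simp only: harm_mult[OF le]) (simp add: poly_monom algebra_simps add_divide_distrib diff_divide_distrib)
    qed
    show ?thesis unfolding eq by (rule disk_poly.add; rule disk_poly.mode)
  qed
  obtain n b m c where ij: "i = (n, b)" "j = (m, c)" by (cases i, cases j) auto
  show ?thesis
  proof (cases "m \<le> n")
    case True then show ?thesis using main by (simp add: ij)
  next
    case False
    then show ?thesis using main[of n m c r b q] by (simp add: ij mult.commute)
  qed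
qed

lemma disk_poly_mult: "disk_poly f \<Longrightarrow> disk_poly g \<Longrightarrow> disk_poly (\<lambda>z. f z * g z)"
proof (induction f rule: disk_poly.induct)
  case (mode i q)
  from mode.prems show ?case
  proof induction
    case (mode j r) show ?case by (rule disk_poly_mult_mode)
  next
    case (add f g) then show ?case by (simp add: distrib_left disk_poly.add)
  qed
next
  case (add f h) then show ?case by (simp add: distrib_right disk_poly.add)
qed

lemma disk_poly_diff: "disk_poly f \<Longrightarrow> disk_poly g \<Longrightarrow> disk_poly (\<lambda>z. f z - g z)"
  using disk_poly.add[OF _ disk_poly_mult[OF disk_poly_const[of "-1"]], of f g] by simp

lemma continuous_on_disk_poly: "disk_poly p \<Longrightarrow> continuous_on S p"
  by (induction rule: disk_poly.induct) (auto intro!: continuous_intros)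

lemma ess_bdd_disk_poly: "disk_poly p \<Longrightarrow> ess_bdd p"
  by (intro ess_bdd_continuous continuous_on_disk_poly)

lemma disk_poly_real_polynomial:
  fixes p :: "complex \<Rightarrow> real"
  shows "real_polynomial_function p \<Longrightarrow> disk_poly p"
proof (induction rule: real_polynomial_function.induct)
  case (linear f)
  interpret bounded_linear f by fact
  have "f = (\<lambda>z. harm (1, True) z * poly [:f 1:] (nsq z) + harm (1, False) z * poly [:f \<i>:] (nsq z))"
  proof
    fix z
    have "z = Re z *\<^sub>R 1 + Im z *\<^sub>R \<i>" by (simp add: complex_eq_iff)
    then have "f z = Re z * f 1 + Im z * f \<i>" by (metis add scaleR real_scaleR_def)
    then show "f z = harm (1, True) z * poly [:f 1:] (nsq z) + harm (1, False) z * poly [:f \<i>:] (nsq z)"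
      by (simp add: harm_def)
  qed
  then show ?case by (rule ssubst) (rule disk_poly.add; rule disk_poly.mode)
next
  case (const c) show ?case by (rule disk_poly_const)
next
  case (add f g) from add.IH show ?case by (rule disk_poly.add)
next
  case (mult f g) from mult.IH show ?case by (rule disk_poly_mult)
qed

lemma bounded_convergence_disk:
  fixes f :: "nat \<Rightarrow> complex \<Rightarrow> real"
  assumes "\<And>n. f n \<in> borel_measurable (disk_area)"
    and "\<And>n. AE z in disk_area. \<bar>f n z\<bar> \<le> M"
    and "AE z in disk_area. (\<lambda>n. f n z) \<longlonglongrightarrow> g z"
    and "g \<in> borel_measurable (disk_area)"
  shows "(\<lambda>n. LINT z|disk_area. f n z) \<longlonglongrightarrow> (LINT z|disk_area. g z)"
  by (rule integral_dominated_convergence[where w="\<lambda>_. M"])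
     (use assms finite_measure.integrable_const[OF finite_measure_disk] in auto)

text \<open>
  A bounded measurable function is an almost everywhere limit of continuous ones, which may be truncated
  at its bound; the Stone-Weierstrass theorem replaces them by polynomials.
\<close>

lemma disk_poly_dense:
  assumes v: "ess_bdd v"
  obtains p M where "\<And>n. disk_poly (p n)" "\<And>n z. z \<in> cball 0 1 \<Longrightarrow> \<bar>p n z\<bar> \<le> M"
    "AE z in disk_area. (\<lambda>n. p n z) \<longlonglongrightarrow> v z"
proof -
  obtain M where M: "AE z in disk_area. \<bar>v z\<bar> \<le> M" using v by (auto simp: ess_bdd_def)
  have "v measurable_on unit_disk"
    using ess_bdd_measurable[OF v] by (simp add: measurable_on_iff_borel_measurable)
  then obtain N g where N: "negligible N" and g: "\<And>n::nat. continuous_on UNIV (g n)"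
    and lim: "\<And>z. z \<notin> N \<Longrightarrow> (\<lambda>n. g n z) \<longlonglongrightarrow> (if z \<in> unit_disk then v z else 0)"
    unfolding measurable_on_def by blast
  define g' where "g' n z = max (- \<bar>M\<bar>) (min \<bar>M\<bar> (g n z))" for n z
  have g'c: "continuous_on (cball 0 1) (g' n)" for n
    unfolding g'_def by (intro continuous_intros continuous_on_subset[OF g]) auto
  have "\<exists>p. disk_poly p \<and> (\<forall>z\<in>cball 0 1. \<bar>g' n z - p z\<bar> < 1 / real (Suc n))" for n
    using Stone_Weierstrass_real_polynomial_function[of "cball 0 1" "g' n" "1 / real (Suc n)"] g'c
      disk_poly_real_polynomial by (metis compact_cball of_nat_0_less_iff zero_less_Suc zero_less_divide_1_iff)
  then obtain p where p: "\<And>n. disk_poly (p n)"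
    and pg: "\<And>n z. z \<in> cball 0 1 \<Longrightarrow> \<bar>g' n z - p n z\<bar> < 1 / real (Suc n)" by metis
  have b: "\<bar>p n z\<bar> \<le> \<bar>M\<bar> + 1" if "z \<in> cball 0 1" for n z
  proof -
    have "\<bar>g' n z\<bar> \<le> \<bar>M\<bar>" unfolding g'_def by auto
    moreover have "1 / real (Suc n) \<le> 1" by simp
    ultimately show ?thesis using pg[OF that, of n] by linarith
  qed
  have "AE z in lebesgue. z \<notin> N" using N by (simp add: negligible_iff_null_sets AE_not_in)
  then have "AE z in lebesgue. z \<in> unit_disk \<longrightarrow> (\<lambda>n. p n z) \<longlonglongrightarrow> v z"
    using M unfolding AE_lebesgue_on_disk_iff
  proof eventually_elim
    case (elim z)
    show ?case
    proof
      assume z: "z \<in> unit_disk"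
      then have "(\<lambda>n. g n z) \<longlonglongrightarrow> v z" using lim[of z] elim by simp
      then have "(\<lambda>n. g' n z) \<longlonglongrightarrow> max (- \<bar>M\<bar>) (min \<bar>M\<bar> (v z))"
        unfolding g'_def by (intro tendsto_intros)
      then have 1: "(\<lambda>n. g' n z) \<longlonglongrightarrow> v z" using elim z by (auto simp: max_def min_def split: if_splits)
      have "(\<lambda>n. g' n z - p n z) \<longlonglongrightarrow> 0"
      proof (rule tendsto_rabs_zero_cancel, rule tendsto_sandwich[OF _ _ tendsto_const])
        show "(\<lambda>n. 1 / real (Suc n)) \<longlonglongrightarrow> 0" using LIMSEQ_inverse_real_of_nat by (simp add: inverse_eq_divide)
        show "\<forall>\<^sub>F n in sequentially. \<bar>g' n z - p n z\<bar> \<le> 1 / real (Suc n)"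
          using pg[of z] z by (intro always_eventually allI less_imp_le) auto
      qed auto
      from tendsto_diff[OF 1 this] show "(\<lambda>n. p n z) \<longlonglongrightarrow> v z" by simp
    qed
  qed
  then have "AE z in disk_area. (\<lambda>n. p n z) \<longlonglongrightarrow> v z"
    by (simp add: AE_lebesgue_on_disk_iff)
  from that[OF p b this] show ?thesis .
qed

lemma integral_disk_poly_limit:
  assumes w: "ess_bdd w" and v: "ess_bdd v" and p: "\<And>n. disk_poly (p n)" "\<And>n z. z \<in> cball 0 1 \<Longrightarrow> \<bar>p n z\<bar> \<le> M"
    "AE z in disk_area. (\<lambda>n. p n z) \<longlonglongrightarrow> v z"
  shows "(\<lambda>n. LINT z|disk_area. w z * p n z) \<longlonglongrightarrow> (LINT z|disk_area. w z * v z)"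
proof -
  obtain K where K: "AE z in disk_area. \<bar>w z\<bar> \<le> K" using w by (auto simp: ess_bdd_def)
  show ?thesis
  proof (rule bounded_convergence_disk[where M="\<bar>K\<bar> * \<bar>M\<bar>"])
    show "(\<lambda>z. w z * p n z) \<in> borel_measurable (disk_area)" for n
      by (intro ess_bdd_measurable ess_bdd_mult w ess_bdd_disk_poly p)
    show "(\<lambda>z. w z * v z) \<in> borel_measurable (disk_area)"
      by (intro ess_bdd_measurable ess_bdd_mult w v)
    show "AE z in disk_area. \<bar>w z * p n z\<bar> \<le> \<bar>K\<bar> * \<bar>M\<bar>" for n
      using K AE_space
    proof eventually_elim
      case (elim z)
      then have "\<bar>p n z\<bar> \<le> \<bar>M\<bar>" using p(2)[of z n] by auto
      then show ?case using elim by (auto simp: abs_mult intro!: mult_mono)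
    qed
    show "AE z in disk_area. (\<lambda>n. w z * p n z) \<longlonglongrightarrow> w z * v z"
      using p(3) by eventually_elim (intro tendsto_intros)
  qed
qed

text \<open>
  Approximating \<open>v\<close> by polynomials gives \<open>\<integral> v\<^sup>2 = 0\<close>.
\<close>

lemma AE_0_if_orthogonal_to_disk_polys:
  assumes v: "ess_bdd v" and orth: "\<And>p. disk_poly p \<Longrightarrow> (LINT z|disk_area. v z * p z) = 0"
  shows "AE z in disk_area. v z = 0"
proof -
  obtain p M where p: "\<And>n. disk_poly (p n)" "\<And>n z. z \<in> cball 0 1 \<Longrightarrow> \<bar>p n z\<bar> \<le> M"
    "AE z in disk_area. (\<lambda>n. p n z) \<longlonglongrightarrow> v z" using disk_poly_dense[OF v] by metis
  have "(\<lambda>n. LINT z|disk_area. v z * p n z) \<longlonglongrightarrow> (LINT z|disk_area. v z * v z)"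
    by (rule integral_disk_poly_limit[OF v v p])
  then have "(LINT z|disk_area. v z * v z) = 0"
    using orth[OF p(1)] by (simp add: LIMSEQ_const_iff)
  then have "AE z in disk_area. v z * v z = 0"
    by (subst (asm) integral_nonneg_eq_0_iff_AE) (auto intro: ess_bdd_integrable ess_bdd_mult v)
  then show ?thesis by simp
qed

section \<open>Test functions and the Laplacian of a mode\<close>

lemma partial_deriv_eq: "(f has_derivative f') (at x) \<Longrightarrow> partial_deriv b f x = f' b"
  unfolding partial_deriv_def using frechet_derivative_at by metis

lemma differentiable_continuous_on:
  fixes f :: "'a::real_normed_vector \<Rightarrow> 'b::real_normed_vector"
  shows "(\<And>x. f differentiable (at x)) \<Longrightarrow> continuous_on S f"
  by (meson continuous_at_imp_continuous_on differentiable_imp_continuous_within)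

lemma C_k_all_if_closed:
  fixes S :: "('a::euclidean_space \<Rightarrow> real) set"
  assumes "\<And>f x. f \<in> S \<Longrightarrow> f differentiable (at x)"
    and "\<And>f b. f \<in> S \<Longrightarrow> b \<in> Basis \<Longrightarrow> partial_deriv b f \<in> S"
  shows "f \<in> S \<Longrightarrow> C_k k f"
proof (induction k arbitrary: f)
  case 0
  then show ?case
    using assms(1) differentiable_continuous_on[of f] by auto
next
  case (Suc k)
  then show ?case using assms by auto
qed

text \<open>
  An algebra of functions closed under partial derivatives, so all its members are smooth. The
  sequence \<open>\<eta>\<close> is meant to consist of the successive derivatives of one radial profile.
\<close>

inductive smooth_alg :: "(nat \<Rightarrow> real \<Rightarrow> real) \<Rightarrow> (complex \<Rightarrow> real) \<Rightarrow> bool" for \<eta> where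
  const: "smooth_alg \<eta> (\<lambda>z. c)"
| Re: "smooth_alg \<eta> Re"
| Im: "smooth_alg \<eta> Im"
| profile: "smooth_alg \<eta> (\<lambda>z. \<eta> m (nsq z))"
| add: "smooth_alg \<eta> f \<Longrightarrow> smooth_alg \<eta> g \<Longrightarrow> smooth_alg \<eta> (\<lambda>z. f z + g z)"
| mult: "smooth_alg \<eta> f \<Longrightarrow> smooth_alg \<eta> g \<Longrightarrow> smooth_alg \<eta> (\<lambda>z. f z * g z)"

lemma has_derivative_norm_sq: "((\<lambda>z::complex. nsq z) has_derivative (\<lambda>h. 2 * (z \<bullet> h))) (at z)"
  unfolding power2_norm_eq_inner
  by (auto intro!: derivative_eq_intros simp: inner_commute)

lemma has_derivative_radial:
  assumes "(f has_real_derivative D) (at (nsq z))"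
  shows "((\<lambda>z. f (nsq z)) has_derivative (\<lambda>h. D * (2 * (z \<bullet> h)))) (at z)"
  using has_derivative_compose[OF has_derivative_norm_sq, of f "(*) D" z] assms
  by (simp add: has_field_derivative_def)

lemma smooth_alg_cmul: "smooth_alg \<eta> f \<Longrightarrow> smooth_alg \<eta> (\<lambda>z. c * f z)"
  by (rule smooth_alg.mult[OF smooth_alg.const])

lemma smooth_alg_closed:
  assumes \<eta>: "\<And>m t. (\<eta> m has_real_derivative \<eta> (Suc m) t) (at t)"
    and "smooth_alg \<eta> f"
  shows "(\<forall>z. f differentiable (at z)) \<and> (\<forall>b. smooth_alg \<eta> (partial_deriv b f))"
  using assms(2)
proof (induction rule: smooth_alg.induct)
  case (const c)
  have "partial_deriv b (\<lambda>z::complex. c) = (\<lambda>z. 0)" for b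
    by (rule ext, rule partial_deriv_eq) (rule has_derivative_const)
  then show ?case by (simp add: smooth_alg.const)
next
  case Re
  have d: "(Re has_derivative Re) (at z)" for z
    by (rule bounded_linear_imp_has_derivative[OF bounded_linear_Re])
  have "partial_deriv b Re = (\<lambda>z. Re b)" for b
    by (rule ext, rule partial_deriv_eq[OF d])
  then show ?case using d by (auto simp: smooth_alg.const differentiable_def)
next
  case Im
  have d: "(Im has_derivative Im) (at z)" for z
    by (rule bounded_linear_imp_has_derivative[OF bounded_linear_Im])
  have "partial_deriv b Im = (\<lambda>z. Im b)" for b
    by (rule ext, rule partial_deriv_eq[OF d])
  then show ?case using d by (auto simp: smooth_alg.const differentiable_def)
next
  case (profile m)
  note d = has_derivative_radial[OF \<eta>]
  have "partial_deriv b (\<lambda>z. \<eta> m (nsq z)) =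
     (\<lambda>z. \<eta> (Suc m) (nsq z) * (2 * Re b * Re z + 2 * Im b * Im z))" for b
    by (rule ext) (subst partial_deriv_eq[OF d], simp add: inner_complex_def)
  moreover have "smooth_alg \<eta> (\<lambda>z. \<eta> (Suc m) (nsq z) * (2 * Re b * Re z + 2 * Im b * Im z))" for b
    by (rule smooth_alg.mult[OF smooth_alg.profile smooth_alg.add[OF smooth_alg_cmul[OF smooth_alg.Re] smooth_alg_cmul[OF smooth_alg.Im]]])
  moreover have "(\<lambda>z. \<eta> m (nsq z)) differentiable (at z)" for z
    by (rule differentiableI[OF d])
  ultimately show ?case by simp
next
  case (add f g)
  have df: "(f has_derivative frechet_derivative f (at z)) (at z)"
    and dg: "(g has_derivative frechet_derivative g (at z)) (at z)" for z
    using add.IH frechet_derivative_works by blast+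
  have "partial_deriv b (\<lambda>z. f z + g z) = (\<lambda>z. partial_deriv b f z + partial_deriv b g z)" for b
    by (rule ext) (subst partial_deriv_eq[OF has_derivative_add[OF df dg]], simp add: partial_deriv_def)
  then show ?case using add.IH by (auto intro: smooth_alg.add)
next
  case (mult f g)
  have df: "(f has_derivative frechet_derivative f (at z)) (at z)"
    and dg: "(g has_derivative frechet_derivative g (at z)) (at z)" for z
    using mult.IH frechet_derivative_works by blast+
  have "partial_deriv b (\<lambda>z. f z * g z) = (\<lambda>z. f z * partial_deriv b g z + partial_deriv b f z * g z)" for b
    by (rule ext) (subst partial_deriv_eq[OF has_derivative_mult[OF df dg]], simp add: partial_deriv_def)
  moreover have "smooth_alg \<eta> (\<lambda>z. f z * partial_deriv b g z + partial_deriv b f z * g z)" for b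
    using mult by (intro smooth_alg.add smooth_alg.mult) auto
  ultimately show ?case using mult.IH by (auto intro!: differentiable_mult)
qed

lemma smooth_alg_C_k:
  assumes "\<And>m t. (\<eta> m has_real_derivative \<eta> (Suc m) t) (at t)" "smooth_alg \<eta> f"
  shows "C_k k f"
  using C_k_all_if_closed[of "Collect (smooth_alg \<eta>)" f k] smooth_alg_closed[of \<eta>, OF assms(1)] assms(2) by simp

lemma smooth_alg_harm: "smooth_alg \<eta> (harm i)"
proof -
  have "smooth_alg \<eta> (\<lambda>z. Re (z ^ n)) \<and> smooth_alg \<eta> (\<lambda>z. Im (z ^ n))" for n
  proof (induction n)
    case 0 then show ?case by (simp add: smooth_alg.const)
  next
    case (Suc n)
    have "smooth_alg \<eta> (\<lambda>z. Re z * Re (z ^ n) + (-1) * (Im z * Im (z ^ n)))"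
      "smooth_alg \<eta> (\<lambda>z. Re z * Im (z ^ n) + Im z * Re (z ^ n))"
      by (intro smooth_alg.add smooth_alg.mult smooth_alg.Re smooth_alg.Im smooth_alg.const Suc[THEN conjunct1] Suc[THEN conjunct2])+
    then show ?case by simp
  qed
  then show ?thesis by (cases "snd i") (simp_all add: harm_def[abs_def])
qed

lemma smooth_alg_poly: "smooth_alg \<eta> (\<lambda>z. poly q (nsq z))"
proof (induction q)
  case 0 then show ?case by (simp add: smooth_alg.const)
next
  case (pCons a q)
  have "smooth_alg \<eta> (\<lambda>z. a + (Re z * Re z + Im z * Im z) * poly q (nsq z))"
    by (intro smooth_alg.add smooth_alg.mult smooth_alg.Re smooth_alg.Im smooth_alg.const pCons.IH)
  moreover have "nsq z = Re z * Re z + Im z * Im z" for z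
    unfolding cmod_power2 by (simp add: power2_eq_square)
  ultimately show ?case by simp
qed

lemma disk_poly_smooth_alg: "disk_poly p \<Longrightarrow> smooth_alg \<eta> p"
  by (induction rule: disk_poly.induct)
     (intro smooth_alg.add smooth_alg.mult smooth_alg_harm smooth_alg_poly | assumption)+

lemma disk_poly_C_k: "disk_poly p \<Longrightarrow> C_k k p"
  by (rule smooth_alg_C_k[of "\<lambda>_ _. 0"]) (auto intro: disk_poly_smooth_alg)

text \<open>
  \<open>Re (z\<^sup>n)\<close> and \<open>Im (z\<^sup>n)\<close> are harmonic, and by Euler's relation the mixed term \<open>2 \<nabla> f \<cdot> \<nabla> harm\<close> is
  \<open>4 n f'\<close> times the harmonic.
\<close>

lemma laplacian_mode:
  assumes f: "\<And>t. (f has_real_derivative f' t) (at t)" and f': "\<And>t. (f' has_real_derivative f'' t) (at t)"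
  shows "laplacian (\<lambda>z. harm i z * f (nsq z)) z =
     4 * harm i z * (nsq z * f'' (nsq z) + (real (fst i) + 1) * f' (nsq z))"
proof -
  let ?n = "fst i"
  define L where "L = (if snd i then Re else Im)"
  have L: "bounded_linear L" by (simp add: L_def bounded_linear_Re bounded_linear_Im)
  interpret L: bounded_linear L by (rule L)
  have harm: "harm i = (\<lambda>z. L (z ^ ?n))" by (auto simp: harm_def L_def)
  have dp: "((\<lambda>z. L (a * z ^ k * b)) has_derivative (\<lambda>h. L (a * (of_nat k * z ^ (k - 1) * h) * b))) (at z)" for z a b k
    by (rule L.has_derivative) (auto intro!: derivative_eq_intros)
  let ?F = "\<lambda>z. harm i z * f (nsq z)"
  have dF: "(?F has_derivative (\<lambda>h. L (z ^ ?n) * (f' (nsq z) * (2 * (z \<bullet> h)))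
       + L (of_nat ?n * z ^ (?n - 1) * h) * f (nsq z))) (at z)" for z
    unfolding harm using has_derivative_mult[OF dp[of 1 ?n 1 z] has_derivative_radial[OF f]] by simp
  have pF: "partial_deriv b ?F = (\<lambda>z. L (z ^ ?n) * (f' (nsq z) * (2 * (z \<bullet> b)))
       + L (of_nat ?n * z ^ (?n - 1) * b) * f (nsq z))" for b
    by (rule ext, rule partial_deriv_eq[OF dF])
  have d1: "((\<lambda>z. L (z ^ ?n) * (f' (nsq z) * (2 * (z \<bullet> b)))) has_derivative
      (\<lambda>h. L (z ^ ?n) * (f' (nsq z) * (2 * (h \<bullet> b)) + f'' (nsq z) * (2 * (z \<bullet> h)) * (2 * (z \<bullet> b)))
        + L (of_nat ?n * z ^ (?n - 1) * h) * (f' (nsq z) * (2 * (z \<bullet> b))))) (at z)" for b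
  proof -
    have "((\<lambda>z. 2 * (z \<bullet> b)) has_derivative (\<lambda>h. 2 * (h \<bullet> b))) (at z)"
      by (auto intro!: derivative_eq_intros)
    from has_derivative_mult[OF dp[of 1 ?n 1 z] has_derivative_mult[OF has_derivative_radial[OF f'] this]]
    show ?thesis by simp
  qed
  have d2: "((\<lambda>z. L (of_nat ?n * z ^ (?n - 1) * b) * f (nsq z)) has_derivative
      (\<lambda>h. L (of_nat ?n * z ^ (?n - 1) * b) * (f' (nsq z) * (2 * (z \<bullet> h)))
       + L (of_nat ?n * (of_nat (?n - 1) * z ^ (?n - 1 - 1) * h) * b) * f (nsq z))) (at z)" for b
    by (rule has_derivative_mult[OF dp has_derivative_radial[OF f]])
  have ppF: "partial_deriv b (partial_deriv b ?F) z =
     (L (z ^ ?n) * (f' (nsq z) * (2 * (b \<bullet> b)) + f'' (nsq z) * (2 * (z \<bullet> b)) * (2 * (z \<bullet> b)))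
        + L (of_nat ?n * z ^ (?n - 1) * b) * (f' (nsq z) * (2 * (z \<bullet> b))))
     + (L (of_nat ?n * z ^ (?n - 1) * b) * (f' (nsq z) * (2 * (z \<bullet> b)))
       + L (of_nat ?n * (of_nat (?n - 1) * z ^ (?n - 1 - 1) * b) * b) * f (nsq z))" for b
    unfolding pF by (rule partial_deriv_eq[OF has_derivative_add[OF d1 d2]])
  have euler: "L (of_nat ?n * z ^ (?n - 1) * 1) * Re z + L (of_nat ?n * z ^ (?n - 1) * \<i>) * Im z = real ?n * L (z ^ ?n)"
  proof -
    have "L (of_nat ?n * z ^ (?n - 1) * 1) * Re z + L (of_nat ?n * z ^ (?n - 1) * \<i>) * Im z
       = L (of_nat ?n * z ^ (?n - 1) * (Re z *\<^sub>R 1 + Im z *\<^sub>R \<i>))"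
      by (simp add: distrib_left L.add L.scaleR)
    also have "Re z *\<^sub>R 1 + Im z *\<^sub>R \<i> = z" by (simp add: complex_eq_iff)
    also have "of_nat ?n * z ^ (?n - 1) * z = real ?n *\<^sub>R z ^ ?n"
      by (cases ?n) (simp_all add: scaleR_conv_of_real)
    finally show ?thesis by (simp add: L.scaleR)
  qed
  have opp: "L (of_nat ?n * (of_nat (?n - 1) * z ^ (?n - 1 - 1) * \<i>) * \<i>)
      = - L (of_nat ?n * (of_nat (?n - 1) * z ^ (?n - 1 - 1) * 1) * 1)"
    by (simp only: L.neg[symmetric]) (simp add: mult.assoc)
  have t: "Re z * Re z + Im z * Im z = nsq z" unfolding cmod_power2 by (simp add: power2_eq_square)
  have "laplacian ?F z = partial_deriv 1 (partial_deriv 1 ?F) z + partial_deriv \<i> (partial_deriv \<i> ?F) z"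
    by (simp add: laplacian_def Basis_complex_def)
  also have "\<dots> = L (z ^ ?n) * (4 * f' (nsq z) + 4 * f'' (nsq z) * (Re z * Re z + Im z * Im z))
     + 4 * f' (nsq z) * (L (of_nat ?n * z ^ (?n - 1) * 1) * Re z + L (of_nat ?n * z ^ (?n - 1) * \<i>) * Im z)"
    unfolding ppF opp by (simp add: inner_complex_def algebra_simps)
  also have "\<dots> = 4 * harm i z * (nsq z * f'' (nsq z) + (real ?n + 1) * f' (nsq z))"
    unfolding euler t by (simp add: harm algebra_simps)
  finally show ?thesis .
qed

lemma partial_deriv_eq_0_outside:
  assumes "z \<notin> closure {z. W z \<noteq> 0}"
  shows "partial_deriv b W z = 0"
proof -
  have "(W has_derivative (\<lambda>_. 0)) (at z)"
  proof (rule has_derivative_transform_within_open[where f="\<lambda>_. 0" and s="- closure {z. W z \<noteq> 0}"])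
    show "\<And>x. x \<in> - closure {z. W z \<noteq> 0} \<Longrightarrow> 0 = W x"
      using closure_subset[of "{z. W z \<noteq> 0}"] by auto
  qed (use assms in auto)
  then show ?thesis using partial_deriv_eq by metis
qed

text \<open>
  Lebesgue measure is translation invariant, so every difference quotient integrates to zero, and the
  derivative is a bounded limit of difference quotients.
\<close>

lemma integral_partial_deriv_0:
  fixes W :: "complex \<Rightarrow> real"
  assumes W: "\<And>z. W differentiable (at z)" and cont: "continuous_on UNIV (partial_deriv b W)"
    and supp: "closure {z. W z \<noteq> 0} \<subseteq> unit_disk" and b: "norm b \<le> 1"
  shows "(LINT z|disk_area. partial_deriv b W z) = 0"
proof -
  have contW: "continuous_on UNIV W"
    using W by (rule differentiable_continuous_on)
  have W0: "W z = 0" if "z \<notin> unit_disk" for z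
    using that supp closure_subset[of "{z. W z \<noteq> 0}"] by auto
  have P0: "partial_deriv b W z = 0" if "z \<notin> unit_disk" for z
    using that supp partial_deriv_eq_0_outside by blast
  have "compact (partial_deriv b W ` cball 0 1)"
    by (intro compact_continuous_image continuous_on_subset[OF cont]) auto
  then obtain K where K: "\<And>z. z \<in> cball 0 1 \<Longrightarrow> \<bar>partial_deriv b W z\<bar> \<le> K"
    using compact_imp_bounded bounded_iff by (metis imageI real_norm_def)
  have bound: "\<bar>partial_deriv b W z\<bar> \<le> \<bar>K\<bar>" for z
    using K[of z] P0[of z] by (cases "z \<in> unit_disk") auto
  define Q where "Q n z = real (Suc n) * (W (z + (1 / real (Suc n)) *\<^sub>R b) - W z)" for n z
  have line: "((\<lambda>t. W (z + t *\<^sub>R b)) has_real_derivative partial_deriv b W (z + t *\<^sub>R b)) (at t)" for z t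
  proof -
    have d: "(W has_derivative frechet_derivative W (at (z + t *\<^sub>R b))) (at (z + t *\<^sub>R b))"
      using W frechet_derivative_works by blast
    interpret bounded_linear "frechet_derivative W (at (z + t *\<^sub>R b))"
      using d by (rule has_derivative_bounded_linear)
    have "((\<lambda>t. z + t *\<^sub>R b) has_derivative (\<lambda>h. h *\<^sub>R b)) (at t)"
      by (auto intro!: derivative_eq_intros)
    from has_derivative_compose[OF this d] show ?thesis
      by (simp add: has_field_derivative_def partial_deriv_def scaleR mult.commute[of _ "frechet_derivative _ _ _"])
  qed
  have Qb: "\<bar>Q n z\<bar> \<le> \<bar>K\<bar>" for n z
  proof -
    have "(0::real) < 1 / real (Suc n)" by simp
    from MVT2[OF this, of "\<lambda>t. W (z + t *\<^sub>R b)" "\<lambda>t. partial_deriv b W (z + t *\<^sub>R b)"] line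
    obtain t where "W (z + (1 / real (Suc n)) *\<^sub>R b) - W z = (1 / real (Suc n)) * partial_deriv b W (z + t *\<^sub>R b)"
      by auto
    then have "Q n z = partial_deriv b W (z + t *\<^sub>R b)" by (simp add: Q_def field_simps)
    then show ?thesis using bound by simp
  qed
  have Qlim: "(\<lambda>n. Q n z) \<longlonglongrightarrow> partial_deriv b W z" for z
  proof -
    have "((\<lambda>h. (W (z + h *\<^sub>R b) - W z) / h) \<longlongrightarrow> partial_deriv b W z) (at 0)"
      using line[of z 0] by (simp add: DERIV_def)
    moreover have "filterlim (\<lambda>n. 1 / real (Suc n)) (at 0) sequentially"
      unfolding filterlim_at
      using LIMSEQ_inverse_real_of_nat by (auto simp: inverse_eq_divide)
    ultimately have "(\<lambda>n. (W (z + (1 / real (Suc n)) *\<^sub>R b) - W z) / (1 / real (Suc n))) \<longlonglongrightarrow> partial_deriv b W z"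
      by (rule filterlim_compose)
    then show ?thesis by (simp add: Q_def mult.commute)
  qed
  have Wint: "integrable lborel W"
  proof -
    have "integrable lborel (\<lambda>x. indicator (cball 0 1) x *\<^sub>R W x)"
      using borel_integrable_compact[of "cball 0 1" W] contW continuous_on_subset by auto
    moreover have "(\<lambda>x. indicator (cball 0 1) x *\<^sub>R W x) = W"
      using W0 by (auto simp: indicator_def fun_eq_iff)
    ultimately show ?thesis by simp
  qed
  have meas [measurable]: "W \<in> borel_measurable borel" "partial_deriv b W \<in> borel_measurable borel"
    using contW cont by (auto intro: borel_measurable_continuous_onI)
  have shift: "(\<lambda>z. z + c) \<in> borel_measurable borel" for c :: complex
    by measurable
  have Qmeas: "Q n \<in> borel_measurable borel" for n
    unfolding Q_def[abs_def] by measurable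
  have trans_int: "integrable lborel (\<lambda>z. W (z + c))" and trans: "(LINT z|lborel. W (z + c)) = (LINT z|lborel. W z)" for c
  proof -
    have d: "distr lborel borel (\<lambda>z. z + c) = (lborel :: complex measure)"
      by (subst add.commute) (rule lborel_distr_plus)
    show "integrable lborel (\<lambda>z. W (z + c))"
      using Wint integrable_distr_eq[of "\<lambda>z. z + c" lborel borel W] by (simp add: d)
    show "(LINT z|lborel. W (z + c)) = (LINT z|lborel. W z)"
      using integral_distr[of "\<lambda>z. z + c" lborel borel W] by (simp add: d)
  qed
  have QI: "(LINT z|lborel. Q n z) = 0" for n
    unfolding Q_def using trans_int Wint trans by simp
  have Q0: "Q n z = 0" if "z \<notin> cball 0 2" for n z
  proof -
    define h where "h = (1 / real (Suc n)) *\<^sub>R b"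
    have n: "norm h \<le> 1"
      using b by (auto simp: h_def field_simps intro: order_trans)
    have "norm z > 2" using that by simp
    then have "norm (z + h) \<ge> 1"
      using n norm_triangle_ineq4[of "z + h" h] by simp
    then show ?thesis unfolding Q_def h_def[symmetric] using W0 \<open>norm z > 2\<close> by simp
  qed
  have "(\<lambda>n. LINT z|lborel. Q n z) \<longlonglongrightarrow> (LINT z|lborel. partial_deriv b W z)"
  proof (rule integral_dominated_convergence[where w="\<lambda>z. indicator (cball 0 2) z * \<bar>K\<bar>"])
    show "AE z in lborel. norm (Q n z) \<le> indicator (cball 0 2) z * \<bar>K\<bar>" for n
      using Qb Q0 by (auto simp: indicator_def)
    show "integrable lborel (\<lambda>z::complex. indicator (cball 0 2) z * \<bar>K\<bar>)"
      by (intro integrable_mult_left integrable_real_indicator) (use emeasure_bounded_finite[of "cball (0::complex) 2"] in simp_all)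
  qed (use Qmeas Qlim in auto)
  then have "(LINT z|lborel. partial_deriv b W z) = 0"
    using QI by (simp add: LIMSEQ_const_iff)
  also have "(LINT z|lborel. partial_deriv b W z) = (LINT z|lebesgue. partial_deriv b W z)"
    by (rule integral_completion[symmetric]) simp
  also have "\<dots> = (LINT z|disk_area. partial_deriv b W z)"
    by (subst integral_restrict_space) (auto intro!: Bochner_Integration.integral_cong simp: indicator_def P0)
  finally show ?thesis .
qed

lemma C_k_SucD:
  assumes "C_k (Suc k) f"
  shows "\<And>x. f differentiable (at x)" "\<And>b. b \<in> Basis \<Longrightarrow> C_k k (partial_deriv b f)"
  using assms by auto

lemma continuous_on_C_k: "C_k k f \<Longrightarrow> continuous_on S f"
proof (cases k)
  case 0
  assume "C_k k f"
  then show ?thesis using 0 continuous_on_subset by fastforce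
next
  case (Suc m)
  assume "C_k k f"
  then show ?thesis
    using Suc differentiable_continuous_on[of f] by auto
qed

text \<open>
  The field \<open>U \<nabla> \<phi> - \<phi> \<nabla> U\<close> has compact support, inherited from \<open>\<phi>\<close>, and divergence \<open>U \<Delta> \<phi> - \<phi> \<Delta> U\<close>.
\<close>

lemma green_test_function:
  assumes U: "\<And>k. C_k k U" and \<phi>: "disk_test_function \<phi>"
  shows "(LINT z|disk_area. U z * (- laplacian \<phi> z)) = (LINT z|disk_area. (- laplacian U z) * \<phi> z)"
proof -
  have \<phi>C: "\<And>k. C_k k \<phi>" and supp: "closure {x. \<phi> x \<noteq> 0} \<subseteq> unit_disk"
    using \<phi> by (auto simp: disk_test_function_def)
  define W where "W b z = U z * partial_deriv b \<phi> z - \<phi> z * partial_deriv b U z" for b z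
  have C: "C_k k (partial_deriv b U)" "C_k k (partial_deriv b \<phi>)"
     "C_k k (partial_deriv b (partial_deriv b U))" "C_k k (partial_deriv b (partial_deriv b \<phi>))"
    if "b \<in> Basis" for b k
    using U[of "Suc k"] \<phi>C[of "Suc k"] U[of "Suc (Suc k)"] \<phi>C[of "Suc (Suc k)"] that by auto
  have fd: "(f has_derivative (\<lambda>h. frechet_derivative f (at z) h)) (at z)" if "\<And>k. C_k k f" for f :: "complex \<Rightarrow> real" and z
    using C_k_SucD(1)[OF that[of "Suc 0"]] frechet_derivative_works by blast
  have dW: "(W b has_derivative (\<lambda>h. (U z * frechet_derivative (partial_deriv b \<phi>) (at z) h
      + frechet_derivative U (at z) h * partial_deriv b \<phi> z)
      - (\<phi> z * frechet_derivative (partial_deriv b U) (at z) h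
      + frechet_derivative \<phi> (at z) h * partial_deriv b U z))) (at z)" if "b \<in> Basis" for b z
    unfolding W_def[abs_def]
    by (intro has_derivative_diff has_derivative_mult fd U \<phi>C C that)
  have pW: "partial_deriv b (W b) = (\<lambda>z. U z * partial_deriv b (partial_deriv b \<phi>) z - \<phi> z * partial_deriv b (partial_deriv b U) z)"
    if "b \<in> Basis" for b
    by (rule ext) (subst partial_deriv_eq[OF dW[OF that]], simp add: partial_deriv_def)
  have cW: "continuous_on S (partial_deriv b (W b))" if "b \<in> Basis" for b S
    unfolding pW[OF that] by (intro continuous_intros continuous_on_C_k[OF U[of 0]] continuous_on_C_k[OF \<phi>C[of 0]] continuous_on_C_k[OF C(3)[OF that, of 0]] continuous_on_C_k[OF C(4)[OF that, of 0]])
  have zero: "(LINT z|disk_area. partial_deriv b (W b) z) = 0" if "b \<in> Basis" for b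
  proof (rule integral_partial_deriv_0)
    show "W b differentiable (at z)" for z using dW[OF that] by (auto simp: differentiable_def)
    show "continuous_on UNIV (partial_deriv b (W b))" by (rule cW[OF that])
    have "{z. W b z \<noteq> 0} \<subseteq> closure {x. \<phi> x \<noteq> 0}"
    proof
      fix z assume z: "z \<in> {z. W b z \<noteq> 0}"
      show "z \<in> closure {x. \<phi> x \<noteq> 0}"
      proof (rule ccontr)
        assume n: "z \<notin> closure {x. \<phi> x \<noteq> 0}"
        then have "\<phi> z = 0" using closure_subset[of "{x. \<phi> x \<noteq> 0}"] by auto
        then show False using z partial_deriv_eq_0_outside[OF n, of b] by (simp add: W_def)
      qed
    qed
    then have "closure {z. W b z \<noteq> 0} \<subseteq> closure {x. \<phi> x \<noteq> 0}"
      by (metis closure_closure closure_mono)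
    then show "closure {z. W b z \<noteq> 0} \<subseteq> unit_disk" using supp by blast
    show "norm b \<le> 1" using that by simp
  qed
  have contL: "continuous_on S (laplacian f)" if "\<And>k. C_k k f" for f :: "complex \<Rightarrow> real" and S
    unfolding laplacian_def[abs_def]
    by (intro continuous_on_sum) (use that[of "Suc (Suc 0)"] continuous_on_subset in fastforce)
  have int: "integrable (disk_area) (\<lambda>z. partial_deriv b (W b) z)" if "b \<in> Basis" for b
    by (intro ess_bdd_integrable ess_bdd_continuous cW that)
  have "0 = (\<Sum>b\<in>Basis. LINT z|disk_area. partial_deriv b (W b) z)"
    using zero by simp
  also have "\<dots> = (LINT z|disk_area. (\<Sum>b\<in>Basis. partial_deriv b (W b) z))"
    by (rule Bochner_Integration.integral_sum[symmetric]) (use int in auto)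
  also have "\<dots> = (LINT z|disk_area. (- laplacian U z) * \<phi> z - U z * (- laplacian \<phi> z))"
    by (intro Bochner_Integration.integral_cong)
       (simp_all add: pW laplacian_def sum_subtractf sum_distrib_left sum_distrib_right mult.commute)
  also have "\<dots> = (LINT z|disk_area. (- laplacian U z) * \<phi> z) - (LINT z|disk_area. U z * (- laplacian \<phi> z))"
    by (intro Bochner_Integration.integral_diff ess_bdd_integrable ess_bdd_continuous continuous_intros contL U \<phi>C
        continuous_on_C_k[OF U[of 0]] continuous_on_C_k[OF \<phi>C[of 0]])
  finally show ?thesis by simp
qed

section \<open>Radial cutoffs\<close>

text \<open>
  Multiples of \<open>exp (- 1 / x)\<close> by polynomials in \<open>1 / x\<close>, extended by zero. This family is closed under
  differentiation, which makes each member smooth also at the origin.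
\<close>

definition flat :: "real poly \<Rightarrow> real \<Rightarrow> real" where
  "flat p x = (if x > 0 then poly p (1 / x) * exp (- (1 / x)) else 0)"

lemma poly_times_exp_tendsto_0: "((\<lambda>y::real. poly p y * exp (- y)) \<longlongrightarrow> 0) at_top"
proof -
  have "((\<lambda>y::real. \<Sum>i\<le>degree p. coeff p i * (y ^ i / exp y)) \<longlongrightarrow> 0) at_top"
    by (rule tendsto_null_sum) (intro tendsto_mult_right_zero tendsto_power_div_exp_0)
  moreover have "(\<Sum>i\<le>degree p. coeff p i * (y ^ i / exp y)) = poly p y * exp (- y)" for y
    by (simp add: poly_altdef sum_distrib_right exp_minus divide_simps)
  ultimately show ?thesis by simp
qed

lemma flat_tendsto_0: "(flat p \<longlongrightarrow> 0) (at 0)"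
proof -
  have "(flat p \<longlongrightarrow> 0) (at_right 0)"
  proof (rule Lim_transform_eventually)
    show "((\<lambda>x. poly p (inverse x) * exp (- inverse x)) \<longlongrightarrow> 0) (at_right 0)"
      by (rule filterlim_compose[OF poly_times_exp_tendsto_0 filterlim_inverse_at_top_right])
    show "\<forall>\<^sub>F x in at_right 0. poly p (inverse x) * exp (- inverse x) = flat p x"
      by (auto simp: eventually_at_filter flat_def inverse_eq_divide)
  qed
  moreover have "(flat p \<longlongrightarrow> 0) (at_left 0)"
  proof (rule Lim_transform_eventually[OF tendsto_const])
    show "\<forall>\<^sub>F x in at_left 0. 0 = flat p x"
      by (auto simp: eventually_at_filter flat_def)
  qed
  ultimately show ?thesis by (simp add: filterlim_at_split)
qed

lemma flat_has_derivative: "(flat p has_real_derivative flat ([:0, 0, 1:] * (p - pderiv p)) x) (at x)"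
proof -
  consider "x > 0" | "x < 0" | "x = 0" by linarith
  then show ?thesis
  proof cases
    case 1
    have "((\<lambda>x. poly p (1 / x) * exp (- (1 / x))) has_real_derivative
        poly ([:0, 0, 1:] * (p - pderiv p)) (1 / x) * exp (- (1 / x))) (at x)"
      using 1 by (auto intro!: derivative_eq_intros DERIV_chain2[OF poly_DERIV] simp: field_simps power2_eq_square)
    then have "(flat p has_real_derivative poly ([:0, 0, 1:] * (p - pderiv p)) (1 / x) * exp (- (1 / x))) (at x)"
      by (rule has_field_derivative_transform_within_open[where S="{0<..}"]) (use 1 in \<open>auto simp: flat_def\<close>)
    then show ?thesis using 1 by (simp add: flat_def)
  next
    case 2
    have "((\<lambda>_. 0) has_real_derivative 0) (at x)" by simp
    then have "(flat p has_real_derivative 0) (at x)"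
      by (rule has_field_derivative_transform_within_open[where S="{..<0}"]) (use 2 in \<open>auto simp: flat_def\<close>)
    then show ?thesis using 2 by (simp add: flat_def)
  next
    case 3
    have "((\<lambda>h. (flat p (0 + h) - flat p 0) / h) \<longlongrightarrow> 0) (at 0)"
    proof (rule Lim_transform_eventually[OF flat_tendsto_0[of "[:0, 1:] * p"]])
      show "\<forall>\<^sub>F h in at 0. flat ([:0, 1:] * p) h = (flat p (0 + h) - flat p 0) / h"
        by (auto simp: eventually_at_filter flat_def)
    qed
    then have "(flat p has_real_derivative 0) (at 0)" by (simp add: DERIV_def)
    then show ?thesis using 3 by (simp add: flat_def)
  qed
qed

primrec flat_poly :: "nat \<Rightarrow> real poly" where
  "flat_poly 0 = 1"
| "flat_poly (Suc m) = [:0, 0, 1:] * (flat_poly m - pderiv (flat_poly m))"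

text \<open>
  The \<open>m\<close>-th derivative in \<open>t\<close> of \<open>exp (- 1 / x)\<close>, where \<open>x = (1 - t) / \<epsilon> - 1\<close>. The cutoff vanishes for
  \<open>t \<ge> 1 - \<epsilon>\<close> and tends to \<open>1\<close> inside the disk as \<open>\<epsilon>\<close> tends to \<open>0\<close>. All cutoffs are rescalings of one profile at the
  boundary, so their derivatives obey scale-invariant bounds.
\<close>

definition cutoff :: "real \<Rightarrow> nat \<Rightarrow> real \<Rightarrow> real" where
  "cutoff \<epsilon> m t = (- 1 / \<epsilon>) ^ m * flat (flat_poly m) ((1 - t) / \<epsilon> - 1)"

lemma cutoff_has_derivative:
  "(cutoff \<epsilon> m has_real_derivative cutoff \<epsilon> (Suc m) t) (at t)"
proof -
  have "((\<lambda>t. (1 - t) / \<epsilon> - 1) has_real_derivative (- 1 / \<epsilon>)) (at t)"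
    by (cases "\<epsilon> = 0") (auto intro!: derivative_eq_intros simp: field_simps)
  from DERIV_cmult[OF DERIV_chain2[OF flat_has_derivative this], of "(- 1 / \<epsilon>) ^ m" "flat_poly m"]
  show ?thesis by (simp add: cutoff_def[abs_def] mult_ac)
qed

lemma cutoff_0_bounds: "0 \<le> cutoff \<epsilon> 0 t" "cutoff \<epsilon> 0 t \<le> 1"
  by (auto simp: cutoff_def flat_def)

lemma cutoff_eq_0: "\<epsilon> > 0 \<Longrightarrow> t \<ge> 1 - \<epsilon> \<Longrightarrow> cutoff \<epsilon> m t = 0"
  by (simp add: cutoff_def flat_def field_simps)

lemma cutoff_0_tendsto_1:
  assumes "t < 1" shows "(\<lambda>k. cutoff (1 / real (Suc k)) 0 t) \<longlonglongrightarrow> 1"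
proof -
  have lim: "filterlim (\<lambda>k. (1 - t) / (1 / real (Suc k)) - 1) at_top sequentially"
  proof -
    have "filterlim (\<lambda>k. -1 + (1 - t) * real (Suc k)) at_top sequentially"
      using assms by (intro filterlim_tendsto_add_at_top[OF tendsto_const] filterlim_tendsto_pos_mult_at_top[OF tendsto_const]
          filterlim_compose[OF filterlim_real_sequentially filterlim_Suc]) simp
    then show ?thesis by (simp add: algebra_simps)
  qed
  have "((\<lambda>x::real. exp (- (1 / x))) \<longlongrightarrow> exp (- 0)) at_top"
    by (intro tendsto_intros tendsto_divide_0[OF tendsto_const] filterlim_at_top_imp_at_infinity filterlim_ident)
  moreover have "\<forall>\<^sub>F x in at_top. exp (- (1 / x)) = flat 1 x"
    using eventually_gt_at_top[of "0::real"] by eventually_elim (simp add: flat_def)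
  ultimately have "(flat 1 \<longlongrightarrow> 1) at_top"
    using Lim_transform_eventually by fastforce
  from filterlim_compose[OF this lim] show ?thesis by (simp add: cutoff_def)
qed

text \<open>
  The factor \<open>1 - t\<close> in front of the second derivative comes from the test polynomial, which vanishes on
  the circle. The right-hand side is a Poisson-type kernel: its mass is bounded uniformly in \<open>\<epsilon>\<close> and
  concentrates at the boundary.
\<close>

lemma cutoff_derivatives_bound:
  assumes e: "\<epsilon> > 0" and t: "t \<le> 1"
  shows "\<bar>cutoff \<epsilon> 1 t\<bar> + (1 - t) * \<bar>cutoff \<epsilon> 2 t\<bar> \<le> 1536 * (\<epsilon> / (\<epsilon>\<^sup>2 + (1 - t)\<^sup>2))"
proof (cases "t \<ge> 1 - \<epsilon>")
  case True
  then show ?thesis using e by (simp add: cutoff_eq_0)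
next
  case False
  \<comment> \<open>In terms of \<open>y = 1 / x\<close>, where \<open>x = \<sigma> - 1\<close> is the argument of the cutoff, the claim is a bound for
    a polynomial of degree 4 times \<open>exp (- y)\<close>.\<close>
  define \<sigma> where "\<sigma> = (1 - t) / \<epsilon>"
  have s1: "\<sigma> > 1" using False e by (simp add: \<sigma>_def field_simps)
  define y where "y = 1 / (\<sigma> - 1)"
  have y: "y > 0" using s1 by (simp add: y_def)
  have \<sigma>: "\<sigma> = (1 + y) / y" using s1 by (simp add: y_def field_simps)
  have t': "1 - t = \<epsilon> * \<sigma>" using e by (simp add: \<sigma>_def)
  have p2: "flat_poly 1 = [:0, 0, 1:]" "flat_poly 2 = [:0, 0, 0, -2, 1:]"
    by (simp_all add: numeral_2_eq_2 pderiv_pCons)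
  have c1: "\<bar>cutoff \<epsilon> 1 t\<bar> = (1 / \<epsilon>) * (y\<^sup>2 * exp (- y))"
    using s1 e unfolding cutoff_def flat_def p2 \<sigma>_def[symmetric] y_def[symmetric]
    by (simp add: y_def[symmetric] power2_eq_square abs_mult)
  have c2: "\<bar>cutoff \<epsilon> 2 t\<bar> = (1 / \<epsilon>\<^sup>2) * (y\<^sup>2 * (y * \<bar>y - 2\<bar>) * exp (- y))"
  proof -
    have "cutoff \<epsilon> 2 t = (1 / \<epsilon>\<^sup>2) * (y\<^sup>2 * (y * (y - 2)) * exp (- y))"
      using s1 e unfolding cutoff_def flat_def p2 \<sigma>_def[symmetric] y_def[symmetric]
      by (simp add: y_def[symmetric] power2_eq_square algebra_simps)
    then show ?thesis using y by (simp add: abs_mult)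
  qed
  have "y / 4 + 1 \<le> exp (y / 4)" using exp_ge_add_one_self[of "y/4"] by linarith
  then have "1 + y \<le> 4 * exp (y / 4)" using y by simp
  then have "(1 + y) ^ 4 \<le> (4 * exp (y / 4)) ^ 4" using y by (intro power_mono) auto
  also have "\<dots> = 256 * exp y" by (simp add: power_mult_distrib exp_of_nat_mult[symmetric])
  finally have y4: "(1 + y) ^ 4 * exp (- y) \<le> 256"
    by (simp add: exp_minus divide_simps)
  have "\<bar>cutoff \<epsilon> 1 t\<bar> + (1 - t) * \<bar>cutoff \<epsilon> 2 t\<bar> = (1 / \<epsilon>) * (y\<^sup>2 * exp (- y) * (1 + (1 + y) * \<bar>y - 2\<bar>))"
    unfolding c1 c2 t' \<sigma> using e y by (simp add: field_simps power2_eq_square)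
  also have "\<dots> \<le> (1 / \<epsilon>) * (y\<^sup>2 * exp (- y) * (3 * (1 + y)\<^sup>2))"
  proof -
    have "(1 + y) * \<bar>y - 2\<bar> \<le> (1 + y) * (2 * (1 + y))" using y by (intro mult_left_mono) auto
    moreover have "1 \<le> (1 + y)\<^sup>2" using y by simp
    moreover have "(1 + y) * (2 * (1 + y)) = 2 * (1 + y)\<^sup>2" by (simp add: power2_eq_square)
    ultimately have "1 + (1 + y) * \<bar>y - 2\<bar> \<le> 3 * (1 + y)\<^sup>2" by linarith
    then show ?thesis using e y by (intro mult_left_mono) auto
  qed
  also have "\<dots> = (1 / \<epsilon>) * (y\<^sup>2 / (2 * (1 + y)\<^sup>2)) * (6 * ((1 + y) ^ 4 * exp (- y)))"
  proof -
    have "y\<^sup>2 * E * (3 * P) = y\<^sup>2 / (2 * P) * (6 * ((P * P) * E))" if "P > 0" for P E :: real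
      using that by (simp add: field_simps)
    from this[of "(1 + y)\<^sup>2"] show ?thesis
      using y by (simp add: power_add[symmetric])
  qed
  also have "\<dots> \<le> (1 / \<epsilon>) * (y\<^sup>2 / (2 * (1 + y)\<^sup>2)) * (6 * 256)"
    using y4 e y by (intro mult_left_mono) auto
  also have "\<dots> \<le> (1 / \<epsilon>) * (y\<^sup>2 / (y\<^sup>2 + (1 + y)\<^sup>2)) * (6 * 256)"
  proof -
    have "y\<^sup>2 \<le> (1 + y)\<^sup>2" using y by (intro power_mono) auto
    then have "y\<^sup>2 / (2 * (1 + y)\<^sup>2) \<le> y\<^sup>2 / (y\<^sup>2 + (1 + y)\<^sup>2)"
      using y by (intro divide_left_mono mult_pos_pos add_pos_pos) auto
    then show ?thesis using e by (intro mult_right_mono mult_left_mono) auto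
  qed
  also have "\<dots> = 1536 * (\<epsilon> / (\<epsilon>\<^sup>2 + (1 - t)\<^sup>2))"
  proof -
    have "\<epsilon>\<^sup>2 + (1 - t)\<^sup>2 = \<epsilon>\<^sup>2 * ((y\<^sup>2 + (1 + y)\<^sup>2) / y\<^sup>2)"
    proof -
      have "\<epsilon>\<^sup>2 + (1 - t)\<^sup>2 = \<epsilon>\<^sup>2 * (y\<^sup>2 / y\<^sup>2) + \<epsilon>\<^sup>2 * ((1 + y)\<^sup>2 / y\<^sup>2)"
        unfolding t' \<sigma> using y by (simp add: power_mult_distrib power_divide)
      also have "\<dots> = \<epsilon>\<^sup>2 * ((y\<^sup>2 + (1 + y)\<^sup>2) / y\<^sup>2)"
        by (simp only: add_divide_distrib distrib_left)
      finally show ?thesis .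
    qed
    then show ?thesis using e y by (simp add: power2_eq_square)
  qed
  finally show ?thesis .
qed

text \<open>
  The operator \<open>- \<Delta>\<close> on profiles of modes of frequency \<open>n\<close>.
\<close>

definition radial_op :: "nat \<Rightarrow> real poly \<Rightarrow> real poly" where
  "radial_op n F = [:-4:] * ([:0, 1:] * pderiv (pderiv F) + [:real n + 1:] * pderiv F)"

lemma poly_radial_op:
  "poly (radial_op n F) t = -4 * (t * poly (pderiv (pderiv F)) t + (real n + 1) * poly (pderiv F) t)"
  by (simp add: radial_op_def)

lemma laplacian_poly_mode:
  "- laplacian (\<lambda>z. mode_fun i F z) z = mode_fun i (radial_op (fst i) F) z"
  by (subst laplacian_mode[OF poly_DERIV poly_DERIV]) (simp add: poly_radial_op algebra_simps)

lemma disk_test_function_cutoff_mode: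
  assumes e: "\<epsilon> > 0" "\<epsilon> < 1"
  shows "disk_test_function (\<lambda>z. harm i z * (poly F (nsq z) * cutoff \<epsilon> 0 (nsq z)))" (is "disk_test_function ?\<phi>")
  unfolding disk_test_function_def
proof
  have "smooth_alg (cutoff \<epsilon>) ?\<phi>"
    by (intro smooth_alg.mult smooth_alg_harm smooth_alg_poly smooth_alg.profile)
  then show "\<forall>k. C_k k ?\<phi>"
    using smooth_alg_C_k[of "cutoff \<epsilon>", OF cutoff_has_derivative] by blast
  have cl: "closed {z::complex. nsq z \<le> 1 - \<epsilon>}"
    by (intro closed_Collect_le continuous_intros)
  have "{z. ?\<phi> z \<noteq> 0} \<subseteq> {z::complex. nsq z \<le> 1 - \<epsilon>}"
  proof
    fix z assume "z \<in> {z. ?\<phi> z \<noteq> 0}"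
    then have "cutoff \<epsilon> 0 (nsq z) \<noteq> 0" by simp
    then have "\<not> nsq z \<ge> 1 - \<epsilon>" using cutoff_eq_0[OF e(1)] by blast
    then show "z \<in> {z::complex. nsq z \<le> 1 - \<epsilon>}" by simp
  qed
  then have "closure {z. ?\<phi> z \<noteq> 0} \<subseteq> {z::complex. nsq z \<le> 1 - \<epsilon>}"
    by (rule closure_minimal[OF _ cl])
  also have "\<dots> \<subseteq> unit_disk"
  proof
    fix z :: complex assume "z \<in> {z. nsq z \<le> 1 - \<epsilon>}"
    then have "nsq z < 1\<^sup>2" using e by simp
    then have "cmod z < 1" by (rule power2_less_imp_less) simp
    then show "z \<in> unit_disk" by simp
  qed
  finally show "closure {z. ?\<phi> z \<noteq> 0} \<subseteq> unit_disk" .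
qed

lemma integral_boundary_kernel:
  fixes \<epsilon> :: real
  assumes e: "\<epsilon> > 0"
  shows "integral {0..1} (\<lambda>t. \<epsilon> / (\<epsilon>\<^sup>2 + (1 - t)\<^sup>2)) \<le> 2"
proof -
  have "((\<lambda>t. \<epsilon> / (\<epsilon>\<^sup>2 + (1 - t)\<^sup>2)) has_integral (- arctan ((1 - 1 :: real) / \<epsilon>)) - (- arctan ((1 - 0 :: real) / \<epsilon>))) {0..1}"
  proof (rule fundamental_theorem_of_calculus)
    fix t :: real assume "t \<in> {0..1}"
    have "((\<lambda>t. - arctan ((1 - t) / \<epsilon>)) has_real_derivative (1 / \<epsilon>) * inverse (1 + ((1 - t) / \<epsilon>)\<^sup>2)) (at t)"
      using e by (auto intro!: derivative_eq_intros)
    moreover have "(1 / \<epsilon>) * inverse (1 + ((1 - t) / \<epsilon>)\<^sup>2) = \<epsilon> / (\<epsilon>\<^sup>2 + (1 - t)\<^sup>2)"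
    proof -
      have "1 + ((1 - t) / \<epsilon>)\<^sup>2 = (\<epsilon>\<^sup>2 + (1 - t)\<^sup>2) / \<epsilon>\<^sup>2" using e by (simp add: field_simps power_divide)
      then show ?thesis using e by (simp add: power2_eq_square)
    qed
    ultimately show "((\<lambda>t. - arctan ((1 - t) / \<epsilon>)) has_vector_derivative \<epsilon> / (\<epsilon>\<^sup>2 + (1 - t)\<^sup>2)) (at t within {0..1})"
      using has_real_derivative_iff_has_vector_derivative has_field_derivative_at_within by metis
  qed simp
  then have "integral {0..1} (\<lambda>t. \<epsilon> / (\<epsilon>\<^sup>2 + (1 - t)\<^sup>2)) = arctan (1 / \<epsilon>)"
    by (simp add: integral_unique)
  then show ?thesis using arctan_ubound[of "1 / \<epsilon>"] pi_less_4 by linarith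
qed

text \<open>
  A quantitative form of the boundary condition that can be integrated against the kernel of
  \<open>cutoff_derivatives_bound\<close>: the quadratic factor cancels the singularity of the kernel.
\<close>

lemma small_near_boundary:
  assumes u: "continuous_on (cball 0 1) u" "\<And>z. z \<notin> unit_disk \<Longrightarrow> u z = 0" and "\<tau> > (0::real)"
  obtains C where "C \<ge> 0" "\<And>z::complex. z \<in> cball 0 1 \<Longrightarrow> \<bar>u z\<bar> \<le> \<tau> + C * (1 - nsq z)\<^sup>2"
proof -
  let ?S = "{z \<in> cball 0 1. \<tau> \<le> \<bar>u z\<bar>}"
  have "closed ?S"
  proof -
    have "closed (cball 0 1 \<inter> (\<lambda>z. \<bar>u z\<bar>) -` {\<tau>..})"
      by (intro continuous_closed_preimage continuous_intros u closed_cball closed_atLeast)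
    also have "cball 0 1 \<inter> (\<lambda>z. \<bar>u z\<bar>) -` {\<tau>..} = ?S" by auto
    finally show ?thesis .
  qed
  then have cS: "compact ?S" by (auto simp: compact_eq_bounded_closed intro: bounded_subset[of "cball 0 1"])
  have "compact (u ` cball 0 1)" by (rule compact_continuous_image[OF u(1)]) simp
  then obtain M where M: "\<And>z. z \<in> cball 0 1 \<Longrightarrow> \<bar>u z\<bar> \<le> M"
    using compact_imp_bounded bounded_iff by (metis imageI real_norm_def)
  have M0: "M \<ge> 0" using M[of 0] by simp
  have pos: "1 - nsq z > 0" if "z \<in> ?S" for z
  proof -
    have "z \<in> unit_disk" using that u(2)[of z] \<open>\<tau> > 0\<close> by force
    then show ?thesis by (simp add: abs_square_less_1)
  qed
  show ?thesis
  proof (cases "?S = {}")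
    case True
    show ?thesis
    proof (rule that[of 0])
      fix z :: complex assume "z \<in> cball 0 1"
      then have "\<not> \<tau> \<le> \<bar>u z\<bar>" using True by blast
      then show "\<bar>u z\<bar> \<le> \<tau> + 0 * (1 - nsq z)\<^sup>2" by simp
    qed simp
  next
    case False
    obtain w where w: "w \<in> ?S" "\<And>z. z \<in> ?S \<Longrightarrow> 1 - (cmod w)\<^sup>2 \<le> 1 - nsq z"
      using continuous_attains_inf[OF cS False, of "\<lambda>z. 1 - nsq z"] by (force intro!: continuous_intros)
    let ?d = "1 - (cmod w)\<^sup>2"
    have d: "?d > 0" by (rule pos[OF w(1)])
    show ?thesis
    proof (rule that[of "M / ?d\<^sup>2"])
      show "0 \<le> M / ?d\<^sup>2" using M0 by simp
      fix z :: complex assume z: "z \<in> cball 0 1"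
      show "\<bar>u z\<bar> \<le> \<tau> + M / ?d\<^sup>2 * (1 - nsq z)\<^sup>2"
      proof (cases "z \<in> ?S")
        case True
        have "?d\<^sup>2 \<le> (1 - nsq z)\<^sup>2" using w(2)[OF True] d by (intro power_mono) auto
        then have "M * 1 \<le> M * ((1 - nsq z)\<^sup>2 / ?d\<^sup>2)"
          using M0 d by (intro mult_left_mono) (auto simp: le_divide_eq)
        then show ?thesis using M[OF z] \<open>\<tau> > 0\<close> by simp
      next
        case False
        then show ?thesis using z M0 by (auto intro: add_increasing2)
      qed
    qed
  qed
qed

section \<open>Testing a distributional solution against polynomials\<close>

lemma continuous_on_compact_bound:
  fixes f :: "'a::topological_space \<Rightarrow> real"
  assumes "compact S" "continuous_on S f"
  obtains B where "B \<ge> 0" "\<And>z. z \<in> S \<Longrightarrow> \<bar>f z\<bar> \<le> B"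
proof -
  have "bounded (f ` S)"
    using compact_continuous_image[OF assms(2,1)] by (rule compact_imp_bounded)
  then obtain B where B: "\<And>y. y \<in> f ` S \<Longrightarrow> norm y \<le> B" unfolding bounded_iff by blast
  have "\<bar>f z\<bar> \<le> \<bar>B\<bar>" if "z \<in> S" for z using B[of "f z"] that by auto
  then show ?thesis by (intro that[of "\<bar>B\<bar>"]) auto
qed

text \<open>
  The kernel concentrates where \<open>u\<close> is small. Given \<open>\<tau> > 0\<close>, split \<open>|u|\<close> into at most \<open>\<tau>\<close>, integrated
  against bounded mass, and a multiple of \<open>(1 - t)\<^sup>2\<close>, whose integral is of order \<open>1 / (k + 1)\<close>.
\<close>

lemma integral_weighted_boundary_kernel_tendsto_0:
  fixes u :: "complex \<Rightarrow> real" and K :: "nat \<Rightarrow> complex \<Rightarrow> real"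
  assumes u: "continuous_on (cball 0 1) u" "\<And>z. z \<notin> unit_disk \<Longrightarrow> u z = 0"
    and K: "\<And>k. K k \<in> borel_measurable (disk_area)"
    and Kb: "\<And>k z. z \<in> unit_disk \<Longrightarrow>
       \<bar>K k z\<bar> \<le> B * ((1 / real (Suc k)) / ((1 / real (Suc k))\<^sup>2 + (1 - nsq z)\<^sup>2))"
  shows "(\<lambda>k. LINT z|disk_area. u z * K k z) \<longlonglongrightarrow> 0"
proof (rule LIMSEQ_I)
  fix r :: real assume r: "r > 0"
  have B: "B \<ge> 0"
  proof -
    have "0 \<le> B * ((1 / real (Suc 0)) / ((1 / real (Suc 0))\<^sup>2 + (1 - (cmod 0)\<^sup>2)\<^sup>2))"
      using Kb[of 0 0] abs_ge_zero order_trans by (metis centre_in_ball zero_less_one)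
    then show ?thesis by simp
  qed
  \<comment> \<open>The kernel has mass at most \<open>2 pi\<close>, so the part of \<open>u\<close> of size \<open>\<tau>\<close> contributes less than \<open>r\<close>.\<close>
  define \<tau> where "\<tau> = r / (2 * (B + 1) * (2 * pi))"
  have \<tau>: "\<tau> > 0" using r B by (simp add: \<tau>_def)
  obtain C where C: "C \<ge> 0" "\<And>z::complex. z \<in> cball 0 1 \<Longrightarrow> \<bar>u z\<bar> \<le> \<tau> + C * (1 - nsq z)\<^sup>2"
    using small_near_boundary[OF u \<tau>] by blast
  let ?q = "\<lambda>k t. (1 / real (Suc k)) / ((1 / real (Suc k))\<^sup>2 + (1 - t)\<^sup>2)"
  have qc: "continuous_on {0..1} (?q k)" for k
    by (intro continuous_intros) (auto simp: add_nonneg_eq_0_iff)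
  have est: "\<bar>LINT z|disk_area. u z * K k z\<bar> \<le> B * (\<tau> * (2 * pi) + C * (1 / real (Suc k)) * pi)" for k
  proof -
    have meas: "(\<lambda>z. u z * K k z) \<in> borel_measurable (disk_area)"
      using K ess_bdd_measurable[OF ess_bdd_continuous[OF u(1)]] by measurable
    let ?h = "\<lambda>t. B * (\<tau> * ?q k t + C * (1 / real (Suc k)))"
    have hc: "continuous_on {0..1} ?h" by (intro continuous_intros qc)
    have hint: "integrable (disk_area) (\<lambda>z. ?h (nsq z))"
      by (intro ess_bdd_integrable ess_bdd_continuous continuous_on_radial hc)
    have pw: "\<bar>u z * K k z\<bar> \<le> ?h (nsq z)" if z: "z \<in> unit_disk" for z
    proof -
      let ?t = "nsq z"
      have q0: "?q k ?t \<ge> 0" by simp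
      have "(1 - ?t)\<^sup>2 * ?q k ?t \<le> 1 / real (Suc k)"
      proof -
        let ?e = "1 / real (Suc k)"
        have "?e\<^sup>2 > 0" by simp
        then have p: "?e\<^sup>2 + (1 - ?t)\<^sup>2 > 0" by (intro add_pos_nonneg) auto
        have "(1 - ?t)\<^sup>2 * ?e \<le> ?e * (?e\<^sup>2 + (1 - ?t)\<^sup>2)" by (simp add: algebra_simps)
        then show ?thesis using p by (simp add: pos_divide_le_eq)
      qed
      then have "C * ((1 - ?t)\<^sup>2 * ?q k ?t) \<le> C * (1 / real (Suc k))" using C(1) by (rule mult_left_mono)
      then have 1: "(\<tau> + C * (1 - ?t)\<^sup>2) * ?q k ?t \<le> \<tau> * ?q k ?t + C * (1 / real (Suc k))"
        by (simp only: distrib_right mult.assoc add_left_mono)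
      have "\<bar>u z * K k z\<bar> \<le> (\<tau> + C * (1 - ?t)\<^sup>2) * (B * ?q k ?t)"
        unfolding abs_mult using C(2)[of z] Kb[OF z, of k] z C(1) \<tau> by (intro mult_mono) auto
      also have "\<dots> = B * ((\<tau> + C * (1 - ?t)\<^sup>2) * ?q k ?t)" by simp
      also have "\<dots> \<le> ?h ?t" using 1 B by (rule mult_left_mono)
      finally show ?thesis .
    qed
    have int: "integrable (disk_area) (\<lambda>z. u z * K k z)"
      by (rule Bochner_Integration.integrable_bound[OF hint meas]) (rule AE_I2, simp only: space_lebesgue_on real_norm_def, rule order_trans[OF pw abs_ge_self])
    have "\<bar>LINT z|disk_area. u z * K k z\<bar> \<le> (LINT z|disk_area. \<bar>u z * K k z\<bar>)"
      by (rule integral_abs_bound)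
    also have "\<dots> \<le> (LINT z|disk_area. ?h (nsq z))"
      by (intro integral_mono integrable_abs int hint) (use pw in auto)
    also have "\<dots> = pi * integral {0..1} ?h" by (rule integral_disk_radial[OF hc])
    also have "integral {0..1} ?h = B * (\<tau> * integral {0..1} (?q k) + C * (1 / real (Suc k)))"
    proof -
      have i: "?q k integrable_on {0..1}" by (rule integrable_continuous_interval[OF qc])
      have c: "((\<lambda>t::real. C * (1 / real (Suc k))) has_integral C * (1 / real (Suc k))) {0..1}"
        using has_integral_const_real[of "C * (1 / real (Suc k))" 0 1] by simp
      show ?thesis
        by (intro integral_unique has_integral_mult_right has_integral_add integrable_integral[OF i] c)
    qed
    also have "pi * (B * (\<tau> * integral {0..1} (?q k) + C * (1 / real (Suc k))))
        \<le> pi * (B * (\<tau> * 2 + C * (1 / real (Suc k))))"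
      using integral_boundary_kernel[of "1 / real (Suc k)"] B \<tau>
      by (intro mult_left_mono add_right_mono) auto
    also have "\<dots> = B * (\<tau> * (2 * pi) + C * (1 / real (Suc k)) * pi)" by (simp add: algebra_simps)
    finally show ?thesis .
  qed
  have "(\<lambda>k. B * (\<tau> * (2 * pi) + C * (1 / real (Suc k)) * pi)) \<longlonglongrightarrow> B * (\<tau> * (2 * pi) + C * 0 * pi)"
    using LIMSEQ_inverse_real_of_nat unfolding inverse_eq_divide by (intro tendsto_intros)
  moreover have "B * (\<tau> * (2 * pi) + C * 0 * pi) < r"
  proof -
    have "\<tau> * (2 * pi) = r / (2 * (B + 1))" by (simp add: \<tau>_def)
    then have "B * (\<tau> * (2 * pi)) = (r / 2) * (B / (B + 1))" by (simp only:) simp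
    also have "\<dots> \<le> (r / 2) * 1" using B r by (intro mult_left_mono) (auto simp: divide_le_eq)
    finally show ?thesis using r by simp
  qed
  ultimately have "eventually (\<lambda>k. B * (\<tau> * (2 * pi) + C * (1 / real (Suc k)) * pi) < r) sequentially"
    by (rule order_tendstoD(2))
  then obtain N where "\<And>k. k \<ge> N \<Longrightarrow> B * (\<tau> * (2 * pi) + C * (1 / real (Suc k)) * pi) < r"
    by (auto simp: eventually_sequentially)
  then show "\<exists>N. \<forall>k\<ge>N. norm ((LINT z|disk_area. u z * K k z) - 0) < r"
    using est by (intro exI[of _ N]) (fastforce intro: le_less_trans)
qed

lemma poly_root_1_bound:
  assumes "poly F (1::real) = 0"
  obtains B where "\<And>t. 0 \<le> t \<Longrightarrow> t \<le> 1 \<Longrightarrow> \<bar>poly F t\<bar> \<le> B * (1 - t)" "B \<ge> 0"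
proof -
  obtain H where H: "F = [:-1, 1:] * H" using assms by (metis poly_eq_0_iff_dvd dvdE)
  have "compact (poly H ` {0..1})" by (intro compact_continuous_image continuous_intros) auto
  then obtain B where B: "\<And>t. t \<in> {0..1} \<Longrightarrow> \<bar>poly H t\<bar> \<le> B"
    using compact_imp_bounded bounded_iff by (metis imageI real_norm_def)
  show ?thesis
  proof (rule that)
    fix t :: real assume t: "0 \<le> t" "t \<le> 1"
    have "poly F t = (t - 1) * poly H t" by (simp add: H algebra_simps)
    then have "\<bar>poly F t\<bar> = (1 - t) * \<bar>poly H t\<bar>" using t by (simp add: abs_mult)
    also have "\<dots> \<le> (1 - t) * B" using B[of t] t by (intro mult_left_mono) auto
    finally show "\<bar>poly F t\<bar> \<le> B * (1 - t)" by (simp add: mult.commute)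
  next
    show "B \<ge> 0" using B[of 0] by simp
  qed
qed

text \<open>
  The definition of a solution only allows test functions with compact support. Multiply the mode by the
  cutoffs: the terms in which a derivative falls on the cutoff tend to zero, since \<open>u\<close> is small where
  they live. Their size is controlled because \<open>F\<close> vanishes at \<open>1\<close>.
\<close>

lemma transposition_mode:
  assumes sol: "dirichlet_solution v u" and F: "poly F 1 = 0"
  shows "(LINT z|disk_area. u z * (mode_fun i (radial_op (fst i) F) z))
    = (LINT z|disk_area. v z * (mode_fun i F z))"
proof -
  let ?n = "fst i" and ?M = "disk_area"
  have v: "integrable ?M v" and u: "continuous_on (cball 0 1) u" "\<And>z. z \<notin> unit_disk \<Longrightarrow> u z = 0"
    and test: "\<And>\<phi>. disk_test_function \<phi> \<Longrightarrow>
        (LINT x|?M. u x * (- laplacian \<phi> x)) = (LINT x|?M. v x * \<phi> x)"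
    using sol by (auto simp: dirichlet_solution_def)
  define e where "e k = 1 / real (Suc (Suc k))" for k
  have e: "e k > 0" "e k < 1" for k by (simp_all add: e_def)
  define \<phi> where "\<phi> k z = harm i z * (poly F (nsq z) * cutoff (e k) 0 (nsq z))" for k z
  have tf: "disk_test_function (\<phi> k)" for k
    unfolding \<phi>_def[abs_def] by (rule disk_test_function_cutoff_mode) (use e in auto)
  \<comment> \<open>\<open>A\<close> collects the terms without, \<open>E\<close> those with derivatives of the cutoff.\<close>
  define A where "A k z = harm i z * (poly (radial_op ?n F) (nsq z) * cutoff (e k) 0 (nsq z))" for k z
  define E where "E k z = -4 * harm i z * (cutoff (e k) 1 (nsq z) * (2 * nsq z * poly (pderiv F) (nsq z)
      + (real ?n + 1) * poly F (nsq z)) + nsq z * poly F (nsq z) * cutoff (e k) 2 (nsq z))" for k z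
  have d0: "(cutoff \<epsilon> 0 has_real_derivative cutoff \<epsilon> 1 t) (at t)" and d1: "(cutoff \<epsilon> 1 has_real_derivative cutoff \<epsilon> 2 t) (at t)" for \<epsilon> t
    using cutoff_has_derivative[of \<epsilon> 0 t] cutoff_has_derivative[of \<epsilon> 1 t] by (simp_all add: numeral_2_eq_2)
  have lap: "- laplacian (\<phi> k) z = A k z + E k z" for k z
  proof -
    have f1: "((\<lambda>t. poly F t * cutoff (e k) 0 t) has_real_derivative
        (poly F t * cutoff (e k) 1 t + poly (pderiv F) t * cutoff (e k) 0 t)) (at t)" for t
      using DERIV_mult[OF poly_DERIV[of F t] d0[of "e k" t]] by (simp add: algebra_simps)
    have f2: "((\<lambda>t. poly F t * cutoff (e k) 1 t + poly (pderiv F) t * cutoff (e k) 0 t) has_real_derivative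
        ((poly F t * cutoff (e k) 2 t + poly (pderiv F) t * cutoff (e k) 1 t)
        + (poly (pderiv F) t * cutoff (e k) 1 t + poly (pderiv (pderiv F)) t * cutoff (e k) 0 t))) (at t)" for t
      using DERIV_add[OF DERIV_mult[OF poly_DERIV[of F t] d1[of "e k" t]] DERIV_mult[OF poly_DERIV[of "pderiv F" t] d0[of "e k" t]]]
      by (simp add: algebra_simps)
    show ?thesis
      unfolding \<phi>_def[abs_def] A_def E_def
      by (subst laplacian_mode[OF f1 f2]) (simp add: poly_radial_op algebra_simps)
  qed
  have cut_c: "continuous_on S (\<lambda>z::complex. cutoff \<epsilon> m (nsq z))" for S \<epsilon> m
  proof -
    have "continuous_on UNIV (cutoff \<epsilon> m)"
      by (rule DERIV_continuous_on) (rule has_field_derivative_at_within[OF cutoff_has_derivative])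
    then show ?thesis by (rule continuous_on_compose2) (auto intro!: continuous_intros)
  qed
  have Ac: "continuous_on S (A k)" and Ec: "continuous_on S (E k)" and \<phi>c: "continuous_on S (\<phi> k)" for S k
    unfolding A_def[abs_def] E_def[abs_def] \<phi>_def[abs_def]
    by (intro continuous_intros cut_c)+
  have ub: "ess_bdd u" by (rule ess_bdd_continuous[OF u(1)])
  have cut1: "(\<lambda>k. cutoff (e k) 0 (nsq z)) \<longlonglongrightarrow> 1" if "z \<in> unit_disk" for z
  proof -
    have "nsq z < 1" using that by (simp add: abs_square_less_1)
    from LIMSEQ_Suc[OF cutoff_0_tendsto_1[OF this]] show ?thesis by (simp only: e_def)
  qed
  have lim: "(\<lambda>k. LINT z|?M. w z * (harm i z * (poly q (nsq z) * cutoff (e k) 0 (nsq z))))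
     \<longlonglongrightarrow> (LINT z|?M. w z * (mode_fun i q z))" if w: "integrable ?M w" for w q
  proof -
    have "continuous_on (cball 0 1) (\<lambda>z. mode_fun i q z)"
      by (intro continuous_intros)
    then obtain B where B: "B \<ge> 0" "\<And>z. z \<in> cball 0 1 \<Longrightarrow> \<bar>mode_fun i q z\<bar> \<le> B"
      by (rule continuous_on_compact_bound[OF compact_cball, where f="\<lambda>z. mode_fun i q z"]) (use that in blast)
    have wm: "w \<in> borel_measurable ?M" using w by simp
    have cm: "g \<in> borel_measurable ?M" if "continuous_on (cball 0 1) g" for g :: "complex \<Rightarrow> real"
      by (rule ess_bdd_measurable[OF ess_bdd_continuous[OF that]])
    show ?thesis
    proof (rule integral_dominated_convergence[where w="\<lambda>z. B * \<bar>w z\<bar>"])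
      show "integrable ?M (\<lambda>z. B * \<bar>w z\<bar>)" using w by simp
      show "(\<lambda>z. w z * (mode_fun i q z)) \<in> borel_measurable ?M"
        by (intro borel_measurable_times wm cm continuous_intros)
      show "(\<lambda>z. w z * (harm i z * (poly q (nsq z) * cutoff (e k) 0 (nsq z)))) \<in> borel_measurable ?M" for k
        by (intro borel_measurable_times wm cm continuous_intros cut_c)
      show "AE z in ?M. (\<lambda>k. w z * (harm i z * (poly q (nsq z) * cutoff (e k) 0 (nsq z))))
          \<longlonglongrightarrow> w z * (mode_fun i q z)"
      proof (rule AE_I2)
        fix z :: complex assume "z \<in> space ?M"
        then have "(\<lambda>k. w z * (harm i z * (poly q (nsq z) * cutoff (e k) 0 (nsq z))))
          \<longlonglongrightarrow> w z * (harm i z * (poly q (nsq z) * 1))"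
          by (intro tendsto_intros cut1) simp
        then show "(\<lambda>k. w z * (harm i z * (poly q (nsq z) * cutoff (e k) 0 (nsq z))))
          \<longlonglongrightarrow> w z * (mode_fun i q z)" by simp
      qed
      show "AE z in ?M. norm (w z * (harm i z * (poly q (nsq z) * cutoff (e k) 0 (nsq z)))) \<le> B * \<bar>w z\<bar>" for k
      proof (rule AE_I2)
        fix z :: complex assume "z \<in> space ?M"
        then have b: "\<bar>mode_fun i q z\<bar> \<le> B" by (intro B(2)) auto
        have "norm (w z * (harm i z * (poly q (nsq z) * cutoff (e k) 0 (nsq z))))
           = \<bar>w z\<bar> * (\<bar>mode_fun i q z\<bar> * cutoff (e k) 0 (nsq z))"
          using cutoff_0_bounds(1)[of "e k" "nsq z"] by (simp add: abs_mult)
        also have "\<dots> \<le> \<bar>w z\<bar> * (B * 1)"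
          using b B(1) cutoff_0_bounds[of "e k" "nsq z"] by (intro mult_left_mono mult_mono) auto
        finally show "norm (w z * (harm i z * (poly q (nsq z) * cutoff (e k) 0 (nsq z)))) \<le> B * \<bar>w z\<bar>"
          by (simp add: mult.commute)
      qed
    qed
  qed
  have limE: "(\<lambda>k. LINT z|?M. u z * E k z) \<longlonglongrightarrow> 0"
  proof -
    obtain B1 where B1: "\<And>t. 0 \<le> t \<Longrightarrow> t \<le> 1 \<Longrightarrow> \<bar>poly F t\<bar> \<le> B1 * (1 - t)" "B1 \<ge> 0"
      using poly_root_1_bound[OF F] by blast
    have "continuous_on {0..1} (poly (pderiv F))" by (intro continuous_intros)
    then obtain B2 where B20: "B2 \<ge> 0" and B2: "\<And>t. t \<in> {0..1} \<Longrightarrow> \<bar>poly (pderiv F) t\<bar> \<le> B2"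
      by (rule continuous_on_compact_bound[OF compact_Icc, where f="poly (pderiv F)"]) (use that in blast)
    define G where "G = 2 * B2 + (real ?n + 2) * B1"
    have G: "G \<ge> 0" "B1 \<le> G" "2 * B2 + (real ?n + 1) * B1 \<le> G" using B1(2) B20 by (auto simp: G_def algebra_simps)
    have Eb: "\<bar>E k z\<bar> \<le> (4 * G * 1536) * (e k / ((e k)\<^sup>2 + (1 - nsq z)\<^sup>2))" if z: "z \<in> unit_disk" for k z
    proof -
      define t where "t = nsq z"
      have t: "0 \<le> t" "t \<le> 1" using z by (auto simp: t_def power_le_one)
      have a1: "\<bar>2 * t * poly (pderiv F) t + (real ?n + 1) * poly F t\<bar> \<le> 2 * B2 + (real ?n + 1) * B1"
      proof -
        have "\<bar>2 * t * poly (pderiv F) t\<bar> \<le> 2 * 1 * B2"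
          unfolding abs_mult using t B2[of t] by (intro mult_mono) auto
        moreover have "\<bar>poly F t\<bar> \<le> B1"
          using B1(1)[OF t] B1(2) t mult_left_le[of "1 - t" B1] by linarith
        then have "\<bar>(real ?n + 1) * poly F t\<bar> \<le> (real ?n + 1) * B1"
          unfolding abs_mult by (intro mult_mono) auto
        ultimately show ?thesis by linarith
      qed
      have a2: "\<bar>t * poly F t\<bar> \<le> B1 * (1 - t)"
        using mult_left_le_one_le[of "\<bar>poly F t\<bar>" t] B1(1)[OF t] t by (simp add: abs_mult)
      have "\<bar>E k z\<bar> = 4 * \<bar>harm i z\<bar> * \<bar>cutoff (e k) 1 t * (2 * t * poly (pderiv F) t + (real ?n + 1) * poly F t) + t * poly F t * cutoff (e k) 2 t\<bar>"
        unfolding E_def t_def by (simp only: abs_mult)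
      also have "\<dots> \<le> 4 * 1 * (\<bar>cutoff (e k) 1 t\<bar> * (2 * B2 + (real ?n + 1) * B1) + (B1 * (1 - t)) * \<bar>cutoff (e k) 2 t\<bar>)"
      proof (intro mult_mono)
        show "\<bar>harm i z\<bar> \<le> 1" using harm_le_1[of z i] z by simp
        have "\<bar>cutoff (e k) 1 t * (2 * t * poly (pderiv F) t + (real ?n + 1) * poly F t)\<bar> \<le> \<bar>cutoff (e k) 1 t\<bar> * (2 * B2 + (real ?n + 1) * B1)"
          unfolding abs_mult[of "cutoff _ _ _"] using a1 by (intro mult_left_mono) auto
        moreover have "\<bar>t * poly F t * cutoff (e k) 2 t\<bar> \<le> (B1 * (1 - t)) * \<bar>cutoff (e k) 2 t\<bar>"
          unfolding abs_mult[of _ "cutoff _ _ _"] using a2 by (intro mult_right_mono) auto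
        ultimately show "\<bar>cutoff (e k) 1 t * (2 * t * poly (pderiv F) t + (real ?n + 1) * poly F t) + t * poly F t * cutoff (e k) 2 t\<bar>
          \<le> \<bar>cutoff (e k) 1 t\<bar> * (2 * B2 + (real ?n + 1) * B1) + (B1 * (1 - t)) * \<bar>cutoff (e k) 2 t\<bar>" by linarith
      qed auto
      also have "\<dots> \<le> 4 * 1 * (\<bar>cutoff (e k) 1 t\<bar> * G + (G * (1 - t)) * \<bar>cutoff (e k) 2 t\<bar>)"
        using G t by (intro mult_left_mono add_mono mult_right_mono) auto
      also have "\<dots> = 4 * G * (\<bar>cutoff (e k) 1 t\<bar> + (1 - t) * \<bar>cutoff (e k) 2 t\<bar>)" by (simp add: algebra_simps)
      also have "\<dots> \<le> 4 * G * (1536 * (e k / ((e k)\<^sup>2 + (1 - t)\<^sup>2)))"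
        using cutoff_derivatives_bound[OF e(1)[of k] t(2)] G(1) by (intro mult_left_mono) auto
      finally show ?thesis by (simp add: t_def)
    qed
    \<comment> \<open>Shifted by one, because \<open>e k = 1 / (k + 2)\<close> in order to be less than \<open>1\<close>.\<close>
    define K where "K k z = (case k of 0 \<Rightarrow> 0 | Suc m \<Rightarrow> E m z)" for k z
    have "(\<lambda>k. LINT z|?M. u z * K k z) \<longlonglongrightarrow> 0"
    proof (rule integral_weighted_boundary_kernel_tendsto_0[OF u, where B="4 * G * 1536"])
      show "K k \<in> borel_measurable ?M" for k
        unfolding K_def[abs_def]
        by (cases k) (auto intro!: ess_bdd_measurable ess_bdd_continuous Ec)
      show "\<bar>K k z\<bar> \<le> 4 * G * 1536 * ((1 / real (Suc k)) / ((1 / real (Suc k))\<^sup>2 + (1 - nsq z)\<^sup>2))"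
        if "z \<in> unit_disk" for k z
      proof (cases k)
        case 0
        then show ?thesis using G(1) by (simp add: K_def)
      next
        case (Suc m)
        then show ?thesis using Eb[OF that, of m] by (simp only: K_def nat.case e_def)
      qed
    qed
    from LIMSEQ_Suc[OF this] show ?thesis by (simp add: K_def)
  qed
  have "(\<lambda>k. (LINT z|?M. u z * A k z) + (LINT z|?M. u z * E k z)) \<longlonglongrightarrow> (LINT z|?M. u z * (mode_fun i (radial_op ?n F) z)) + 0"
    unfolding A_def by (intro tendsto_add limE lim ess_bdd_integrable ub)
  moreover have "(LINT z|?M. u z * A k z) + (LINT z|?M. u z * E k z) = (LINT z|?M. v z * \<phi> k z)" for k
  proof -
    have "(LINT z|?M. u z * A k z) + (LINT z|?M. u z * E k z) = (LINT z|?M. u z * A k z + u z * E k z)"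
      by (intro Bochner_Integration.integral_add[symmetric] ess_bdd_integrable ess_bdd_mult ub ess_bdd_continuous Ac Ec)
    also have "\<dots> = (LINT z|?M. u z * (- laplacian (\<phi> k) z))" by (simp only: lap distrib_left)
    also have "\<dots> = (LINT z|?M. v z * \<phi> k z)" by (rule test[OF tf])
    finally show ?thesis .
  qed
  ultimately have "(\<lambda>k. LINT z|?M. v z * \<phi> k z) \<longlonglongrightarrow> (LINT z|?M. u z * (mode_fun i (radial_op ?n F) z))"
    by simp
  moreover have "(\<lambda>k. LINT z|?M. v z * \<phi> k z) \<longlonglongrightarrow> (LINT z|?M. v z * (mode_fun i F z))"
    unfolding \<phi>_def by (rule lim[OF v])
  ultimately show ?thesis by (rule LIMSEQ_unique)
qed

section \<open>Radial inequalities and Poisson's equation for polynomials\<close>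

lemma FTC_real:
  fixes G g :: "real \<Rightarrow> real"
  assumes "a \<le> b" "\<And>t. t \<in> {a..b} \<Longrightarrow> (G has_real_derivative g t) (at t)"
  shows "(g has_integral G b - G a) {a..b}"
  by (rule fundamental_theorem_of_calculus[OF assms(1)])
     (rule has_real_derivative_iff_has_vector_derivative[THEN iffD1], rule has_field_derivative_at_within, rule assms(2))

lemma integral_01_FTC:
  fixes G g :: "real \<Rightarrow> real"
  assumes "\<And>t. t \<in> {0..1} \<Longrightarrow> (G has_real_derivative g t) (at t)"
  shows "integral {0..1} g = G 1 - G 0" "g integrable_on {0..1}"
proof -
  have "(g has_integral G 1 - G 0) {0..1}"
    by (rule FTC_real) (use assms in auto)
  then show "integral {0..1} g = G 1 - G 0" "g integrable_on {0..1}"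
    by (auto simp: integral_unique has_integral_integrable)
qed

lemma has_real_derivative_power_Suc:
  "((\<lambda>t::real. t ^ Suc n) has_real_derivative (real n + 1) * t ^ n) (at t)"
  by (auto intro!: derivative_eq_intros simp del: power_Suc)

lemma continuous_on_if_DERIV:
  assumes "\<And>t. (f has_real_derivative f' t) (at t)"
  shows "continuous_on S f"
  by (rule DERIV_continuous_on) (rule has_field_derivative_at_within[OF assms])

text \<open>
  Integration by parts with the divergence form \<open>t\<^sup>n (t f'' + (n + 1) f') = (t\<^sup>n\<^sup>+\<^sup>1 f')'\<close>.
\<close>

lemma radial_green:
  fixes f f' f'' g g' :: "real \<Rightarrow> real"
  assumes f: "\<And>t. (f has_real_derivative f' t) (at t)" "\<And>t. (f' has_real_derivative f'' t) (at t)"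
    and g: "\<And>t. (g has_real_derivative g' t) (at t)"
    and c: "continuous_on {0..1} f''" "continuous_on {0..1} g'"
  shows "integral {0..1} (\<lambda>t. t ^ n * ((t * f'' t + (real n + 1) * f' t) * g t))
       = f' 1 * g 1 - integral {0..1} (\<lambda>t. t ^ Suc n * (f' t * g' t))"
proof -
  have cont: "continuous_on {0..1} f'" "continuous_on {0..1} g"
    by (rule continuous_on_if_DERIV, rule f g)+
  have d: "((\<lambda>t. t ^ Suc n * (f' t * g t)) has_real_derivative
      t ^ n * ((t * f'' t + (real n + 1) * f' t) * g t) + t ^ Suc n * (f' t * g' t)) (at t)" for t
    using DERIV_mult[OF has_real_derivative_power_Suc DERIV_mult[OF f(2) g]]
    by (simp add: algebra_simps)
  have "integral {0..1} (\<lambda>t. t ^ n * ((t * f'' t + (real n + 1) * f' t) * g t) + t ^ Suc n * (f' t * g' t)) = f' 1 * g 1"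
    using integral_01_FTC(1)[OF d] by simp
  moreover have "integral {0..1} (\<lambda>t. t ^ n * ((t * f'' t + (real n + 1) * f' t) * g t) + t ^ Suc n * (f' t * g' t))
    = integral {0..1} (\<lambda>t. t ^ n * ((t * f'' t + (real n + 1) * f' t) * g t)) + integral {0..1} (\<lambda>t. t ^ Suc n * (f' t * g' t))"
    by (intro Henstock_Kurzweil_Integration.integral_add integrable_continuous_interval continuous_intros c cont)
  ultimately show ?thesis by simp
qed

lemma radial_op_energy:
  assumes "poly F 1 = 0"
  shows "integral {0..1} (\<lambda>t. t ^ n * (poly (radial_op n F) t * poly F t))
    = 4 * integral {0..1} (\<lambda>t. t ^ Suc n * (poly (pderiv F) t)\<^sup>2)"
proof -
  have "integral {0..1} (\<lambda>t. t ^ n * (poly (radial_op n F) t * poly F t))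
     = -4 * integral {0..1} (\<lambda>t. t ^ n * ((t * poly (pderiv (pderiv F)) t + (real n + 1) * poly (pderiv F) t) * poly F t))"
    by (subst Henstock_Kurzweil_Integration.integral_mult_right[symmetric]) (simp add: poly_radial_op algebra_simps)
  also have "\<dots> = 4 * integral {0..1} (\<lambda>t. t ^ Suc n * (poly (pderiv F) t)\<^sup>2)"
    by (subst radial_green[OF poly_DERIV poly_DERIV poly_DERIV])
       (auto intro!: continuous_intros simp: assms power2_eq_square)
  finally show ?thesis .
qed

text \<open>
  Picone's identity: for a positive solution \<open>\<phi>\<close> of the eigenvalue equation the difference of the two
  sides is the integral of \<open>t\<^sup>n\<^sup>+\<^sup>1 (F' - F \<phi>' / \<phi>)\<^sup>2\<close>, as the total derivative of \<open>t\<^sup>n\<^sup>+\<^sup>1 \<phi>' F\<^sup>2 / \<phi>\<close> integrates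
  to zero.
\<close>

lemma radial_picone:
  fixes \<phi> \<phi>' \<phi>'' F F' :: "real \<Rightarrow> real"
  assumes \<phi>: "\<And>t. (\<phi> has_real_derivative \<phi>' t) (at t)" "\<And>t. (\<phi>' has_real_derivative \<phi>'' t) (at t)"
    and ode: "\<And>t. t * \<phi>'' t + (real n + 1) * \<phi>' t = - k * \<phi> t"
    and pos: "\<And>t. t \<in> {0..1} \<Longrightarrow> \<phi> t > 0"
    and F: "\<And>t. (F has_real_derivative F' t) (at t)" and cF': "continuous_on {0..1} F'" and F1: "F 1 = 0"
  shows "k * integral {0..1} (\<lambda>t. t ^ n * (F t)\<^sup>2) \<le> integral {0..1} (\<lambda>t. t ^ Suc n * (F' t)\<^sup>2)"
proof -
  have cF: "continuous_on {0..1} F" using F by (rule continuous_on_if_DERIV)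
  define h where "h t = t ^ Suc n * (F' t)\<^sup>2 - k * (t ^ n * (F t)\<^sup>2) - t ^ Suc n * (F' t - F t * \<phi>' t / \<phi> t)\<^sup>2" for t
  have d: "((\<lambda>t. t ^ Suc n * \<phi>' t * (F t)\<^sup>2 / \<phi> t) has_real_derivative h t) (at t)" if t: "t \<in> {0..1}" for t
  proof -
    have nz: "\<phi> t \<noteq> 0" using pos[OF t] by simp
    have "((\<lambda>t. t ^ Suc n * \<phi>' t * (F t)\<^sup>2 / \<phi> t) has_real_derivative
       ((((real n + 1) * t ^ n * \<phi>' t + \<phi>'' t * t ^ Suc n) * (F t)\<^sup>2 + (2 * F t * F' t) * (t ^ Suc n * \<phi>' t)) * \<phi> t
         - t ^ Suc n * \<phi>' t * (F t)\<^sup>2 * \<phi>' t) / (\<phi> t * \<phi> t)) (at t)"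
    proof (rule DERIV_divide[OF DERIV_mult[OF DERIV_mult[OF has_real_derivative_power_Suc \<phi>(2)]] \<phi>(1) nz])
      show "((\<lambda>t. (F t)\<^sup>2) has_real_derivative 2 * F t * F' t) (at t)"
        using F by (auto intro!: derivative_eq_intros)
    qed
    moreover have "((((real n + 1) * t ^ n * \<phi>' t + \<phi>'' t * t ^ Suc n) * (F t)\<^sup>2 + (2 * F t * F' t) * (t ^ Suc n * \<phi>' t)) * \<phi> t
         - t ^ Suc n * \<phi>' t * (F t)\<^sup>2 * \<phi>' t) / (\<phi> t * \<phi> t) = h t"
    proof -
      have e: "(real n + 1) * t ^ n * \<phi>' t + \<phi>'' t * t ^ Suc n = - k * t ^ n * \<phi> t"
      proof -
        have "(real n + 1) * t ^ n * \<phi>' t + \<phi>'' t * t ^ Suc n = t ^ n * (t * \<phi>'' t + (real n + 1) * \<phi>' t)"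
          by (simp add: algebra_simps)
        also have "\<dots> = - k * t ^ n * \<phi> t" unfolding ode by simp
        finally show ?thesis .
      qed
      show ?thesis
        unfolding e h_def using nz by (simp add: field_simps power2_eq_square)
    qed
    ultimately show ?thesis by simp
  qed
  have int: "(\<lambda>t. t ^ Suc n * (F' t)\<^sup>2) integrable_on {0..1}" "(\<lambda>t. k * (t ^ n * (F t)\<^sup>2)) integrable_on {0..1}"
    by (intro integrable_continuous_interval continuous_intros cF cF')+
  have "0 = integral {0..1} h" using integral_01_FTC(1)[OF d] F1 by simp
  also have "\<dots> \<le> integral {0..1} (\<lambda>t. t ^ Suc n * (F' t)\<^sup>2 - k * (t ^ n * (F t)\<^sup>2))"
  proof (rule integral_le)
    show "h integrable_on {0..1}" using integral_01_FTC(2)[OF d] by simp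
    show "(\<lambda>t. t ^ Suc n * (F' t)\<^sup>2 - k * (t ^ n * (F t)\<^sup>2)) integrable_on {0..1}"
      by (intro integrable_diff int)
  qed (auto simp: h_def)
  also have "\<dots> = integral {0..1} (\<lambda>t. t ^ Suc n * (F' t)\<^sup>2) - k * integral {0..1} (\<lambda>t. t ^ n * (F t)\<^sup>2)"
    by (subst Henstock_Kurzweil_Integration.integral_diff[OF int]) simp
  finally show ?thesis by simp
qed

text \<open>
  Expand the square in \<open>\<integral> t\<^sup>n\<^sup>-\<^sup>1 (n F + 2 t F')\<^sup>2 \<ge> 0\<close> and integrate the mixed term by parts.
\<close>

lemma radial_hardy:
  assumes n: "n \<ge> 1" and F1: "poly F (1::real) = 0"
  shows "(real n)\<^sup>2 * integral {0..1} (\<lambda>t. t ^ (n - 1) * (poly F t)\<^sup>2)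
     \<le> 4 * integral {0..1} (\<lambda>t. t ^ Suc n * (poly (pderiv F) t)\<^sup>2)"
proof -
  let ?F = "poly F" and ?F' = "poly (pderiv F)"
  obtain m where m: "n = Suc m" using n by (cases n) auto
  have i: "(\<lambda>t. t ^ a * (?F t * ?F' t)) integrable_on {0..1}" "(\<lambda>t. t ^ a * (?F t)\<^sup>2) integrable_on {0..1}"
    "(\<lambda>t. t ^ a * (?F' t)\<^sup>2) integrable_on {0..1}" for a
    by (intro integrable_continuous_interval continuous_intros)+
  have d: "((\<lambda>t. t ^ n * (?F t)\<^sup>2) has_real_derivative (real n * (t ^ m * (?F t)\<^sup>2) + 2 * (t ^ n * (?F t * ?F' t)))) (at t)" for t
    unfolding m using DERIV_mult[OF has_real_derivative_power_Suc[of m t] DERIV_power[OF poly_DERIV[of F t], of 2]]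
    by (simp add: algebra_simps)
  have "integral {0..1} (\<lambda>t. real n * (t ^ m * (?F t)\<^sup>2) + 2 * (t ^ n * (?F t * ?F' t))) = 0"
    using integral_01_FTC(1)[OF d] F1 m by simp
  then have e: "real n * integral {0..1} (\<lambda>t. t ^ m * (?F t)\<^sup>2) + 2 * integral {0..1} (\<lambda>t. t ^ n * (?F t * ?F' t)) = 0"
    by (subst (asm) Henstock_Kurzweil_Integration.integral_add) (intro integrable_on_mult_right i | simp)+
  have "0 \<le> integral {0..1} (\<lambda>t. t ^ m * (real n * ?F t + 2 * t * ?F' t)\<^sup>2)"
    by (rule integral_nonneg) (auto intro!: integrable_continuous_interval continuous_intros)
  also have "(\<lambda>t. t ^ m * (real n * ?F t + 2 * t * ?F' t)\<^sup>2) =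
    (\<lambda>t. (real n)\<^sup>2 * (t ^ m * (?F t)\<^sup>2) + (4 * real n * (t ^ n * (?F t * ?F' t)) + 4 * (t ^ Suc n * (?F' t)\<^sup>2)))"
    by (rule ext) (simp add: m power2_eq_square algebra_simps)
  also have "integral {0..1} \<dots> = (real n)\<^sup>2 * integral {0..1} (\<lambda>t. t ^ m * (?F t)\<^sup>2)
     + (4 * real n * integral {0..1} (\<lambda>t. t ^ n * (?F t * ?F' t)) + 4 * integral {0..1} (\<lambda>t. t ^ Suc n * (?F' t)\<^sup>2))"
    by (simp only: Henstock_Kurzweil_Integration.integral_add Henstock_Kurzweil_Integration.integral_mult_right integrable_on_mult_right i integrable_add)
  finally have "0 \<le> (real n)\<^sup>2 * integral {0..1} (\<lambda>t. t ^ m * (?F t)\<^sup>2)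
     + 2 * real n * (2 * integral {0..1} (\<lambda>t. t ^ n * (?F t * ?F' t))) + 4 * integral {0..1} (\<lambda>t. t ^ Suc n * (?F' t)\<^sup>2)"
    by simp
  also have "2 * integral {0..1} (\<lambda>t. t ^ n * (?F t * ?F' t)) = - (real n * integral {0..1} (\<lambda>t. t ^ m * (?F t)\<^sup>2))"
    using e by linarith
  finally show ?thesis by (simp add: m power2_eq_square algebra_simps)
qed

text \<open>
  The left-hand side bounds the square of the mode at \<open>|z|\<^sup>2 = t\<close>. It is at most
  \<open>\<integral> (n s\<^sup>n\<^sup>-\<^sup>1 F\<^sup>2 + s\<^sup>n\<^sup>+\<^sup>1 F'\<^sup>2 / n)\<close>, hence controlled by the Dirichlet integral through Hardy's
  inequality; the Dirichlet integral is controlled by the energy identity. The factor \<open>1 / n\<^sup>2\<close> makes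
  the bounds summable over the modes.
\<close>

lemma radial_sup_bound_pos:
  assumes n: "n \<ge> 1" and F1: "poly F (1::real) = 0" and t: "0 \<le> t" "t \<le> 1"
  shows "t ^ n * (poly F t)\<^sup>2 \<le> (5 / 4) / (real n)\<^sup>2 * integral {0..1} (\<lambda>t. t ^ n * (poly (radial_op n F) t)\<^sup>2)"
proof -
  let ?F = "poly F" and ?F' = "poly (pderiv F)" and ?q = "poly (radial_op n F)"
  obtain m where m: "n = Suc m" using n by (cases n) auto
  have np: "real n \<ge> 1" using n by simp
  define A where "A = integral {0..1} (\<lambda>t. t ^ Suc n * (?F' t)\<^sup>2)"
  define H where "H = integral {0..1} (\<lambda>t. t ^ m * (?F t)\<^sup>2)"
  define Q where "Q = integral {0..1} (\<lambda>t. t ^ n * (?q t)\<^sup>2)"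
  have i: "(\<lambda>t. t ^ a * (poly p t)\<^sup>2) integrable_on {u..w}" "(\<lambda>t. t ^ a * (poly p t * poly q t)) integrable_on {u..w}" for a p q and u w :: real
    by (intro integrable_continuous_interval continuous_intros)+
  have H: "(real n)\<^sup>2 * H \<le> 4 * A" using radial_hardy[OF n F1] by (simp add: H_def A_def m)
  have A0: "A \<ge> 0" unfolding A_def by (rule integral_nonneg[OF i(1)]) auto
  \<comment> \<open>Young's inequality with weight \<open>n\<^sup>2\<close>, which lets Hardy's inequality absorb the second term.\<close>
  have "2 * (4 * A) \<le> Q / (real n)\<^sup>2 + 4 * A"
  proof -
    have "2 * (4 * A) = integral {0..1} (\<lambda>t. 2 * (t ^ n * (?q t * ?F t)))"
      using radial_op_energy[OF F1, of n] by (simp add: A_def)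
    also have "\<dots> \<le> integral {0..1} (\<lambda>t. (1 / (real n)\<^sup>2) * (t ^ n * (?q t)\<^sup>2) + (real n)\<^sup>2 * (t ^ m * (?F t)\<^sup>2))"
    proof (rule integral_le)
      fix t :: real assume t: "t \<in> {0..1}"
      have "0 \<le> (?q t / real n - real n * ?F t)\<^sup>2" by simp
      then have "2 * (?q t * ?F t) \<le> (1 / (real n)\<^sup>2) * (?q t)\<^sup>2 + (real n)\<^sup>2 * (?F t)\<^sup>2"
        using np by (simp add: power2_diff power_divide power_mult_distrib)
      then have "t ^ n * (2 * (?q t * ?F t)) \<le> t ^ n * ((1 / (real n)\<^sup>2) * (?q t)\<^sup>2 + (real n)\<^sup>2 * (?F t)\<^sup>2)"
        using t by (intro mult_left_mono) auto
      also have "\<dots> \<le> (1 / (real n)\<^sup>2) * (t ^ n * (?q t)\<^sup>2) + (real n)\<^sup>2 * (t ^ m * (?F t)\<^sup>2)"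
      proof -
        have "t ^ n \<le> t ^ m" using t by (simp add: m mult_left_le_one_le)
        then have "t ^ n * ((real n)\<^sup>2 * (?F t)\<^sup>2) \<le> t ^ m * ((real n)\<^sup>2 * (?F t)\<^sup>2)" by (rule mult_right_mono) simp
        then show ?thesis by (simp add: distrib_left mult.left_commute mult.commute)
      qed
      finally show "2 * (t ^ n * (?q t * ?F t)) \<le> (1 / (real n)\<^sup>2) * (t ^ n * (?q t)\<^sup>2) + (real n)\<^sup>2 * (t ^ m * (?F t)\<^sup>2)"
        by simp
    qed (intro integrable_on_mult_right integrable_add i)+
    also have "\<dots> = (1 / (real n)\<^sup>2) * Q + (real n)\<^sup>2 * H"
      unfolding Q_def H_def
      by (simp only: Henstock_Kurzweil_Integration.integral_add Henstock_Kurzweil_Integration.integral_mult_right integrable_on_mult_right i)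
    finally show ?thesis using H by simp
  qed
  then have AQ: "A \<le> Q / (4 * (real n)\<^sup>2)" by simp
  \<comment> \<open>\<open>g\<close> is the derivative of \<open>t\<^sup>n F\<^sup>2\<close>, and \<open>e\<close> dominates \<open>- g\<close>.\<close>
  define g where "g t = real n * (t ^ m * (?F t)\<^sup>2) + 2 * (t ^ n * (?F t * ?F' t))" for t
  define e where "e t = real n * (t ^ m * (?F t)\<^sup>2) + (1 / real n) * (t ^ Suc n * (?F' t)\<^sup>2)" for t
  have d: "((\<lambda>t. t ^ n * (?F t)\<^sup>2) has_real_derivative g t) (at t)" for t
    unfolding m g_def using DERIV_mult[OF has_real_derivative_power_Suc[of m t] DERIV_power[OF poly_DERIV[of F t], of 2]]
    by (simp add: algebra_simps)
  have ei: "e integrable_on {u..w}" and gi: "g integrable_on {u..w}" for u w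
    unfolding e_def[abs_def] g_def[abs_def] by (intro integrable_on_mult_right integrable_add i)+
  have e0: "e s \<ge> 0" if "s \<in> {0..1}" for s using that by (auto simp: e_def)
  have ge: "- g s \<le> e s" if s: "s \<in> {0..1}" for s
  proof -
    have "0 \<le> s ^ m * (real n * ?F s + s * ?F' s)\<^sup>2 / real n" using s by simp
    also have "\<dots> = e s + 2 * (s ^ n * (?F s * ?F' s))"
      using np by (simp add: e_def m field_simps power2_eq_square)
    also have "\<dots> \<le> e s + g s" using s by (simp add: g_def)
    finally show ?thesis by simp
  qed
  have "(g has_integral 1 ^ n * (?F 1)\<^sup>2 - t ^ n * (?F t)\<^sup>2) {t..1}"
    by (rule FTC_real[OF t(2) d])
  then have "t ^ n * (?F t)\<^sup>2 = integral {t..1} (\<lambda>s. - g s)"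
    using F1 by (simp add: integral_unique)
  also have "\<dots> \<le> integral {t..1} e"
    by (rule integral_le) (use ge t in \<open>auto intro!: ei gi integrable_neg\<close>)
  also have "\<dots> \<le> integral {0..1} e"
    by (rule integral_subset_le) (use t ei e0 in auto)
  also have "\<dots> = real n * H + (1 / real n) * A"
    unfolding e_def[abs_def] H_def A_def
    by (simp only: Henstock_Kurzweil_Integration.integral_add Henstock_Kurzweil_Integration.integral_mult_right integrable_on_mult_right i)
  also have "\<dots> \<le> 4 * A / real n + A / real n"
  proof -
    have "real n * H = ((real n)\<^sup>2 * H) / real n" using np by (simp add: power2_eq_square)
    also have "\<dots> \<le> 4 * A / real n" using H np by (intro divide_right_mono) auto
    finally show ?thesis by simp
  qed
  also have "\<dots> = 5 * A / real n" by (simp add: add_divide_distrib[symmetric])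
  also have "\<dots> \<le> 5 * A" using A0 np by (simp add: divide_le_eq mult_le_cancel_left1)
  also have "\<dots> \<le> (5 / 4) / (real n)\<^sup>2 * Q" using AQ by simp
  finally show ?thesis by (simp add: Q_def)
qed

text \<open>
  In dimension two the Dirichlet integral of a radial function does not control its values. Instead
  \<open>t F'(t) = - (1/4) \<integral>\<^sub>0\<^sup>t q\<close> and Cauchy-Schwarz give \<open>|F'(t)| \<le> \<parallel>q\<parallel> / (4 \<surd>t)\<close>, which is integrable.
\<close>

lemma radial_sup_bound_0:
  assumes F1: "poly F (1::real) = 0" and t: "0 \<le> t" "t \<le> 1"
  shows "(poly F t)\<^sup>2 \<le> integral {0..1} (\<lambda>t. (poly (radial_op 0 F) t)\<^sup>2) / 4"
proof -
  let ?F' = "poly (pderiv F)" and ?q = "poly (radial_op 0 F)"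
  define Q where "Q = integral {0..1} (\<lambda>t. (?q t)\<^sup>2)"
  have Q0: "Q \<ge> 0" unfolding Q_def by (rule integral_nonneg) (auto intro!: integrable_continuous_interval continuous_intros)
  have i: "?q integrable_on {u..w}" "(\<lambda>s. (?q s)\<^sup>2) integrable_on {u..w}" for u w
    by (intro integrable_continuous_interval continuous_intros)+
  have F': "\<bar>?F' s\<bar> \<le> sqrt Q / (4 * sqrt s)" if s: "0 < s" "s \<le> 1" for s
  proof -
    define J where "J = integral {0..s} ?q"
    have d: "((\<lambda>s. -4 * (s * ?F' s)) has_real_derivative ?q r) (at r)" for r
      by (auto intro!: derivative_eq_intros poly_DERIV simp: poly_radial_op)
    have "(?q has_integral (-4 * (s * ?F' s)) - (-4 * (0 * ?F' 0))) {0..s}"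
      by (rule FTC_real[OF _ d]) (use s in simp)
    then have J: "J = -4 * (s * ?F' s)" by (simp add: J_def integral_unique)
    have "0 \<le> integral {0..s} (\<lambda>r. (?q r - J / s)\<^sup>2)"
      by (rule integral_nonneg) (auto intro!: integrable_continuous_interval continuous_intros)
    also have "(\<lambda>r. (?q r - J / s)\<^sup>2) = (\<lambda>r. (?q r)\<^sup>2 + ((-2 * J / s) * ?q r + (J / s)\<^sup>2))"
      by (rule ext) (simp add: power2_eq_square algebra_simps)
    also have "integral {0..s} \<dots> = integral {0..s} (\<lambda>r. (?q r)\<^sup>2) + ((-2 * J / s) * J + (J / s)\<^sup>2 * s)"
    proof -
      have c: "((\<lambda>r::real. (J / s)\<^sup>2) has_integral (J / s)\<^sup>2 * s) {0..s}"
        using has_integral_const_real[of "(J/s)\<^sup>2" 0 s] s by (simp add: mult.commute)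
      show ?thesis unfolding J_def
        by (intro integral_unique has_integral_add has_integral_mult_right integrable_integral i c[unfolded J_def])
    qed
    also have "\<dots> = integral {0..s} (\<lambda>r. (?q r)\<^sup>2) - J\<^sup>2 / s"
      using s by (simp add: power2_eq_square field_simps)
    also have "integral {0..s} (\<lambda>r. (?q r)\<^sup>2) \<le> Q"
      unfolding Q_def by (rule integral_subset_le) (use s i in auto)
    finally have "J\<^sup>2 \<le> Q * s" using s by (simp add: field_simps)
    then have "\<bar>J\<bar> \<le> sqrt Q * sqrt s" by (metis real_sqrt_abs real_sqrt_le_mono real_sqrt_mult)
    then have "4 * s * \<bar>?F' s\<bar> \<le> sqrt Q * sqrt s" unfolding J using s by (simp add: abs_mult)
    also have "\<dots> = 4 * s * (sqrt Q / (4 * sqrt s))" using s by (simp add: field_simps)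
    finally show ?thesis by (rule mult_left_le_imp_le) (use s in simp)
  qed
  \<comment> \<open>The derivative of \<open>\<plusminus> F + (\<surd>Q / 2) \<surd>t\<close> is nonnegative.\<close>
  have mono: "c * poly F t \<le> sqrt Q / 2" if c: "\<bar>c\<bar> = 1" for c
  proof -
    have "c * poly F t + sqrt Q / 2 * sqrt t \<le> c * poly F 1 + sqrt Q / 2 * sqrt 1"
    proof (rule DERIV_nonneg_imp_increasing_open[OF t(2)])
      fix s :: real assume s: "t < s" "s < 1"
      then have s0: "s > 0" using t by simp
      have "((\<lambda>a. c * poly F a + sqrt Q / 2 * sqrt a) has_real_derivative (c * ?F' s + sqrt Q / 2 * (inverse (sqrt s) / 2))) (at s)"
        using s0 by (intro derivative_intros poly_DERIV DERIV_cmult DERIV_real_sqrt)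
      moreover have "\<bar>c * ?F' s\<bar> \<le> sqrt Q / 2 * (inverse (sqrt s) / 2)"
        using F'[of s] s s0 c by (simp add: abs_mult field_simps)
      then have "0 \<le> c * ?F' s + sqrt Q / 2 * (inverse (sqrt s) / 2)" by linarith
      ultimately show "\<exists>y. ((\<lambda>a. c * poly F a + sqrt Q / 2 * sqrt a) has_real_derivative y) (at s) \<and> 0 \<le> y" by blast
    qed (intro continuous_intros)
    moreover have "0 \<le> sqrt Q / 2 * sqrt t" using t Q0 by simp
    ultimately show ?thesis using F1 by simp
  qed
  have "\<bar>poly F t\<bar> \<le> sqrt Q / 2" using mono[of 1] mono[of "-1"] by simp
  then have "\<bar>poly F t\<bar>\<^sup>2 \<le> (sqrt Q / 2)\<^sup>2" by (intro power_mono) auto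
  then show ?thesis using Q0 by (simp add: power_divide Q_def[symmetric])
qed


text \<open>
  \<open>- \<Delta> U = p\<close> in the disk and \<open>U = 0\<close> on the circle, for polynomials written mode by mode.
\<close>

definition poisson_pair :: "(complex \<Rightarrow> real) \<Rightarrow> (complex \<Rightarrow> real) \<Rightarrow> bool" where
  "poisson_pair U p \<longleftrightarrow> (\<exists>N F. (\<forall>i. poly (F i) 1 = 0) \<and>
     U = (\<lambda>z. \<Sum>i\<in>{..N} \<times> UNIV. mode_fun i (F i) z) \<and>
     p = (\<lambda>z. \<Sum>i\<in>{..N} \<times> UNIV. mode_fun i (radial_op (fst i) (F i)) z))"

lemma radial_op_0 [simp]: "radial_op n 0 = 0"
  and radial_op_add: "radial_op n (F + G) = radial_op n F + radial_op n G"
  and radial_op_diff: "radial_op n (F - G) = radial_op n F - radial_op n G"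
  and radial_op_const: "radial_op n [:c:] = 0"
  by (simp_all only: radial_op_def pderiv_0 pderiv_add pderiv_diff pderiv_pCons mult_zero_right algebra_simps)
     simp_all

text \<open>
  On monomials \<open>radial_op n\<close> lowers the degree by one and multiplies by a nonzero number; adding a
  constant adjusts the boundary value.
\<close>

lemma radial_op_surj:
  obtains F where "radial_op n F = q" "poly F (1::real) = 0"
proof -
  let ?c = "\<lambda>m. - coeff q m / (4 * (real m + 1) * (real m + 1 + real n))"
  have mon: "radial_op n (monom (?c m) (Suc m)) = monom (coeff q m) m" for m
  proof -
    have "[:0, 1:] * pderiv (monom c m) = monom (real m * c) m" for c :: real
    proof (cases m)
      case (Suc k)
      have "[:0, 1:] * pderiv (monom c (Suc k)) = pCons 0 (monom (real (Suc k) * c) k)"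
        by (simp only: pderiv_monom) simp
      then show ?thesis by (simp only: Suc monom_Suc[symmetric])
    qed (simp add: pderiv_monom)
    from this[of "real (Suc m) * ?c m"]
    have "[:0, 1:] * pderiv (monom (real (Suc m) * ?c m) m) = monom (real m * (real (Suc m) * ?c m)) m" .
    then have "radial_op n (monom (?c m) (Suc m)) = monom (-4 * (real m * (real (Suc m) * ?c m) + (real n + 1) * (real (Suc m) * ?c m))) m"
      by (simp add: radial_op_def pderiv_monom smult_monom add_monom minus_monom algebra_simps)
    also have "-4 * (real m * (real (Suc m) * ?c m) + (real n + 1) * (real (Suc m) * ?c m)) = coeff q m"
    proof -
      have "real m + 1 \<noteq> 0" "real m + 1 + real n \<noteq> 0" by (simp_all add: add_nonneg_eq_0_iff add_pos_nonneg)
      then have h: "(4 * (real m + 1) * (real m + 1 + real n)) * ?c m = - coeff q m" by simp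
      have "-4 * (real m * (real (Suc m) * x) + (real n + 1) * (real (Suc m) * x)) = - ((4 * (real m + 1) * (real m + 1 + real n)) * x)" for x
        by (simp add: algebra_simps)
      from this[of "?c m"] show ?thesis by (simp only: h minus_minus)
    qed
    finally show ?thesis .
  qed
  define F where "F = (\<Sum>m\<le>degree q. monom (?c m) (Suc m))"
  have "radial_op n (\<Sum>m\<in>I. monom (?c m) (Suc m)) = (\<Sum>m\<in>I. monom (coeff q m) m)" if "finite I" for I
    using that by (induction I rule: finite_induct) (simp_all only: sum.empty sum.insert radial_op_0 radial_op_add mon not_False_eq_True)
  then have F: "radial_op n F = q" by (simp add: F_def poly_as_sum_of_monoms)
  show ?thesis
    by (rule that[of "F - [:poly F 1:]"]) (simp_all add: radial_op_diff radial_op_const F)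
qed

lemma poisson_pair_exists:
  assumes "disk_poly p" obtains U where "poisson_pair U p"
proof -
  obtain N q where p: "p = (\<lambda>z. \<Sum>i\<in>{..N} \<times> UNIV. mode_fun i (q i) z)"
    using disk_poly_repr[OF assms] .
  have "\<exists>F. radial_op (fst i) F = q i \<and> poly F 1 = 0" for i
    using radial_op_surj[of "fst i" "q i"] by metis
  then obtain F where F: "\<And>i. radial_op (fst i) (F i) = q i" "\<And>i. poly (F i) 1 = 0" by metis
  show ?thesis
    by (rule that[of "\<lambda>z. \<Sum>i\<in>{..N} \<times> UNIV. mode_fun i (F i) z"])
       (unfold poisson_pair_def, intro exI[of _ N] exI[of _ F], simp add: F p)
qed

lemma poisson_pair_disk_poly: "poisson_pair U p \<Longrightarrow> disk_poly U" "poisson_pair U p \<Longrightarrow> disk_poly p"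
  unfolding poisson_pair_def by (auto intro!: disk_poly_sum[where \<phi>="\<lambda>i. i"])

lemma poisson_pair_boundary: "poisson_pair U p \<Longrightarrow> cmod z = 1 \<Longrightarrow> U z = 0"
  unfolding poisson_pair_def by (elim exE conjE) (simp del: split_paired_All)

lemma poisson_pair_single:
  assumes "poly F 1 = 0"
  shows "poisson_pair (\<lambda>z. mode_fun i F z) (\<lambda>z. mode_fun i (radial_op (fst i) F) z)"
  unfolding poisson_pair_def
proof (intro exI[of _ "fst i"] exI[of _ "\<lambda>j. if j = i then F else 0"] conjI ext allI)
  have *: "(\<Sum>j\<in>{..fst i} \<times> UNIV. if j = i then x else 0) = x" for x :: real
    by (simp add: mem_Times_iff)
  fix z
  have "(\<Sum>j\<in>{..fst i} \<times> UNIV. mode_fun j (if j = i then F else 0) z)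
      = (\<Sum>j\<in>{..fst i} \<times> UNIV. if j = i then mode_fun i F z else 0)"
    by (intro sum.cong) auto
  then show "mode_fun i F z = (\<Sum>j\<in>{..fst i} \<times> UNIV. mode_fun j (if j = i then F else 0) z)"
    unfolding * ..
  have "(\<Sum>j\<in>{..fst i} \<times> UNIV. mode_fun j (radial_op (fst j) (if j = i then F else 0)) z)
      = (\<Sum>j\<in>{..fst i} \<times> UNIV. if j = i then mode_fun i (radial_op (fst i) F) z else 0)"
    by (intro sum.cong) auto
  then show "mode_fun i (radial_op (fst i) F) z = (\<Sum>j\<in>{..fst i} \<times> UNIV. mode_fun j (radial_op (fst j) (if j = i then F else 0)) z)"
    unfolding * ..
qed (use assms in simp)

lemma poisson_pair_diff:
  assumes "poisson_pair U p" "poisson_pair V r"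
  shows "poisson_pair (\<lambda>z. U z - V z) (\<lambda>z. p z - r z)"
proof -
  from assms(1) obtain N F where F: "\<forall>i. poly (F i) 1 = 0"
     "U = (\<lambda>z. \<Sum>i\<in>{..N} \<times> UNIV. mode_fun i (F i) z)"
     "p = (\<lambda>z. \<Sum>i\<in>{..N} \<times> UNIV. mode_fun i (radial_op (fst i) (F i)) z)"
    unfolding poisson_pair_def by (elim exE conjE)
  from assms(2) obtain M G where G: "\<forall>i. poly (G i) 1 = 0"
     "V = (\<lambda>z. \<Sum>i\<in>{..M} \<times> UNIV. mode_fun i (G i) z)"
     "r = (\<lambda>z. \<Sum>i\<in>{..M} \<times> UNIV. mode_fun i (radial_op (fst i) (G i)) z)"
    unfolding poisson_pair_def by (elim exE conjE)
  let ?K = "max N M"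
  have pad: "(\<Sum>i\<in>{..A} \<times> (UNIV::bool set). f i) = (\<Sum>i\<in>{..?K} \<times> UNIV. if fst i \<le> A then f i else 0)"
    if "A \<le> ?K" for A and f :: "nat \<times> bool \<Rightarrow> real"
  proof -
    have "{..A} \<times> (UNIV::bool set) = {i \<in> {..?K} \<times> UNIV. fst i \<le> A}" using that by auto
    then show ?thesis by (simp only: sum.inter_filter[symmetric] finite_SigmaI finite_atMost finite)
  qed
  let ?H = "\<lambda>i. (if fst i \<le> N then F i else 0) - (if fst i \<le> M then G i else 0)"
  show ?thesis
    unfolding poisson_pair_def
  proof (intro exI[of _ ?K] exI[of _ ?H] conjI ext allI)
    show "poly (?H i) 1 = 0" for i using F(1)[rule_format, of i] G(1)[rule_format, of i] by simp
    fix z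
    show "U z - V z = (\<Sum>i\<in>{..?K} \<times> UNIV. mode_fun i (?H i) z)"
      unfolding F(2) G(2) pad[OF max.cobounded1] pad[OF max.cobounded2] sum_subtractf[symmetric]
      by (intro sum.cong) (auto simp: algebra_simps)
    show "p z - r z = (\<Sum>i\<in>{..?K} \<times> UNIV. mode_fun i (radial_op (fst i) (?H i)) z)"
      unfolding F(3) G(3) pad[OF max.cobounded1] pad[OF max.cobounded2] sum_subtractf[symmetric]
      by (intro sum.cong) (auto simp: radial_op_diff algebra_simps)
  qed
qed

lemma transposition:
  assumes sol: "dirichlet_solution v u" and U: "poisson_pair U p"
  shows "(LINT z|disk_area. u z * p z) = (LINT z|disk_area. v z * U z)"
proof -
  from U obtain N F where F: "\<forall>i. poly (F i) 1 = 0"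
     "U = (\<lambda>z. \<Sum>i\<in>{..N} \<times> UNIV. mode_fun i (F i) z)"
     "p = (\<lambda>z. \<Sum>i\<in>{..N} \<times> UNIV. mode_fun i (radial_op (fst i) (F i)) z)"
    unfolding poisson_pair_def by (elim exE conjE)
  let ?M = "disk_area"
  have v: "integrable ?M v" and uc: "continuous_on (cball 0 1) u"
    using sol by (auto simp: dirichlet_solution_def)
  have iv: "integrable ?M (\<lambda>z. w z * (mode_fun i q z))" if w: "integrable ?M w" for w i q
  proof -
    have c: "continuous_on (cball 0 1) (\<lambda>z. mode_fun i q z)" by (intro continuous_intros)
    obtain B where B: "\<And>z. z \<in> cball 0 1 \<Longrightarrow> \<bar>mode_fun i q z\<bar> \<le> B"
      using continuous_on_compact_bound[OF compact_cball c] by blast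
    show ?thesis
    proof (rule Bochner_Integration.integrable_bound[OF integrable_mult_left[OF w, of B]])
      show "(\<lambda>z. w z * (mode_fun i q z)) \<in> borel_measurable ?M"
        by (intro borel_measurable_times borel_measurable_integrable[OF w] ess_bdd_measurable[OF ess_bdd_continuous[OF c]])
      show "AE z in ?M. norm (w z * (mode_fun i q z)) \<le> norm (w z * B)"
      proof (rule AE_I2)
        fix z assume "z \<in> space ?M"
        then have "\<bar>mode_fun i q z\<bar> \<le> \<bar>B\<bar>" using B[of z] by auto
        then show "norm (w z * (mode_fun i q z)) \<le> norm (w z * B)"
          unfolding real_norm_def abs_mult[of "w z"] by (rule mult_left_mono) simp
      qed
    qed
  qed
  have ui: "integrable ?M u" by (rule ess_bdd_integrable[OF ess_bdd_continuous[OF uc]])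
  have "(LINT z|?M. u z * p z) = (\<Sum>i\<in>{..N} \<times> UNIV. LINT z|?M. u z * (mode_fun i (radial_op (fst i) (F i)) z))"
    unfolding F(3) sum_distrib_left by (rule Bochner_Integration.integral_sum) (rule iv[OF ui])
  also have "\<dots> = (\<Sum>i\<in>{..N} \<times> UNIV. LINT z|?M. v z * (mode_fun i (F i) z))"
    by (intro sum.cong refl transposition_mode[OF sol]) (use F(1)[rule_format] in simp)
  also have "\<dots> = (LINT z|?M. v z * U z)"
    unfolding F(2) sum_distrib_left by (rule Bochner_Integration.integral_sum[symmetric]) (rule iv[OF v])
  finally show ?thesis .
qed

text \<open>
  By transposition the difference of two solutions is orthogonal to every polynomial, since every
  polynomial is \<open>- \<Delta> U\<close> for a polynomial \<open>U\<close> vanishing on the circle.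
\<close>

lemma dirichlet_solution_unique:
  assumes "dirichlet_solution v u1" "dirichlet_solution v u2"
  shows "u1 = u2"
proof -
  let ?M = "disk_area"
  have c: "continuous_on (cball 0 1) u1" "continuous_on (cball 0 1) u2"
    and out: "\<And>x. x \<notin> unit_disk \<Longrightarrow> u1 x = u2 x"
    using assms by (auto simp: dirichlet_solution_def)
  have cd: "continuous_on (cball 0 1) (\<lambda>z. u1 z - u2 z)" by (intro continuous_intros c)
  have "AE z in ?M. u1 z - u2 z = 0"
  proof (rule AE_0_if_orthogonal_to_disk_polys)
    show "ess_bdd (\<lambda>z. u1 z - u2 z)" by (rule ess_bdd_continuous[OF cd])
    fix p assume p: "disk_poly p"
    obtain U where U: "poisson_pair U p" using poisson_pair_exists[OF p] .
    have "(LINT z|?M. (u1 z - u2 z) * p z) = (LINT z|?M. u1 z * p z) - (LINT z|?M. u2 z * p z)"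
      unfolding left_diff_distrib
      by (intro Bochner_Integration.integral_diff ess_bdd_integrable ess_bdd_mult ess_bdd_continuous c ess_bdd_disk_poly p continuous_on_disk_poly)
    then show "(LINT z|?M. (u1 z - u2 z) * p z) = 0"
      by (simp add: transposition[OF assms(1) U] transposition[OF assms(2) U])
  qed
  then have ae: "AE z in lebesgue. z \<in> unit_disk \<longrightarrow> u1 z - u2 z = 0" by (simp add: AE_lebesgue_on_disk_iff)
  have "u1 z - u2 z = 0" if z: "z \<in> unit_disk" for z
  proof (rule ccontr)
    assume nz: "u1 z - u2 z \<noteq> 0"
    have "open (unit_disk \<inter> (\<lambda>z. u1 z - u2 z) -` (- {0}))"
      by (intro continuous_open_preimage continuous_on_subset[OF cd ball_subset_cball]) auto
    moreover have "z \<in> unit_disk \<inter> (\<lambda>z. u1 z - u2 z) -` (- {0})" using z nz by auto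
    moreover have "unit_disk \<inter> (\<lambda>z. u1 z - u2 z) -` (- {0}) \<in> null_sets lebesgue"
    proof -
      have "{x \<in> space lebesgue. \<not> (x \<in> unit_disk \<longrightarrow> u1 x - u2 x = 0)} \<in> null_sets lebesgue"
        using ae by (subst (asm) completion.AE_iff_null_sets) (auto intro: null_sets_completion_subset)
      moreover have "{x \<in> space lebesgue. \<not> (x \<in> unit_disk \<longrightarrow> u1 x - u2 x = 0)} = unit_disk \<inter> (\<lambda>z. u1 z - u2 z) -` (- {0})"
        by auto
      ultimately show ?thesis by simp
    qed
    ultimately show False using open_not_negligible negligible_iff_null_sets by blast
  qed
  then show ?thesis using out by (intro ext) (metis eq_iff_diff_eq_0)
qed

lemma green_op_eq: "dirichlet_solution v u \<Longrightarrow> green_op v = u"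
  unfolding green_op_def by (blast intro: the_equality dirichlet_solution_unique)

lemma poisson_pair_laplacian:
  assumes "poisson_pair U p" shows "- laplacian U z = p z"
proof -
  from assms obtain N F where F: "\<forall>i. poly (F i) 1 = 0"
     "U = (\<lambda>z. \<Sum>i\<in>{..N} \<times> UNIV. mode_fun i (F i) z)"
     "p = (\<lambda>z. \<Sum>i\<in>{..N} \<times> UNIV. mode_fun i (radial_op (fst i) (F i)) z)"
    unfolding poisson_pair_def by (elim exE conjE)
  have sum: "laplacian (\<lambda>z. \<Sum>i\<in>I. mode_fun i (F i) z) z
     = (\<Sum>i\<in>I. laplacian (\<lambda>z. mode_fun i (F i) z) z)" if "finite I" for I z
    using that
  proof (induction I rule: finite_induct)
    case empty
    have "partial_deriv b (\<lambda>z::complex. 0) = (\<lambda>z. 0)" for b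
      by (rule ext, rule partial_deriv_eq) (rule has_derivative_const)
    then show ?case by (simp add: laplacian_def)
  next
    case (insert i I)
    let ?f = "\<lambda>z. mode_fun i (F i) z" and ?g = "\<lambda>z. \<Sum>i\<in>I. mode_fun i (F i) z"
    have f: "C_k k ?f" and g: "C_k k ?g" for k
      using disk_poly_C_k[OF disk_poly.mode] disk_poly_C_k[OF disk_poly_sum[OF insert.hyps(1), of "\<lambda>i. i"]] by auto
    have add: "partial_deriv b (\<lambda>z. f z + g z) = (\<lambda>z. partial_deriv b f z + partial_deriv b g z)"
      if "\<And>z. f differentiable (at z)" "\<And>z. g differentiable (at z)" for f g :: "complex \<Rightarrow> real" and b
    proof
      fix z
      have "((\<lambda>z. f z + g z) has_derivative (\<lambda>h. frechet_derivative f (at z) h + frechet_derivative g (at z) h)) (at z)"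
        using that frechet_derivative_works by (intro has_derivative_add) blast+
      then show "partial_deriv b (\<lambda>z. f z + g z) z = partial_deriv b f z + partial_deriv b g z"
        by (simp add: partial_deriv_eq) (simp add: partial_deriv_def)
    qed
    have "laplacian (\<lambda>z. ?f z + ?g z) z = laplacian ?f z + laplacian ?g z"
      unfolding laplacian_def sum.distrib[symmetric]
    proof (rule sum.cong[OF refl])
      fix b :: complex assume b: "b \<in> Basis"
      have 1: "partial_deriv b (\<lambda>z. ?f z + ?g z) = (\<lambda>z. partial_deriv b ?f z + partial_deriv b ?g z)"
        using C_k_SucD(1)[OF f] C_k_SucD(1)[OF g] by (rule add)
      show "partial_deriv b (partial_deriv b (\<lambda>z. ?f z + ?g z)) z = partial_deriv b (partial_deriv b ?f) z + partial_deriv b (partial_deriv b ?g) z"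
        unfolding 1
        using add[OF C_k_SucD(1)[OF C_k_SucD(2)[OF f b]] C_k_SucD(1)[OF C_k_SucD(2)[OF g b]]] by simp
    qed
    then show ?case using insert by simp
  qed
  show ?thesis
    unfolding F(2,3) by (subst sum) (simp_all add: sum_negf[symmetric] laplacian_poly_mode del: sum_negf)
qed

lemma poisson_pair_solution:
  assumes "poisson_pair U p"
  shows "dirichlet_solution p (\<lambda>z. if z \<in> unit_disk then U z else 0)"
  unfolding dirichlet_solution_def
proof (intro conjI allI impI)
  note dp = poisson_pair_disk_poly[OF assms]
  show "integrable (disk_area) p" by (intro ess_bdd_integrable ess_bdd_disk_poly dp)
  show "continuous_on (cball 0 1) (\<lambda>z. if z \<in> unit_disk then U z else 0)"
  proof (rule continuous_on_eq[OF continuous_on_disk_poly[OF dp(1)]])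
    fix z :: complex assume "z \<in> cball 0 1"
    then show "U z = (if z \<in> unit_disk then U z else 0)"
      using poisson_pair_boundary[OF assms, of z] by auto
  qed
  fix \<phi> assume \<phi>: "disk_test_function \<phi>"
  have "(LINT x|disk_area. (if x \<in> unit_disk then U x else 0) * (- laplacian \<phi> x))
    = (LINT x|disk_area. U x * (- laplacian \<phi> x))"
    by (intro Bochner_Integration.integral_cong) auto
  also have "\<dots> = (LINT x|disk_area. (- laplacian U x) * \<phi> x)"
    by (rule green_test_function[OF disk_poly_C_k[OF dp(1)] \<phi>])
  also have "\<dots> = (LINT x|disk_area. p x * \<phi> x)"
    by (simp only: poisson_pair_laplacian[OF assms])
  finally show "(LINT x|disk_area. (if x \<in> unit_disk then U x else 0) * (- laplacian \<phi> x))
      = (LINT x|disk_area. p x * \<phi> x)" .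
qed auto

section \<open>Bessel functions and the radial spectral gap\<close>

definition clifford_coeff :: "nat \<Rightarrow> nat \<Rightarrow> real" where
  "clifford_coeff n m = (-1) ^ m / (fact m * fact (m + n))"

text \<open>
  The Bessel-Clifford function \<open>C\<^sub>n\<close>, with \<open>J\<^sub>n(x) = (x / 2)\<^sup>n C\<^sub>n(x\<^sup>2 / 4)\<close>. It is the entire function of
  \<open>t = r\<^sup>2\<close> that remains of a Bessel function after its angular factor \<open>r\<^sup>n\<close> is split off.
\<close>

definition clifford :: "nat \<Rightarrow> real \<Rightarrow> real" where
  "clifford n s = (\<Sum>m. clifford_coeff n m * s ^ m)"

lemma summable_clifford: "summable (\<lambda>m. clifford_coeff n m * s ^ m)"
proof (rule summable_comparison_test')
  show "summable (\<lambda>m. inverse (fact m) * \<bar>s\<bar> ^ m)" by (rule summable_exp)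
  fix m :: nat assume "m \<ge> 0"
  have "(1::real) \<le> fact (m + n)" by (rule fact_ge_1)
  then have "inverse (fact m * fact (m + n)) \<le> inverse (fact m :: real)"
    by (intro le_imp_inverse_le) (auto simp: mult_le_cancel_left1)
  then have "inverse (fact m * fact (m + n)) * \<bar>s\<bar> ^ m \<le> inverse (fact m) * \<bar>s\<bar> ^ m"
    by (intro mult_right_mono) auto
  then show "norm (clifford_coeff n m * s ^ m) \<le> inverse (fact m) * \<bar>s\<bar> ^ m"
    by (simp add: clifford_coeff_def abs_mult power_abs divide_inverse)
qed

lemma clifford_sums: "(\<lambda>m. clifford_coeff n m * s ^ m) sums clifford n s"
  unfolding clifford_def using summable_clifford by (rule summable_sums)

lemma clifford_has_derivative: "(clifford n has_real_derivative - clifford (Suc n) s) (at s)"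
proof -
  have "(clifford n has_real_derivative (\<Sum>m. diffs (clifford_coeff n) m * s ^ m)) (at s)"
    unfolding clifford_def[abs_def] by (rule termdiffs_strong_converges_everywhere) (rule summable_clifford)
  moreover have "diffs (clifford_coeff n) m * s ^ m = - (clifford_coeff (Suc n) m * s ^ m)" for m
  proof -
    have "real (Suc m) * ((-1) ^ Suc m / (real (Suc m) * f * g)) = - ((-1) ^ m / (f * g))" for f g :: real
      by (simp del: of_nat_Suc)
    from this[of "fact m" "fact (Suc m + n)"] show ?thesis
      by (simp only: diffs_def clifford_coeff_def fact_Suc[of m] add_Suc add_Suc_right of_nat_mult of_nat_fact)
  qed
  ultimately show ?thesis
    by (simp only: suminf_minus[OF summable_clifford] clifford_def)
qed

lemma clifford_recurrence: "clifford n s = (real n + 1) * clifford (Suc n) s - s * clifford (Suc (Suc n)) s"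
proof -
  let ?b = "\<lambda>m. case m of 0 \<Rightarrow> 0 | Suc k \<Rightarrow> clifford_coeff (Suc (Suc n)) k * s ^ Suc k"
  have "(\<lambda>k. s * (clifford_coeff (Suc (Suc n)) k * s ^ k)) sums (s * clifford (Suc (Suc n)) s)"
    by (intro sums_mult clifford_sums)
  then have "(\<lambda>k. ?b (Suc k)) sums (s * clifford (Suc (Suc n)) s)" by (simp only: nat.case power_Suc mult_ac)
  then have "?b sums (s * clifford (Suc (Suc n)) s + ?b 0)" by (rule sums_Suc_iff[THEN iffD1])
  then have b: "?b sums (s * clifford (Suc (Suc n)) s)" by (simp only: nat.case add_0_right)
  have "clifford_coeff n m * s ^ m = (real n + 1) * (clifford_coeff (Suc n) m * s ^ m) - ?b m" for m
  proof (cases m)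
    case 0
    have "real n + 1 \<noteq> 0" "(fact (Suc n) :: real) = (real n + 1) * fact n" by (simp_all add: add_nonneg_eq_0_iff)
    then show ?thesis unfolding 0 clifford_coeff_def by (simp del: fact_Suc)
  next
    case (Suc k)
    have f: "(fact (Suc k + Suc n) :: real) = (real k + real n + 2) * fact (Suc k + n)" by simp
    have c1: "clifford_coeff (Suc n) m = clifford_coeff n m / (real k + real n + 2)"
      unfolding clifford_coeff_def Suc f by simp
    have c2: "clifford_coeff (Suc (Suc n)) k = - clifford_coeff n m * (real k + 1) / (real k + real n + 2)"
    proof -
      have "k + Suc (Suc n) = Suc k + Suc n" by simp
      moreover have "(-1) ^ k / (f * (a * g)) = - ((-1) ^ Suc k / ((real (Suc k) * f) * g)) * real (Suc k) / a"
        for a f g :: real by (simp del: of_nat_Suc)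
      from this[of "fact k" "real k + real n + 2" "fact (Suc k + n)"]
      have "(-1) ^ k / (fact k * ((real k + real n + 2) * fact (Suc k + n)))
        = - ((-1) ^ Suc k / ((real (Suc k) * fact k) * fact (Suc k + n))) * (real k + 1) / (real k + real n + 2)"
        by (simp only: of_nat_Suc add.commute[of 1 "real k"])
      moreover have "(fact (Suc k) :: real) = real (Suc k) * fact k" by simp
      ultimately show ?thesis unfolding clifford_coeff_def Suc by (simp only: f)
    qed
    have nz: "real k + real n + 2 \<noteq> 0" by (simp add: add_nonneg_eq_0_iff)
    have "clifford_coeff n m = (real n + 1) * clifford_coeff (Suc n) m - clifford_coeff (Suc (Suc n)) k"
    proof -
      have e: "p * (x / a) - (- x * q / a) = x * ((p + q) / a)" for p q x a :: real
        by (simp add: add_divide_distrib distrib_left mult.commute)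
      have one: "(real n + 1 + (real k + 1)) / (real k + real n + 2) = 1" using nz by (simp add: add_ac)
      show ?thesis unfolding c1 c2 e one by (rule mult_1_right[symmetric])
    qed
    then show ?thesis by (simp only: Suc nat.case) (simp add: algebra_simps)
  qed
  then have "(\<lambda>m. clifford_coeff n m * s ^ m) sums ((real n + 1) * clifford (Suc n) s - s * clifford (Suc (Suc n)) s)"
    using sums_diff[OF sums_mult[OF clifford_sums[of "Suc n" s], of "real n + 1"] b] by simp
  then show ?thesis using clifford_sums sums_unique2 by blast
qed

lemma clifford_0 [simp]: "clifford n 0 = 1 / fact n"
  unfolding clifford_def using powser_zero[of "clifford_coeff n"] by (simp add: clifford_coeff_def)

lemma bessel_J_clifford: "bessel_J n x = (x / 2) ^ n * clifford n ((x / 2)\<^sup>2)"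
proof -
  have "(-1) ^ m / (fact m * fact (m + n)) * (x / 2) ^ (2 * m + n)
      = (x / 2) ^ n * (clifford_coeff n m * ((x / 2)\<^sup>2) ^ m)" for m
    by (simp only: power_add power_mult) (simp only: clifford_coeff_def mult_ac)
  then show ?thesis
    by (simp only: bessel_J_def clifford_def suminf_mult[OF summable_clifford])
qed

lemma continuous_on_clifford [continuous_intros]:
  assumes "continuous_on S f" shows "continuous_on S (\<lambda>x. clifford n (f x))"
proof -
  have "continuous_on UNIV (clifford n)" by (rule continuous_on_if_DERIV[OF clifford_has_derivative])
  then show ?thesis using assms by (rule continuous_on_compose2) simp
qed

text \<open>
  After five terms, whose sum is negative, the series alternates with decreasing terms and continues
  with a negative one.
\<close>

lemma clifford_1_4_neg: "clifford 1 4 < 0"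
proof -
  define a where "a m = (4::real) ^ (m + 5) / (fact (m + 5) * fact (m + 6))" for m
  have tail: "clifford_coeff 1 (m + 5) * 4 ^ (m + 5) = - ((-1) ^ m * a m)" for m
  proof -
    have e: "m + 5 + 1 = m + 6" by simp
    show ?thesis unfolding clifford_coeff_def a_def e by (simp add: power_add)
  qed
  have apos: "a m > 0" for m by (simp add: a_def)
  have step: "a (Suc m) = a m * (4 / ((real m + 6) * (real m + 7)))" for m
  proof -
    have f: "(fact (Suc m + 5) :: real) = (real m + 6) * fact (m + 5)" "(fact (Suc m + 6) :: real) = (real m + 7) * fact (m + 6)"
    proof -
      have "real (Suc (m + 5)) = real m + 6" "real (Suc (m + 6)) = real m + 7" by simp_all
      then show "(fact (Suc m + 5) :: real) = (real m + 6) * fact (m + 5)" "(fact (Suc m + 6) :: real) = (real m + 7) * fact (m + 6)"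
        by (simp_all only: add_Suc fact_Suc of_nat_mult of_nat_fact)
    qed
    have "(4 * P) / ((x * F) * (y * G)) = P / (F * G) * (4 / (x * y))" for P x y F G :: real
      by (simp add: mult_ac)
    then show ?thesis unfolding a_def f unfolding add_Suc power_Suc .
  qed
  have dec: "a (Suc m) \<le> a m" for m
  proof -
    have "(6::real) * 7 \<le> (real m + 6) * (real m + 7)" by (intro mult_mono) auto
    then have "4 / ((real m + 6) * (real m + 7)) \<le> 1" by (simp add: divide_le_eq)
    then have "a m * (4 / ((real m + 6) * (real m + 7))) \<le> a m * 1" using apos[of m] by (intro mult_left_mono) auto
    then show ?thesis by (simp add: step)
  qed
  have sm: "summable (\<lambda>m. clifford_coeff 1 (m + 5) * 4 ^ (m + 5))"
    by (rule summable_ignore_initial_segment[OF summable_clifford])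
  have "(\<lambda>m. \<bar>clifford_coeff 1 (m + 5) * 4 ^ (m + 5)\<bar>) \<longlonglongrightarrow> 0"
    by (intro tendsto_rabs_zero summable_LIMSEQ_zero[OF sm])
  moreover have "\<bar>clifford_coeff 1 (m + 5) * 4 ^ (m + 5)\<bar> = a m" for m
    unfolding tail using apos[of m] by (simp add: abs_mult)
  ultimately have "a \<longlonglongrightarrow> 0" by simp
  then have "0 \<le> (\<Sum>m. (-1) ^ m * a m)"
    using summable_Leibniz'(2)[of a 0, OF _ less_imp_le[OF apos] dec] by simp
  moreover have "(\<Sum>m. clifford_coeff 1 (m + 5) * 4 ^ (m + 5)) = - (\<Sum>m. (-1) ^ m * a m)"
  proof -
    have "summable (\<lambda>m. - ((-1) ^ m * a m))" using sm unfolding tail .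
    then have "summable (\<lambda>m. (-1) ^ m * a m)" by (simp only: summable_minus_iff)
    then show ?thesis unfolding tail by (rule suminf_minus)
  qed
  ultimately have "(\<Sum>m. clifford_coeff 1 (m + 5) * 4 ^ (m + 5)) \<le> 0" by simp
  moreover have "clifford 1 4 = (\<Sum>m. clifford_coeff 1 (m + 5) * 4 ^ (m + 5)) + (\<Sum>m<5. clifford_coeff 1 m * 4 ^ m)"
    unfolding clifford_def by (rule suminf_split_initial_segment[OF summable_clifford])
  moreover have "(\<Sum>m<5. clifford_coeff 1 m * 4 ^ m) < 0"
    by (simp add: clifford_coeff_def numeral_eq_Suc)
  ultimately show ?thesis by linarith
qed

text \<open>
  A quarter of the critical eigenvalue \<open>j\<^sup>2\<close>; in the variable \<open>t = |z|\<^sup>2\<close> it is the first positive zero of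
  \<open>clifford 1\<close>.
\<close>

definition kappa :: real where "kappa = (bessel_J1_zero / 2)\<^sup>2"

lemma kappa_props: "kappa > 0" "clifford 1 kappa = 0" "\<And>s. 0 \<le> s \<Longrightarrow> s < kappa \<Longrightarrow> clifford 1 s > 0"
  and bessel_J1_zero_pos: "bessel_J1_zero > 0"
proof -
  let ?S = "{s \<in> {0..4}. clifford 1 s = 0}"
  have cont: "continuous_on A (clifford 1)" for A by (rule continuous_on_clifford[OF continuous_on_id])
  obtain s0 where "0 \<le> s0" "s0 \<le> 4" "clifford 1 s0 = 0"
    using IVT2'[of "clifford 1" 4 0 0] clifford_1_4_neg cont by auto
  then have ne: "?S \<noteq> {}" by auto
  have "closed ?S" by (rule continuous_closed_preimage_constant[OF cont]) simp
  then have "compact ?S" by (auto simp: compact_eq_bounded_closed intro: bounded_subset[of "{0..4}"])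
  then obtain k where k: "k \<in> ?S" "\<And>s. s \<in> ?S \<Longrightarrow> k \<le> s"
    using continuous_attains_inf[OF _ ne continuous_on_id] by blast
  have kp: "k > 0" using k(1) clifford_0[of 1] by (cases "k = 0") auto
  have first: "k \<le> s" if "0 \<le> s" "clifford 1 s = 0" for s
    using that k by (cases "s \<le> 4") force+
  have j: "bessel_J1_zero = 2 * sqrt k"
    unfolding bessel_J1_zero_def
  proof (rule Least_equality)
    show "0 < 2 * sqrt k \<and> bessel_J 1 (2 * sqrt k) = 0"
      using k(1) kp by (simp add: bessel_J_clifford)
    fix x :: real assume x: "0 < x \<and> bessel_J 1 x = 0"
    then have "clifford 1 ((x / 2)\<^sup>2) = 0" by (auto simp: bessel_J_clifford)
    then have "k \<le> (x / 2)\<^sup>2" by (intro first) auto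
    then have "sqrt k \<le> x / 2" using x by (intro real_le_lsqrt) auto
    then show "2 * sqrt k \<le> x" by simp
  qed
  have kk: "kappa = k" unfolding kappa_def j using kp by simp
  have "bessel_J1_zero > 0" unfolding j using kp by simp
  then show "kappa > 0" "clifford 1 kappa = 0" "bessel_J1_zero > 0" using kp k(1) kk by simp_all
  show "clifford 1 s > 0" if s: "0 \<le> s" "s < kappa" for s
  proof (rule ccontr)
    assume "\<not> clifford 1 s > 0"
    then obtain r where "0 \<le> r" "r \<le> s" "clifford 1 r = 0"
      using IVT2'[of "clifford 1" s 0 0] s cont by auto
    then show False using first[of r] s kk by simp
  qed
qed

text \<open>
  Positivity passes from one order to the next because \<open>s\<^sup>n\<^sup>+\<^sup>1 C\<^sub>n\<^sub>+\<^sub>1\<close> has derivative \<open>s\<^sup>n C\<^sub>n\<close>. At the right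
  end point strict positivity is gained.
\<close>

lemma clifford_pos_Suc:
  assumes n: "n \<ge> 1" and pos: "\<And>s. 0 \<le> s \<Longrightarrow> s < k \<Longrightarrow> clifford n s > 0" and s: "0 \<le> s" "s \<le> k"
  shows "clifford (Suc n) s > 0"
proof (cases "s = 0")
  case False
  then have s0: "s > 0" using s by simp
  have "0 ^ Suc n * clifford (Suc n) 0 < s ^ Suc n * clifford (Suc n) s"
  proof (rule DERIV_pos_imp_increasing_open[OF s0])
    fix x assume x: "0 < x" "x < s"
    have "((\<lambda>s. s ^ Suc n * clifford (Suc n) s) has_real_derivative
        (real n + 1) * x ^ n * clifford (Suc n) x + (- clifford (Suc (Suc n)) x) * x ^ Suc n) (at x)"
      by (rule DERIV_mult[OF has_real_derivative_power_Suc clifford_has_derivative])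
    moreover have "(real n + 1) * x ^ n * clifford (Suc n) x + (- clifford (Suc (Suc n)) x) * x ^ Suc n = x ^ n * clifford n x"
      unfolding clifford_recurrence[of n] by (simp add: algebra_simps)
    moreover have "x ^ n * clifford n x > 0" using x s pos[of x] by simp
    ultimately show "\<exists>y. ((\<lambda>s. s ^ Suc n * clifford (Suc n) s) has_real_derivative y) (at x) \<and> 0 < y" by metis
  qed (intro continuous_intros)
  then have "0 < s ^ Suc n * clifford (Suc n) s" by simp
  then show ?thesis by (rule zero_less_mult_pos) (use s0 in simp)
qed simp

lemma clifford_pos_less: "n \<ge> 1 \<Longrightarrow> 0 \<le> s \<Longrightarrow> s < kappa \<Longrightarrow> clifford n s > 0"
proof (induction n arbitrary: s rule: dec_induct)
  case base then show ?case using kappa_props(3) by simp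
next
  case (step n)
  show ?case by (rule clifford_pos_Suc[of n kappa]) (use step in auto)
qed

lemma clifford_pos_le:
  assumes "n \<ge> 2" "0 \<le> s" "s \<le> kappa" shows "clifford n s > 0"
proof -
  obtain m where m: "n = Suc m" "m \<ge> 1" using assms(1) by (cases n) auto
  show ?thesis unfolding m(1) by (rule clifford_pos_Suc[of m kappa]) (use m assms clifford_pos_less in auto)
qed

lemma clifford_scaled_DERIV:
  "((\<lambda>t. c * clifford n (k * t)) has_real_derivative - (c * k) * clifford (Suc n) (k * t)) (at t)"
proof -
  have "((\<lambda>t. k * t) has_real_derivative k) (at t)" by (auto intro!: derivative_eq_intros)
  from DERIV_cmult[OF DERIV_chain2[OF clifford_has_derivative this], of c n] show ?thesis by (simp add: mult_ac)
qed

lemma clifford_0_eq_DERIV: "((\<lambda>t. t * clifford 1 (kappa * t)) has_real_derivative clifford 0 (kappa * t)) (at t)"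
proof -
  have "((\<lambda>t. t * (1 * clifford 1 (kappa * t))) has_real_derivative 1 * (1 * clifford 1 (kappa * t)) + (- (1 * kappa) * clifford (Suc 1) (kappa * t)) * t) (at t)"
    by (rule DERIV_mult[OF DERIV_ident clifford_scaled_DERIV])
  then show ?thesis using clifford_recurrence[of 0 "kappa * t"] by (simp add: mult_ac)
qed

text \<open>
  The rescaled Bessel equation; this is the eigenvalue equation required by \<open>radial_picone\<close>.
\<close>

lemma clifford_ode:
  "t * (k * k * clifford (Suc (Suc n)) (k * t)) + (real n + 1) * (- k * clifford (Suc n) (k * t)) = - k * clifford n (k * t)"
  unfolding clifford_recurrence[of n "k * t"] by (simp add: algebra_simps)

text \<open>
  For \<open>k < \<kappa>\<close> the comparison function \<open>C\<^sub>n(k t)\<close> is positive up to and including \<open>t = 1\<close>, so Picone's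
  identity applies without boundary terms. Then let \<open>k\<close> tend to \<open>\<kappa>\<close>.
\<close>

lemma radial_rayleigh:
  assumes n: "n \<ge> 1" and F1: "poly F (1::real) = 0"
  shows "kappa * integral {0..1} (\<lambda>t. t ^ n * (poly F t)\<^sup>2) \<le> integral {0..1} (\<lambda>t. t ^ Suc n * (poly (pderiv F) t)\<^sup>2)"
proof (rule field_le_mult_one_interval)
  fix x :: real assume x: "0 < x" "x < 1"
  let ?k = "x * kappa"
  have k: "0 \<le> ?k" "?k < kappa" using x kappa_props(1) by auto
  have "?k * integral {0..1} (\<lambda>t. t ^ n * (poly F t)\<^sup>2) \<le> integral {0..1} (\<lambda>t. t ^ Suc n * (poly (pderiv F) t)\<^sup>2)"
  proof (rule radial_picone[where \<phi>="\<lambda>t. clifford n (?k * t)" and \<phi>'="\<lambda>t. - ?k * clifford (Suc n) (?k * t)" and \<phi>''="\<lambda>t. ?k * ?k * clifford (Suc (Suc n)) (?k * t)"])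
    show "((\<lambda>t. clifford n (?k * t)) has_real_derivative - ?k * clifford (Suc n) (?k * t)) (at t)" for t
      using clifford_scaled_DERIV[of 1 n ?k t] by simp
    show "((\<lambda>t. - ?k * clifford (Suc n) (?k * t)) has_real_derivative ?k * ?k * clifford (Suc (Suc n)) (?k * t)) (at t)" for t
      using clifford_scaled_DERIV[of "- ?k" "Suc n" ?k t] by (simp add: mult_ac)
    show "t * (?k * ?k * clifford (Suc (Suc n)) (?k * t)) + (real n + 1) * (- ?k * clifford (Suc n) (?k * t)) = - ?k * clifford n (?k * t)" for t
      by (rule clifford_ode)
    show "0 < clifford n (?k * t)" if "t \<in> {0..1}" for t
    proof (rule clifford_pos_less[OF n])
      show "0 \<le> ?k * t" using k that by simp
      have "?k * t \<le> ?k" using k that mult_left_le[of t ?k] by simp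
      then show "?k * t < kappa" using k(2) by (rule le_less_trans)
    qed
  qed (auto intro!: poly_DERIV continuous_intros F1)
  then show "x * (kappa * integral {0..1} (\<lambda>t. t ^ n * (poly F t)\<^sup>2)) \<le> integral {0..1} (\<lambda>t. t ^ Suc n * (poly (pderiv F) t)\<^sup>2)"
    by (simp add: mult.assoc)
qed

text \<open>
  With \<open>A = \<integral> t\<^sup>n q F\<close> and \<open>m = \<integral> t\<^sup>n F\<^sup>2\<close>, expand \<open>\<integral> t\<^sup>n (q - 4 \<kappa> F)\<^sup>2 \<ge> 0\<close> and use \<open>4 \<kappa> m \<le> A\<close>, which is the
  Rayleigh inequality.
\<close>

lemma radial_energy_inequality_pos:
  assumes n: "n \<ge> 1" and F1: "poly F (1::real) = 0"
  shows "4 * kappa * integral {0..1} (\<lambda>t. t ^ n * (poly (radial_op n F) t * poly F t))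
    \<le> integral {0..1} (\<lambda>t. t ^ n * (poly (radial_op n F) t)\<^sup>2)"
proof -
  let ?q = "poly (radial_op n F)" and ?l = "4 * kappa"
  have i: "(\<lambda>t. t ^ n * (poly p t)\<^sup>2) integrable_on {0..1}" "(\<lambda>t. t ^ n * (poly p t * poly r t)) integrable_on {0..1}" for p r :: "real poly"
    by (intro integrable_continuous_interval continuous_intros)+
  define A where "A = integral {0..1} (\<lambda>t. t ^ n * (?q t * poly F t))"
  define m where "m = integral {0..1} (\<lambda>t. t ^ n * (poly F t)\<^sup>2)"
  have Am: "?l * m \<le> A"
    using radial_rayleigh[OF n F1] radial_op_energy[OF F1, of n] by (simp add: A_def m_def)
  have "0 \<le> integral {0..1} (\<lambda>t. t ^ n * (?q t - ?l * poly F t)\<^sup>2)"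
    by (rule integral_nonneg) (auto intro!: integrable_continuous_interval continuous_intros)
  also have "(\<lambda>t. t ^ n * (?q t - ?l * poly F t)\<^sup>2) = (\<lambda>t. t ^ n * (?q t)\<^sup>2 + ((-2 * ?l) * (t ^ n * (?q t * poly F t)) + ?l\<^sup>2 * (t ^ n * (poly F t)\<^sup>2)))"
    by (rule ext) (simp add: power2_eq_square algebra_simps)
  also have "integral {0..1} \<dots> = integral {0..1} (\<lambda>t. t ^ n * (?q t)\<^sup>2) + ((-2 * ?l) * A + ?l\<^sup>2 * m)"
    unfolding A_def m_def
    by (intro integral_unique has_integral_add has_integral_mult_right integrable_integral i)
  finally have "2 * ?l * A - ?l * (?l * m) \<le> integral {0..1} (\<lambda>t. t ^ n * (?q t)\<^sup>2)"
    by (simp add: power2_eq_square algebra_simps)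
  moreover have "?l * (?l * m) \<le> ?l * A" using Am kappa_props(1) by (intro mult_left_mono) auto
  ultimately show ?thesis unfolding A_def[symmetric] by linarith
qed

text \<open>
  The mean-zero condition makes \<open>g = F'\<close> vanish at \<open>1\<close>. Then \<open>\<integral> q\<^sup>2 = 16 \<integral> t\<^sup>2 g'\<^sup>2\<close> and \<open>\<integral> q F = 4 \<integral> t g\<^sup>2\<close>, so
  the claim is the Rayleigh inequality of frequency \<open>1\<close> for \<open>g\<close>.
\<close>

lemma radial_energy_inequality_0:
  assumes F1: "poly F (1::real) = 0" and mean: "integral {0..1} (poly (radial_op 0 F)) = 0"
  shows "4 * kappa * integral {0..1} (\<lambda>t. poly (radial_op 0 F) t * poly F t)
    \<le> integral {0..1} (\<lambda>t. (poly (radial_op 0 F) t)\<^sup>2)"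
proof -
  let ?q = "poly (radial_op 0 F)" and ?g = "poly (pderiv F)" and ?g' = "poly (pderiv (pderiv F))"
  have d: "((\<lambda>t. -4 * (t * ?g t)) has_real_derivative ?q t) (at t)" for t
    by (auto intro!: derivative_eq_intros poly_DERIV simp: poly_radial_op)
  have g1: "poly (pderiv F) 1 = 0" using integral_01_FTC(1)[OF d] mean by simp
  have i: "(\<lambda>t. t ^ a * (?g' t)\<^sup>2) integrable_on {0..1}" for a by (intro integrable_continuous_interval continuous_intros)
  have d2: "((\<lambda>t. t * (?g t)\<^sup>2) has_real_derivative (?g t)\<^sup>2 + 2 * t * (?g t * ?g' t)) (at t)" for t
    by (auto intro!: derivative_eq_intros poly_DERIV simp: power2_eq_square)
  have z: "integral {0..1} (\<lambda>t. (?g t)\<^sup>2 + 2 * t * (?g t * ?g' t)) = 0"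
    and zi: "(\<lambda>t. (?g t)\<^sup>2 + 2 * t * (?g t * ?g' t)) integrable_on {0..1}"
    using integral_01_FTC[OF d2] g1 by simp_all
  have "integral {0..1} (\<lambda>t. (?q t)\<^sup>2) = integral {0..1} (\<lambda>t. 16 * (t ^ 2 * (?g' t)\<^sup>2) + 16 * ((?g t)\<^sup>2 + 2 * t * (?g t * ?g' t)))"
    by (rule arg_cong[where f="integral {0..1}"], rule ext) (simp add: poly_radial_op power2_eq_square algebra_simps)
  also have "\<dots> = 16 * integral {0..1} (\<lambda>t. t ^ 2 * (?g' t)\<^sup>2) + 16 * 0"
    by (intro integral_unique has_integral_add has_integral_mult_right integrable_integral i zi[THEN integrable_integral, unfolded z])
  finally have q: "integral {0..1} (\<lambda>t. (?q t)\<^sup>2) = 16 * integral {0..1} (\<lambda>t. t ^ 2 * (?g' t)\<^sup>2)" by simp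
  have "kappa * integral {0..1} (\<lambda>t. t * (?g t)\<^sup>2) \<le> integral {0..1} (\<lambda>t. t ^ 2 * (?g' t)\<^sup>2)"
    using radial_rayleigh[of 1, OF _ g1] by (simp add: power2_eq_square)
  moreover have "integral {0..1} (\<lambda>t. ?q t * poly F t) = 4 * integral {0..1} (\<lambda>t. t * (?g t)\<^sup>2)"
    using radial_op_energy[OF F1, of 0] by simp
  ultimately show ?thesis by (simp add: q)
qed

section \<open>The solution operator and the energy inequality\<close>

lemma integral_mode_sums:
  assumes "finite I"
  shows "(LINT z|disk_area. (\<Sum>i\<in>I. mode_fun i (a i) z) * (\<Sum>i\<in>I. mode_fun i (b i) z))
    = (\<Sum>i\<in>I. harm_weight i * integral {0..1} (\<lambda>t. t ^ fst i * (poly (a i) t * poly (b i) t)))"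
proof -
  let ?M = "disk_area"
  let ?t = "\<lambda>i j z. harm i z * harm j z * (poly (a i) (nsq z) * poly (b j) (nsq z))"
  have c: "continuous_on {0..1} (\<lambda>t. poly (a i) t * poly (b j) t)" for i j by (intro continuous_intros)
  have int: "integrable ?M (?t i j)" for i j
    by (intro ess_bdd_integrable ess_bdd_continuous continuous_intros)
  have "(LINT z|?M. (\<Sum>i\<in>I. mode_fun i (a i) z) * (\<Sum>i\<in>I. mode_fun i (b i) z))
    = (LINT z|?M. (\<Sum>i\<in>I. \<Sum>j\<in>I. ?t i j z))"
    unfolding sum_product by (intro Bochner_Integration.integral_cong refl sum.cong) (simp_all add: mult_ac)
  also have "\<dots> = (\<Sum>i\<in>I. \<Sum>j\<in>I. (LINT z|?M. ?t i j z))"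
    by (subst Bochner_Integration.integral_sum, intro Bochner_Integration.integrable_sum int)
       (intro sum.cong refl Bochner_Integration.integral_sum int)
  also have "\<dots> = (\<Sum>i\<in>I. \<Sum>j\<in>I. if i = j then harm_weight i * integral {0..1} (\<lambda>t. t ^ fst i * (poly (a i) t * poly (b j) t)) else 0)"
    by (intro sum.cong refl harm_orthogonal c)
  also have "\<dots> = (\<Sum>i\<in>I. harm_weight i * integral {0..1} (\<lambda>t. t ^ fst i * (poly (a i) t * poly (b i) t)))"
    using assms by (intro sum.cong refl) (simp add: sum.delta')
  finally show ?thesis .
qed

lemma integral_mode_sum:
  "(LINT z|disk_area. (\<Sum>i\<in>{..N} \<times> UNIV. mode_fun i (a i) z)) = pi * integral {0..1} (poly (a (0, True)))"
proof -
  let ?I = "{..N} \<times> (UNIV :: bool set)" and ?e = "\<lambda>i. if i = (0, True) then 1 else 0 :: real poly"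
  have "(\<Sum>i\<in>?I. mode_fun i (?e i) z) = (\<Sum>i\<in>?I. if i = (0, True) then 1 else 0)" for z
    by (intro sum.cong) (auto simp: harm_def)
  also have "\<dots> = (1 :: real)" by simp
  finally have one: "(\<Sum>i\<in>?I. mode_fun i (?e i) z) = 1" for z .
  have "(LINT z|disk_area. (\<Sum>i\<in>?I. mode_fun i (a i) z) * (\<Sum>i\<in>?I. mode_fun i (?e i) z))
    = (\<Sum>i\<in>?I. harm_weight i * integral {0..1} (\<lambda>t. t ^ fst i * (poly (a i) t * poly (?e i) t)))"
    by (rule integral_mode_sums) simp
  also have "\<dots> = (\<Sum>i\<in>?I. if i = (0, True) then pi * integral {0..1} (poly (a (0, True))) else 0)"
    by (intro sum.cong) (auto simp: harm_weight_def)
  also have "\<dots> = pi * integral {0..1} (poly (a (0, True)))" by simp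
  finally show ?thesis by (simp only: one mult_1_right)
qed

text \<open>
  Sum the bounds of the single modes with the Cauchy-Schwarz inequality; the square norms of the modes
  add up by orthogonality.
\<close>

lemma poisson_pair_sup_bound:
  obtains C where "C \<ge> 0" "\<And>U p z. poisson_pair U p \<Longrightarrow> z \<in> cball 0 1 \<Longrightarrow>
     (U z)\<^sup>2 \<le> C * (LINT z|disk_area. p z * p z)"
proof -
  \<comment> \<open>A weight for which \<open>d n\<close> times the square norm of a mode bounds the square of the mode of the solution.\<close>
  define d where "d n = (if n = 0 then 1 else 1 / (real n)\<^sup>2)" for n :: nat
  have d0: "d n \<ge> 0" for n by (simp add: d_def)
  have sd: "summable d"
  proof -
    have "summable (\<lambda>n. inverse (real n ^ 2))" by (rule inverse_power_summable) simp
    then have "summable (\<lambda>n. d (Suc n))"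
      by (subst (asm) summable_Suc_iff[symmetric]) (simp add: d_def inverse_eq_divide)
    then show ?thesis by (simp only: summable_Suc_iff)
  qed
  define C where "C = 2 * suminf d"
  have C0: "C \<ge> 0" unfolding C_def using suminf_nonneg[OF sd d0] by simp
  show ?thesis
  proof (rule that[OF C0])
    fix U p and z :: complex assume pair: "poisson_pair U p" and z: "z \<in> cball 0 1"
    from pair obtain N F where F: "\<forall>i. poly (F i) 1 = 0"
     "U = (\<lambda>z. \<Sum>i\<in>{..N} \<times> UNIV. mode_fun i (F i) z)"
     "p = (\<lambda>z. \<Sum>i\<in>{..N} \<times> UNIV. mode_fun i (radial_op (fst i) (F i)) z)"
      unfolding poisson_pair_def by (elim exE conjE)
    let ?I = "{..N} \<times> (UNIV :: bool set)"
    let ?t = "nsq z"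
    have t: "0 \<le> ?t" "?t \<le> 1" using z by (auto simp: power_le_one)
    define Q where "Q i = integral {0..1} (\<lambda>t. t ^ fst i * (poly (radial_op (fst i) (F i)) t)\<^sup>2)" for i
    have Q0: "Q i \<ge> 0" for i unfolding Q_def
      by (rule integral_nonneg) (auto intro!: integrable_continuous_interval continuous_intros)
    have w0: "harm_weight i \<ge> 0" for i by (simp add: harm_weight_def)
    have norm: "(LINT z|disk_area. p z * p z) = (\<Sum>i\<in>?I. harm_weight i * Q i)"
      unfolding F(3) Q_def by (subst integral_mode_sums) (simp_all add: power2_eq_square)
    have mode_bound: "(harm i z * poly (F i) ?t)\<^sup>2 \<le> d (fst i) * (harm_weight i * Q i)" for i
    proof (cases "fst i = 0")
      case True
      then have sq: "(poly (F i) ?t)\<^sup>2 \<le> Q i / 4"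
        using radial_sup_bound_0[OF F(1)[rule_format] t, of i] by (simp add: Q_def)
      show ?thesis
      proof (cases "snd i")
        case s: True
        have "Q i / 4 \<le> pi * Q i" using pi_gt3 Q0[of i] mult_right_mono[of "1/4" pi "Q i"] by simp
        then show ?thesis using True s sq by (simp add: harm_def d_def harm_weight_def)
      next
        case False
        then show ?thesis using True by (simp add: harm_def harm_weight_def)
      qed
    next
      case False
      then have n: "fst i \<ge> 1" by simp
      have "(harm i z)\<^sup>2 \<le> ?t ^ fst i"
      proof -
        have "(harm i z)\<^sup>2 \<le> (cmod z ^ fst i)\<^sup>2" using harm_le[of i z] by (metis abs_ge_zero power2_abs power_mono)
        then show ?thesis by (simp add: power_mult[symmetric] mult.commute)
      qed
      then have "(harm i z * poly (F i) ?t)\<^sup>2 \<le> ?t ^ fst i * (poly (F i) ?t)\<^sup>2"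
        unfolding power_mult_distrib by (rule mult_right_mono) simp
      also have "\<dots> \<le> (5 / 4) / (real (fst i))\<^sup>2 * Q i"
        unfolding Q_def by (rule radial_sup_bound_pos[OF n F(1)[rule_format] t])
      also have "\<dots> = (1 / (real (fst i))\<^sup>2) * ((5 / 4) * Q i)" by simp
      also have "\<dots> \<le> (1 / (real (fst i))\<^sup>2) * ((pi / 2) * Q i)"
        using Q0[of i] pi_gt3 by (intro mult_left_mono mult_right_mono) auto
      finally show ?thesis using False by (simp add: d_def harm_weight_def)
    qed
    have "\<bar>U z\<bar> \<le> (\<Sum>i\<in>?I. \<bar>harm i z * poly (F i) ?t\<bar>)" unfolding F(2) by (rule sum_abs)
    also have "\<dots> \<le> (\<Sum>i\<in>?I. sqrt (d (fst i)) * sqrt (harm_weight i * Q i))"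
    proof (rule sum_mono)
      fix i
      have "sqrt ((harm i z * poly (F i) ?t)\<^sup>2) \<le> sqrt (d (fst i) * (harm_weight i * Q i))"
        by (rule real_sqrt_le_mono[OF mode_bound])
      then show "\<bar>harm i z * poly (F i) ?t\<bar> \<le> sqrt (d (fst i)) * sqrt (harm_weight i * Q i)"
        by (simp add: real_sqrt_mult)
    qed
    finally have "\<bar>U z\<bar>\<^sup>2 \<le> (\<Sum>i\<in>?I. sqrt (d (fst i)) * sqrt (harm_weight i * Q i))\<^sup>2"
      by (intro power_mono) auto
    also have "\<dots> \<le> (\<Sum>i\<in>?I. (sqrt (d (fst i)))\<^sup>2) * (\<Sum>i\<in>?I. (sqrt (harm_weight i * Q i))\<^sup>2)"
      by (rule Cauchy_Schwarz_ineq_sum)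
    also have "\<dots> = (\<Sum>i\<in>?I. d (fst i)) * (\<Sum>i\<in>?I. harm_weight i * Q i)"
      using d0 w0 Q0 by simp
    also have "\<dots> \<le> C * (\<Sum>i\<in>?I. harm_weight i * Q i)"
    proof (rule mult_right_mono)
      have "(\<Sum>i\<in>?I. d (fst i)) = (\<Sum>n\<le>N. \<Sum>b\<in>(UNIV::bool set). d n)"
        by (subst sum.cartesian_product) (simp add: split_beta)
      also have "\<dots> = 2 * (\<Sum>n\<le>N. d n)" by (simp add: UNIV_bool sum_distrib_left)
      also have "\<dots> \<le> C" unfolding C_def using sum_le_suminf[OF sd, of "{..N}"] d0 by simp
      finally show "(\<Sum>i\<in>?I. d (fst i)) \<le> C" .
      show "0 \<le> (\<Sum>i\<in>?I. harm_weight i * Q i)" using w0 Q0 by (intro sum_nonneg) simp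
    qed
    finally show "(U z)\<^sup>2 \<le> C * (LINT z|disk_area. p z * p z)" by (simp add: norm)
  qed
qed

lemma continuous_on_laplacian:
  assumes "\<And>k. C_k k f" shows "continuous_on S (laplacian f)"
  unfolding laplacian_def[abs_def]
  by (intro continuous_on_sum) (use assms[of "Suc (Suc 0)"] continuous_on_subset in fastforce)

text \<open>
  By the sup bound the polynomial solutions converge uniformly, so the limit is continuous with zero
  boundary values, and the weak equation passes to the limit.
\<close>

lemma dirichlet_solution_limit:
  assumes v: "ess_bdd v" and p: "\<And>n z. z \<in> cball 0 1 \<Longrightarrow> \<bar>p n z\<bar> \<le> M"
    and lim: "AE z in disk_area. (\<lambda>n. p n z) \<longlonglongrightarrow> v z"
    and pair: "\<And>n. poisson_pair (U n) (p n)"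
  shows "dirichlet_solution v (green_op v)"
    and "(\<lambda>n. LINT z|disk_area. p n z * U n z) \<longlonglongrightarrow> (LINT z|disk_area. v z * green_op v z)"
proof -
  let ?M = "disk_area"
  interpret finite_measure ?M by (rule finite_measure_disk)
  have dp: "disk_poly (U n)" "disk_poly (p n)" for n using poisson_pair_disk_poly[OF pair] by auto
  have Uc: "continuous_on S (U n)" for n S by (rule continuous_on_disk_poly[OF dp(1)])
  have pb: "ess_bdd (p n)" for n by (rule ess_bdd_disk_poly[OF dp(2)])
  obtain C where C: "C \<ge> 0" "\<And>U p z. poisson_pair U p \<Longrightarrow> z \<in> cball 0 1 \<Longrightarrow> (U z)\<^sup>2 \<le> C * (LINT z|?M. p z * p z)"
    using poisson_pair_sup_bound by blast
  obtain K where K: "AE z in ?M. \<bar>v z\<bar> \<le> K" using v by (auto simp: ess_bdd_def)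
  have pM: "AE z in ?M. \<bar>p n z\<bar> \<le> \<bar>M\<bar>" for n
  proof (rule AE_I2)
    fix z :: complex assume "z \<in> space ?M"
    then have "\<bar>p n z\<bar> \<le> M" by (intro p) auto
    then show "\<bar>p n z\<bar> \<le> \<bar>M\<bar>" by simp
  qed
  have L2: "(\<lambda>n. LINT z|?M. (p n z - v z) * (p n z - v z)) \<longlonglongrightarrow> (LINT z|?M. 0)"
  proof (rule bounded_convergence_disk[where M="(\<bar>M\<bar> + \<bar>K\<bar>) * (\<bar>M\<bar> + \<bar>K\<bar>)"])
    show "(\<lambda>z. (p n z - v z) * (p n z - v z)) \<in> borel_measurable ?M" for n
      by (intro ess_bdd_measurable ess_bdd_mult ess_bdd_diff pb v)
    show "AE z in ?M. \<bar>(p n z - v z) * (p n z - v z)\<bar> \<le> (\<bar>M\<bar> + \<bar>K\<bar>) * (\<bar>M\<bar> + \<bar>K\<bar>)" for n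
      using K pM[of n] by eventually_elim (unfold abs_mult, intro mult_mono, auto)
    show "AE z in ?M. (\<lambda>n. (p n z - v z) * (p n z - v z)) \<longlonglongrightarrow> 0"
      using lim
    proof eventually_elim
      case (elim z)
      have "(\<lambda>n. (p n z - v z) * (p n z - v z)) \<longlonglongrightarrow> (v z - v z) * (v z - v z)" by (intro tendsto_intros elim)
      then show ?case by simp
    qed
  qed simp
  have "uniformly_Cauchy_on (cball 0 1) U"
    unfolding uniformly_Cauchy_on_def
  proof (intro allI impI)
    fix e :: real assume e: "e > 0"
    define \<delta> where "\<delta> = e\<^sup>2 / (C + 1) / 4"
    have \<delta>: "\<delta> > 0" using e C(1) by (simp add: \<delta>_def)
    have "eventually (\<lambda>n. (LINT z|?M. (p n z - v z) * (p n z - v z)) < \<delta>) sequentially"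
      using order_tendstoD(2)[OF L2, of \<delta>] \<delta> by simp
    then obtain N where N: "\<And>n. n \<ge> N \<Longrightarrow> (LINT z|?M. (p n z - v z) * (p n z - v z)) < \<delta>"
      by (auto simp: eventually_sequentially)
    show "\<exists>N. \<forall>x\<in>cball 0 1. \<forall>m\<ge>N. \<forall>n\<ge>N. dist (U m x) (U n x) < e"
    proof (intro exI ballI allI impI)
      fix x :: complex and m n assume x: "x \<in> cball 0 1" and mn: "m \<ge> N" "n \<ge> N"
      have int: "integrable ?M (\<lambda>z. (p k z - v z) * (p k z - v z))" for k
        by (intro ess_bdd_integrable ess_bdd_mult ess_bdd_diff pb v)
      have "(LINT z|?M. (p m z - p n z) * (p m z - p n z))
         \<le> (LINT z|?M. 2 * ((p m z - v z) * (p m z - v z)) + 2 * ((p n z - v z) * (p n z - v z)))"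
      proof (rule integral_mono)
        show "integrable ?M (\<lambda>z. (p m z - p n z) * (p m z - p n z))"
          by (intro ess_bdd_integrable ess_bdd_mult ess_bdd_diff pb)
        show "integrable ?M (\<lambda>z. 2 * ((p m z - v z) * (p m z - v z)) + 2 * ((p n z - v z) * (p n z - v z)))"
          by (intro Bochner_Integration.integrable_add integrable_mult_right int)
        fix z
        have "0 \<le> ((p m z - v z) + (p n z - v z))\<^sup>2" by simp
        then show "(p m z - p n z) * (p m z - p n z) \<le> 2 * ((p m z - v z) * (p m z - v z)) + 2 * ((p n z - v z) * (p n z - v z))"
          by (simp add: power2_eq_square algebra_simps)
      qed
      also have "\<dots> = 2 * (LINT z|?M. (p m z - v z) * (p m z - v z)) + 2 * (LINT z|?M. (p n z - v z) * (p n z - v z))"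
        by (subst Bochner_Integration.integral_add) (intro integrable_mult_right int | simp)+
      also have "\<dots> < 4 * \<delta>" using N[OF mn(1)] N[OF mn(2)] by simp
      finally have I: "(LINT z|?M. (p m z - p n z) * (p m z - p n z)) < 4 * \<delta>" .
      have "(U m x - U n x)\<^sup>2 \<le> C * (LINT z|?M. (p m z - p n z) * (p m z - p n z))"
        by (rule C(2)[OF poisson_pair_diff[OF pair pair] x])
      also have "\<dots> \<le> C * (4 * \<delta>)" using I C(1) by (intro mult_left_mono) auto
      also have "\<dots> < e\<^sup>2"
      proof -
        have "4 * (x / 4) = x" for x :: real by simp
        then have "4 * \<delta> = e\<^sup>2 / (C + 1)" unfolding \<delta>_def .
        then have "C * (4 * \<delta>) = e\<^sup>2 * (C / (C + 1))" by (simp only:) (simp add: mult.commute)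
        also have "\<dots> < e\<^sup>2 * 1" using C(1) e by (intro mult_strict_left_mono) (auto simp: divide_less_eq)
        finally show ?thesis by simp
      qed
      finally have "\<bar>U m x - U n x\<bar>\<^sup>2 < e\<^sup>2" by simp
      then have "\<bar>U m x - U n x\<bar> < e" by (rule power2_less_imp_less) (use e in simp)
      then show "dist (U m x) (U n x) < e" by (simp add: dist_real_def)
    qed
  qed
  then have "uniformly_convergent_on (cball 0 1) U" by (rule Cauchy_uniformly_convergent)
  then obtain l where l: "uniform_limit (cball 0 1) U l sequentially"
    by (auto simp: uniformly_convergent_on_def)
  have lc: "continuous_on (cball 0 1) l"
    by (rule uniform_limit_theorem[OF _ l]) (auto intro!: always_eventually Uc)
  have pt: "(\<lambda>n. U n z) \<longlonglongrightarrow> l z" if "z \<in> cball 0 1" for z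
    by (rule tendsto_uniform_limitI[OF l that])
  have lb: "l z = 0" if "cmod z = 1" for z
    using pt[of z] that poisson_pair_boundary[OF pair that] by (simp add: LIMSEQ_const_iff)
  define u where "u z = (if z \<in> unit_disk then l z else 0)" for z
  have uc: "continuous_on (cball 0 1) u"
    by (rule continuous_on_eq[OF lc]) (use lb in \<open>auto simp: u_def\<close>)
  have ub: "ess_bdd u" by (rule ess_bdd_continuous[OF uc])
  have U2: "\<bar>U n z\<bar> \<le> sqrt (C * (M\<^sup>2 * pi))" if z: "z \<in> cball 0 1" for n z
  proof -
    have "(LINT z|?M. p n z * p n z) \<le> (LINT z|?M. \<bar>M\<bar> * \<bar>M\<bar>)"
    proof (rule integral_mono_AE)
      show "integrable ?M (\<lambda>z. p n z * p n z)" by (intro ess_bdd_integrable ess_bdd_mult pb)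
      show "AE z in ?M. p n z * p n z \<le> \<bar>M\<bar> * \<bar>M\<bar>"
        using pM[of n]
      proof eventually_elim
        case (elim z)
        have "p n z * p n z = \<bar>p n z\<bar> * \<bar>p n z\<bar>" by simp
        also have "\<dots> \<le> \<bar>M\<bar> * \<bar>M\<bar>" using elim by (intro mult_mono) auto
        finally show ?case .
      qed
    qed simp
    also have "\<dots> = M\<^sup>2 * pi"
      using integral_disk_radial[of "\<lambda>_. \<bar>M\<bar> * \<bar>M\<bar>"] by (simp add: power2_eq_square)
    finally have "C * (LINT z|?M. p n z * p n z) \<le> C * (M\<^sup>2 * pi)" using C(1) by (rule mult_left_mono)
    then have "(U n z)\<^sup>2 \<le> C * (M\<^sup>2 * pi)" using C(2)[OF pair z, of n] by linarith
    then show ?thesis by (metis real_sqrt_abs real_sqrt_le_mono)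
  qed
  have UA: "AE z in ?M. \<bar>U n z\<bar> \<le> sqrt (C * (M\<^sup>2 * pi))" for n by (rule AE_I2) (use U2 in auto)
  have Ulim: "AE z in ?M. (\<lambda>n. U n z) \<longlonglongrightarrow> u z" by (rule AE_I2) (use pt in \<open>auto simp: u_def\<close>)
  have sol: "dirichlet_solution v u"
    unfolding dirichlet_solution_def
  proof (intro conjI allI impI)
    show "integrable ?M v" by (rule ess_bdd_integrable[OF v])
    show "continuous_on (cball 0 1) u" by (rule uc)
    fix \<phi> assume \<phi>: "disk_test_function \<phi>"
    then have \<phi>C: "\<And>k. C_k k \<phi>" by (simp add: disk_test_function_def)
    have c: "continuous_on (cball 0 1) \<phi>" "continuous_on (cball 0 1) (laplacian \<phi>)"
      by (rule continuous_on_C_k[OF \<phi>C[of 0]], rule continuous_on_laplacian[OF \<phi>C])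
    obtain L where L: "L \<ge> 0" "\<And>z. z \<in> cball 0 1 \<Longrightarrow> \<bar>laplacian \<phi> z\<bar> \<le> L"
      using continuous_on_compact_bound[OF compact_cball c(2)] by blast
    have "(\<lambda>n. LINT z|?M. \<phi> z * p n z) \<longlonglongrightarrow> (LINT z|?M. \<phi> z * v z)"
      by (rule integral_disk_poly_limit[OF ess_bdd_continuous[OF c(1)] v dp(2) p lim])
    moreover have "(\<lambda>n. LINT z|?M. U n z * (- laplacian \<phi> z)) \<longlonglongrightarrow> (LINT z|?M. u z * (- laplacian \<phi> z))"
    proof (rule bounded_convergence_disk[where M="sqrt (C * (M\<^sup>2 * pi)) * L"])
      show "(\<lambda>z. U n z * (- laplacian \<phi> z)) \<in> borel_measurable ?M" for n
        by (intro ess_bdd_measurable ess_bdd_continuous continuous_intros Uc c)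
      show "(\<lambda>z. u z * (- laplacian \<phi> z)) \<in> borel_measurable ?M"
        by (intro ess_bdd_measurable ess_bdd_continuous continuous_intros uc c)
      show "AE z in ?M. \<bar>U n z * (- laplacian \<phi> z)\<bar> \<le> sqrt (C * (M\<^sup>2 * pi)) * L" for n
        using UA[of n] AE_space
      proof eventually_elim
        case (elim z)
        have "\<bar>- laplacian \<phi> z\<bar> \<le> L" using L(2)[of z] elim by simp
        then show ?case unfolding abs_mult using elim C(1) by (intro mult_mono) auto
      qed
      show "AE z in ?M. (\<lambda>n. U n z * (- laplacian \<phi> z)) \<longlonglongrightarrow> u z * (- laplacian \<phi> z)"
        using Ulim by eventually_elim (intro tendsto_intros)
    qed
    moreover have "(LINT z|?M. U n z * (- laplacian \<phi> z)) = (LINT z|?M. \<phi> z * p n z)" for n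
    proof -
      have "(LINT z|?M. U n z * (- laplacian \<phi> z)) = (LINT z|?M. (- laplacian (U n) z) * \<phi> z)"
        by (rule green_test_function[OF disk_poly_C_k[OF dp(1)] \<phi>])
      then show ?thesis by (simp only: poisson_pair_laplacian[OF pair] mult.commute)
    qed
    ultimately have "(LINT z|?M. u z * (- laplacian \<phi> z)) = (LINT z|?M. \<phi> z * v z)"
      using LIMSEQ_unique by (simp del: mult_minus_right)
    then show "(LINT z|?M. u z * (- laplacian \<phi> z)) = (LINT z|?M. v z * \<phi> z)"
      by (simp only: mult.commute)
  qed (simp add: u_def)
  then have g: "green_op v = u" by (rule green_op_eq)
  show "dirichlet_solution v (green_op v)" unfolding g by (rule sol)
  show "(\<lambda>n. LINT z|?M. p n z * U n z) \<longlonglongrightarrow> (LINT z|?M. v z * green_op v z)"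
    unfolding g
  proof (rule bounded_convergence_disk[where M="\<bar>M\<bar> * sqrt (C * (M\<^sup>2 * pi))"])
    show "(\<lambda>z. p n z * U n z) \<in> borel_measurable ?M" for n
      by (intro ess_bdd_measurable ess_bdd_mult pb ess_bdd_disk_poly dp)
    show "(\<lambda>z. v z * u z) \<in> borel_measurable ?M"
      by (intro ess_bdd_measurable ess_bdd_mult v ub)
    show "AE z in ?M. \<bar>p n z * U n z\<bar> \<le> \<bar>M\<bar> * sqrt (C * (M\<^sup>2 * pi))" for n
      using UA[of n] pM[of n] by eventually_elim (unfold abs_mult, intro mult_mono, auto)
    show "AE z in ?M. (\<lambda>n. p n z * U n z) \<longlonglongrightarrow> v z * u z"
      using Ulim lim by eventually_elim (intro tendsto_intros)
  qed
qed

lemma dirichlet_solution_green_op: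
  assumes v: "ess_bdd v" shows "dirichlet_solution v (green_op v)"
proof (rule disk_poly_dense[OF v])
  fix p M
  assume p: "\<And>n. disk_poly (p n)" "\<And>n z. z \<in> cball 0 1 \<Longrightarrow> \<bar>p n z\<bar> \<le> M"
    "AE z in disk_area. (\<lambda>n. p n z) \<longlonglongrightarrow> v z"
  have "\<exists>U. poisson_pair U (p n)" for n using poisson_pair_exists[OF p(1)] by metis
  then obtain U where U: "\<And>n. poisson_pair (U n) (p n)" by metis
  show ?thesis by (rule dirichlet_solution_limit(1)[OF v p(2) p(3) U])
qed

lemma ess_bdd_green_op: "ess_bdd v \<Longrightarrow> ess_bdd (green_op v)"
  using dirichlet_solution_green_op by (auto simp: dirichlet_solution_def intro: ess_bdd_continuous)

lemma poisson_pair_energy_inequality: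
  assumes pair: "poisson_pair U p" and mean: "(LINT z|disk_area. p z) = 0"
  shows "4 * kappa * (LINT z|disk_area. p z * U z) \<le> (LINT z|disk_area. p z * p z)"
proof -
  let ?M = "disk_area"
  from pair obtain N F where F: "\<forall>i. poly (F i) 1 = 0"
     "U = (\<lambda>z. \<Sum>i\<in>{..N} \<times> UNIV. mode_fun i (F i) z)"
     "p = (\<lambda>z. \<Sum>i\<in>{..N} \<times> UNIV. mode_fun i (radial_op (fst i) (F i)) z)"
    unfolding poisson_pair_def by (elim exE conjE)
  let ?I = "{..N} \<times> (UNIV :: bool set)" and ?q = "\<lambda>i. radial_op (fst i) (F i)"
  have m0: "integral {0..1} (poly (?q (0, True))) = 0"
    using mean integral_mode_sum[where N=N and a="?q"] by (simp add: F(3))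
  have "4 * kappa * (LINT z|?M. p z * U z)
     = (\<Sum>i\<in>?I. harm_weight i * (4 * kappa * integral {0..1} (\<lambda>t. t ^ fst i * (poly (?q i) t * poly (F i) t))))"
    unfolding F(2,3) by (subst integral_mode_sums) (simp_all add: sum_distrib_left mult_ac)
  also have "\<dots> \<le> (\<Sum>i\<in>?I. harm_weight i * integral {0..1} (\<lambda>t. t ^ fst i * (poly (?q i) t * poly (?q i) t)))"
  proof (rule sum_mono)
    fix i :: "nat \<times> bool"
    show "harm_weight i * (4 * kappa * integral {0..1} (\<lambda>t. t ^ fst i * (poly (?q i) t * poly (F i) t)))
      \<le> harm_weight i * integral {0..1} (\<lambda>t. t ^ fst i * (poly (?q i) t * poly (?q i) t))"
    proof (cases "harm_weight i = 0")
      case False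
      have "4 * kappa * integral {0..1} (\<lambda>t. t ^ fst i * (poly (?q i) t * poly (F i) t))
        \<le> integral {0..1} (\<lambda>t. t ^ fst i * (poly (?q i) t * poly (?q i) t))"
      proof (cases "fst i = 0")
        case True
        then have i: "i = (0, True)" using False by (cases i) (auto simp: harm_weight_def split: if_splits)
        show ?thesis
          using radial_energy_inequality_0[OF F(1)[rule_format], of i] m0 by (simp add: i power2_eq_square)
      next
        case n: False
        show ?thesis
          using radial_energy_inequality_pos[OF _ F(1)[rule_format], of "fst i" i] n by (simp add: power2_eq_square)
      qed
      then show ?thesis by (rule mult_left_mono) (simp add: harm_weight_def)
    qed simp
  qed
  also have "\<dots> = (LINT z|?M. p z * p z)"
    unfolding F(3) by (subst integral_mode_sums) simp_all
  finally show ?thesis .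
qed

text \<open>
  Subtract the means of the approximating polynomials, which tend to the mean of \<open>v\<close>.
\<close>

lemma disk_poly_dense_mean_zero:
  assumes v: "ess_bdd v" and mean: "(LINT z|disk_area. v z) = 0"
  obtains p M where "\<And>n. disk_poly (p n)" "\<And>n z. z \<in> cball 0 1 \<Longrightarrow> \<bar>p n z\<bar> \<le> M"
    "AE z in disk_area. (\<lambda>n. p n z) \<longlonglongrightarrow> v z"
    "\<And>n. (LINT z|disk_area. p n z) = 0"
proof (rule disk_poly_dense[OF v])
  let ?M = "disk_area"
  fix p M
  assume p: "\<And>n. disk_poly (p n)" "\<And>n z. z \<in> cball 0 1 \<Longrightarrow> \<bar>p n z\<bar> \<le> M"
    "AE z in ?M. (\<lambda>n. p n z) \<longlonglongrightarrow> v z"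
  have one: "(LINT z|?M. c) = pi * c" for c :: real using integral_disk_radial[of "\<lambda>_. c"] by simp
  define c where "c n = (LINT z|?M. p n z) / pi" for n
  have "(\<lambda>n. LINT z|?M. 1 * p n z) \<longlonglongrightarrow> (LINT z|?M. 1 * v z)"
    by (rule integral_disk_poly_limit[OF ess_bdd_const v p])
  then have c: "c \<longlonglongrightarrow> 0" unfolding c_def[abs_def] using mean by (intro tendsto_divide_zero) simp
  then obtain L where L: "\<And>n. \<bar>c n\<bar> \<le> L" using convergent_imp_Bseq[of c] unfolding Bseq_def convergent_def by auto
  show ?thesis
  proof (rule that[of "\<lambda>n z. p n z - c n" "M + L"])
    show "disk_poly (\<lambda>z. p n z - c n)" for n by (intro disk_poly_diff p disk_poly_const)
    show "\<bar>p n z - c n\<bar> \<le> M + L" if "z \<in> cball 0 1" for n z using p(2)[OF that, of n] L[of n] by linarith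
    show "AE z in ?M. (\<lambda>n. p n z - c n) \<longlonglongrightarrow> v z"
      using p(3)
    proof eventually_elim
      case (elim z)
      show ?case using tendsto_diff[OF elim c] by simp
    qed
    show "(LINT z|?M. p n z - c n) = 0" for n
    proof -
      have "(LINT z|?M. p n z - c n) = (LINT z|?M. p n z) - (LINT z|?M. c n)"
        by (rule Bochner_Integration.integral_diff)
           (rule ess_bdd_integrable[OF ess_bdd_disk_poly[OF p(1)]], rule ess_bdd_integrable[OF ess_bdd_const])
      then show ?thesis by (simp only: one) (simp add: c_def)
    qed
  qed
qed

text \<open>
  The sharp constant \<open>4 \<kappa> = j\<^sup>2\<close> is inherited from polynomials, where the inequality holds mode by mode.
\<close>

lemma energy_inequality:
  assumes v: "ess_bdd v" and mean: "(LINT z|disk_area. v z) = 0"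
  shows "4 * kappa * (LINT z|disk_area. v z * green_op v z) \<le> (LINT z|disk_area. v z * v z)"
proof (rule disk_poly_dense_mean_zero[OF v mean])
  let ?M = "disk_area"
  fix p M
  assume p: "\<And>n. disk_poly (p n)" "\<And>n z. z \<in> cball 0 1 \<Longrightarrow> \<bar>p n z\<bar> \<le> M"
    "AE z in ?M. (\<lambda>n. p n z) \<longlonglongrightarrow> v z" "\<And>n. (LINT z|?M. p n z) = 0"
  have "\<exists>U. poisson_pair U (p n)" for n using poisson_pair_exists[OF p(1)] by metis
  then obtain U where U: "\<And>n. poisson_pair (U n) (p n)" by metis
  have M0: "M \<ge> 0" using p(2)[of 0 0] by simp
  have 1: "(\<lambda>n. 4 * kappa * (LINT z|?M. p n z * U n z)) \<longlonglongrightarrow> 4 * kappa * (LINT z|?M. v z * green_op v z)"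
    by (intro tendsto_mult tendsto_const dirichlet_solution_limit(2)[OF v p(2) p(3) U])
  have 2: "(\<lambda>n. LINT z|?M. p n z * p n z) \<longlonglongrightarrow> (LINT z|?M. v z * v z)"
  proof (rule bounded_convergence_disk[where M="M * M"])
    show "(\<lambda>z. p n z * p n z) \<in> borel_measurable ?M" for n
      by (intro ess_bdd_measurable ess_bdd_mult ess_bdd_disk_poly p)
    show "(\<lambda>z. v z * v z) \<in> borel_measurable ?M" by (intro ess_bdd_measurable ess_bdd_mult v)
    show "AE z in ?M. \<bar>p n z * p n z\<bar> \<le> M * M" for n
      by (rule AE_I2, unfold abs_mult, intro mult_mono p(2)) (use M0 in auto)
    show "AE z in ?M. (\<lambda>n. p n z * p n z) \<longlonglongrightarrow> v z * v z"
      using p(3) by eventually_elim (intro tendsto_intros)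
  qed
  show ?thesis
    by (rule LIMSEQ_le[OF 1 2]) (use poisson_pair_energy_inequality[OF U p(4)] in blast)
qed

section \<open>The Euler-Lagrange equation of maximisers\<close>

lemma dirichlet_solution_add_scaled:
  assumes v: "ess_bdd v" "dirichlet_solution v u" and w: "ess_bdd w" "dirichlet_solution w y"
  shows "dirichlet_solution (\<lambda>z. v z + c * w z) (\<lambda>z. u z + c * y z)"
  unfolding dirichlet_solution_def
proof (intro conjI allI impI)
  let ?M = "disk_area"
  have uc: "continuous_on (cball 0 1) u" "continuous_on (cball 0 1) y"
    and out: "\<And>x. x \<notin> unit_disk \<Longrightarrow> u x = 0" "\<And>x. x \<notin> unit_disk \<Longrightarrow> y x = 0"
    and tu: "\<And>\<phi>. disk_test_function \<phi> \<Longrightarrow> (LINT x|?M. u x * (- laplacian \<phi> x)) = (LINT x|?M. v x * \<phi> x)"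
    and ty: "\<And>\<phi>. disk_test_function \<phi> \<Longrightarrow> (LINT x|?M. y x * (- laplacian \<phi> x)) = (LINT x|?M. w x * \<phi> x)"
    using v(2) w(2) by (auto simp: dirichlet_solution_def)
  show "integrable ?M (\<lambda>z. v z + c * w z)"
    by (intro ess_bdd_integrable ess_bdd_add ess_bdd_mult ess_bdd_const v w)
  show "continuous_on (cball 0 1) (\<lambda>z. u z + c * y z)" by (intro continuous_intros uc)
  show "u x + c * y x = 0" if "x \<notin> unit_disk" for x using out that by simp
  fix \<phi> assume \<phi>: "disk_test_function \<phi>"
  then have \<phi>C: "\<And>k. C_k k \<phi>" by (simp add: disk_test_function_def)
  have b: "ess_bdd \<phi>" "ess_bdd (\<lambda>x. - laplacian \<phi> x)"
    by (rule ess_bdd_continuous[OF continuous_on_C_k[OF \<phi>C[of 0]]],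
        rule ess_bdd_continuous[OF continuous_on_minus[OF continuous_on_laplacian[OF \<phi>C]]])
  have lin: "(LINT x|?M. (f x + c * g x) * h x) = (LINT x|?M. f x * h x) + c * (LINT x|?M. g x * h x)"
    if "ess_bdd f" "ess_bdd g" "ess_bdd h" for f g h
  proof -
    have "(LINT x|?M. (f x + c * g x) * h x) = (LINT x|?M. f x * h x + c * (g x * h x))"
      by (intro Bochner_Integration.integral_cong) (simp_all add: algebra_simps)
    also have "\<dots> = (LINT x|?M. f x * h x) + (LINT x|?M. c * (g x * h x))"
      by (intro Bochner_Integration.integral_add ess_bdd_integrable ess_bdd_mult ess_bdd_const that)
    finally show ?thesis by simp
  qed
  have ub: "ess_bdd u" "ess_bdd y" by (intro ess_bdd_continuous uc)+
  show "(LINT x|?M. (u x + c * y x) * (- laplacian \<phi> x)) = (LINT x|?M. (v x + c * w x) * \<phi> x)"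
    unfolding lin[OF ub b(2)] lin[OF v(1) w(1) b(1)] tu[OF \<phi>] ty[OF \<phi>] ..
qed

lemma quadratic_nonneg_imp_linear_0:
  fixes b c :: real
  assumes "\<And>x. 0 \<le> 2 * x * b + x\<^sup>2 * c" "c \<ge> 0"
  shows "b = 0"
proof (rule ccontr)
  assume b: "b \<noteq> 0"
  \<comment> \<open>Evaluate at \<open>x = - b / (c + 1)\<close>; the summand \<open>1\<close> avoids division by zero.\<close>
  have "0 \<le> (c + 1)\<^sup>2 * (2 * (- b / (c + 1)) * b + (- b / (c + 1))\<^sup>2 * c)"
    using assms(1)[of "- b / (c + 1)"] by simp
  also have "\<dots> = - (2 * (c + 1) * b\<^sup>2) + b\<^sup>2 * c"
  proof -
    have "d\<^sup>2 * (2 * (- b / d) * b + (- b / d)\<^sup>2 * c) = - (2 * d * b\<^sup>2) + b\<^sup>2 * c" if "d \<noteq> 0" for d :: real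
      using that by (simp add: field_simps power2_eq_square)
    then show ?thesis using assms(2) by simp
  qed
  also have "\<dots> = - (c + 2) * b\<^sup>2" by (simp add: algebra_simps)
  also have "\<dots> < 0" using b assms(2) by (simp add: mult_neg_pos)
  finally show False by simp
qed

text \<open>
  The quadratic form \<open>\<integral> v\<^sup>2 - 4 \<kappa> \<integral> v (\<G> v)\<close> is nonnegative on functions of mean zero, so a zero \<open>v\<close> of it
  lies in its kernel: perturb \<open>v\<close> by multiples of \<open>p\<close>.
\<close>

lemma euler_lagrange:
  assumes v: "ess_bdd v" and mean: "(LINT z|disk_area. v z) = 0"
    and eq: "4 * kappa * (LINT z|disk_area. v z * green_op v z) = (LINT z|disk_area. v z * v z)"
    and pair: "poisson_pair U p" and pm: "(LINT z|disk_area. p z) = 0"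
  shows "(LINT z|disk_area. v z * p z) = 4 * kappa * (LINT z|disk_area. v z * U z)"
proof -
  let ?M = "disk_area"
  let ?U = "\<lambda>z. if z \<in> unit_disk then U z else 0"
  note sol = dirichlet_solution_green_op[OF v]
  have pb: "ess_bdd p" and Ub: "ess_bdd U"
    using poisson_pair_disk_poly[OF pair] by (auto intro: ess_bdd_disk_poly)
  have gb: "ess_bdd (green_op v)" by (rule ess_bdd_green_op[OF v])
  have int: "integrable ?M (\<lambda>z. f z * g z)" if "ess_bdd f" "ess_bdd g" for f g
    by (intro ess_bdd_integrable ess_bdd_mult that)
  have lin: "(LINT z|?M. (f z + x * g z) * (h z + x * k z)) =
     (LINT z|?M. f z * h z) + x * ((LINT z|?M. f z * k z) + (LINT z|?M. g z * h z)) + x\<^sup>2 * (LINT z|?M. g z * k z)"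
    if b: "ess_bdd f" "ess_bdd g" "ess_bdd h" "ess_bdd k" for f g h k x
  proof -
    have "(LINT z|?M. (f z + x * g z) * (h z + x * k z)) =
       (LINT z|?M. (f z * h z + x * (f z * k z + g z * h z)) + x\<^sup>2 * (g z * k z))"
      by (intro Bochner_Integration.integral_cong) (simp_all add: algebra_simps power2_eq_square)
    also have "\<dots> = (LINT z|?M. f z * h z + x * (f z * k z + g z * h z)) + (LINT z|?M. x\<^sup>2 * (g z * k z))"
      by (intro Bochner_Integration.integral_add Bochner_Integration.integrable_add integrable_mult_right int b)
    also have "(LINT z|?M. f z * h z + x * (f z * k z + g z * h z)) = (LINT z|?M. f z * h z) + (LINT z|?M. x * (f z * k z + g z * h z))"
      by (intro Bochner_Integration.integral_add Bochner_Integration.integrable_add integrable_mult_right int b)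
    also have "(LINT z|?M. x * (f z * k z + g z * h z)) = x * ((LINT z|?M. f z * k z) + (LINT z|?M. g z * h z))"
      by (subst integral_mult_right_zero) (simp add: Bochner_Integration.integral_add int b)
    finally show ?thesis by simp
  qed
  have key: "0 \<le> 2 * x * ((LINT z|?M. v z * p z) - 4 * kappa * (LINT z|?M. v z * U z))
      + x\<^sup>2 * ((LINT z|?M. p z * p z) - 4 * kappa * (LINT z|?M. p z * U z))" for x
  proof -
    let ?w = "\<lambda>z. v z + x * p z"
    have wb: "ess_bdd ?w" by (intro ess_bdd_add ess_bdd_mult ess_bdd_const v pb)
    have wm: "(LINT z|?M. ?w z) = 0"
      using mean pm by (subst Bochner_Integration.integral_add) (auto intro: ess_bdd_integrable v pb)
    have g: "green_op ?w = (\<lambda>z. green_op v z + x * ?U z)"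
      by (rule green_op_eq[OF dirichlet_solution_add_scaled[OF v sol pb poisson_pair_solution[OF pair]]])
    have "(LINT z|?M. ?w z * green_op ?w z) = (LINT z|?M. (v z + x * p z) * (green_op v z + x * U z))"
      unfolding g by (intro Bochner_Integration.integral_cong) auto
    also have "\<dots> = (LINT z|?M. v z * green_op v z) + x * ((LINT z|?M. v z * U z) + (LINT z|?M. p z * green_op v z)) + x\<^sup>2 * (LINT z|?M. p z * U z)"
      by (rule lin[OF v pb gb Ub])
    also have "(LINT z|?M. p z * green_op v z) = (LINT z|?M. v z * U z)"
      using transposition[OF sol pair] by (simp only: mult.commute)
    finally have 1: "(LINT z|?M. ?w z * green_op ?w z) = (LINT z|?M. v z * green_op v z) + x * (2 * (LINT z|?M. v z * U z)) + x\<^sup>2 * (LINT z|?M. p z * U z)"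
      by simp
    have 2: "(LINT z|?M. ?w z * ?w z) = (LINT z|?M. v z * v z) + x * (2 * (LINT z|?M. v z * p z)) + x\<^sup>2 * (LINT z|?M. p z * p z)"
      unfolding lin[OF v pb v pb] by (simp add: mult.commute)
    have "4 * kappa * (LINT z|?M. ?w z * green_op ?w z) \<le> (LINT z|?M. ?w z * ?w z)"
      by (rule energy_inequality[OF wb wm])
    then show ?thesis
      unfolding 1 2 using eq by (simp add: algebra_simps)
  qed
  have "(LINT z|?M. v z * p z) - 4 * kappa * (LINT z|?M. v z * U z) = 0"
    by (rule quadratic_nonneg_imp_linear_0[OF key]) (use poisson_pair_energy_inequality[OF pair pm] in simp)
  then show ?thesis by simp
qed

definition eigfun :: "nat \<times> bool \<Rightarrow> complex \<Rightarrow> real" where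
  "eigfun i z = harm i z * clifford (fst i) (kappa * nsq z)"

definition eig_indices :: "(nat \<times> bool) set" where
  "eig_indices = {(0, True), (1, True), (1, False)}"

lemma continuous_on_eigfun [continuous_intros]: "continuous_on S (eigfun i)"
  unfolding eigfun_def[abs_def] by (intro continuous_intros)

lemma ess_bdd_eigfun: "ess_bdd (eigfun i)"
  by (intro ess_bdd_continuous continuous_intros)

lemma integral_eigfun_mode:
  "(LINT z|disk_area. eigfun i z * (mode_fun j q z))
    = (if i = j then harm_weight i * integral {0..1} (\<lambda>t. t ^ fst i * (clifford (fst i) (kappa * t) * poly q t)) else 0)"
proof -
  have "(LINT z|disk_area. eigfun i z * (mode_fun j q z))
    = (LINT z|disk_area. harm i z * harm j z * (clifford (fst i) (kappa * nsq z) * poly q (nsq z)))"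
    by (intro Bochner_Integration.integral_cong) (simp_all add: eigfun_def mult_ac)
  also have "\<dots> = (if i = j then harm_weight i * integral {0..1} (\<lambda>t. t ^ fst i * (clifford (fst i) (kappa * t) * poly q t)) else 0)"
    by (rule harm_orthogonal) (intro continuous_intros)
  finally show ?thesis .
qed

text \<open>
  Green's formula twice. The boundary terms are \<open>F'(1) C\<^sub>n(\<kappa>)\<close> and a multiple of \<open>F(1)\<close>,
  and both vanish by assumption.
\<close>

lemma radial_clifford_adjoint:
  assumes F1: "poly F (1::real) = 0" and bc: "clifford n kappa * poly (pderiv F) 1 = 0"
  shows "integral {0..1} (\<lambda>t. t ^ n * (clifford n (kappa * t) * poly (radial_op n F) t))
    = 4 * kappa * integral {0..1} (\<lambda>t. t ^ n * (clifford n (kappa * t) * poly F t))"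
proof -
  let ?\<phi> = "\<lambda>t. clifford n (kappa * t)" and ?\<phi>' = "\<lambda>t. - kappa * clifford (Suc n) (kappa * t)"
    and ?\<phi>'' = "\<lambda>t. kappa * kappa * clifford (Suc (Suc n)) (kappa * t)"
  have d: "(?\<phi> has_real_derivative ?\<phi>' t) (at t)" "(?\<phi>' has_real_derivative ?\<phi>'' t) (at t)" for t
    using clifford_scaled_DERIV[of 1 n kappa t] clifford_scaled_DERIV[of "- kappa" "Suc n" kappa t] by (simp_all add: mult_ac)
  have "integral {0..1} (\<lambda>t. t ^ n * ((t * poly (pderiv (pderiv F)) t + (real n + 1) * poly (pderiv F) t) * ?\<phi> t))
     = poly (pderiv F) 1 * ?\<phi> 1 - integral {0..1} (\<lambda>t. t ^ Suc n * (poly (pderiv F) t * ?\<phi>' t))"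
    by (rule radial_green[OF poly_DERIV poly_DERIV d(1)]) (intro continuous_intros)+
  moreover have "integral {0..1} (\<lambda>t. t ^ n * ((t * ?\<phi>'' t + (real n + 1) * ?\<phi>' t) * poly F t))
     = ?\<phi>' 1 * poly F 1 - integral {0..1} (\<lambda>t. t ^ Suc n * (?\<phi>' t * poly (pderiv F) t))"
    by (rule radial_green[OF d poly_DERIV]) (intro continuous_intros)+
  ultimately have 1: "integral {0..1} (\<lambda>t. t ^ n * ((t * poly (pderiv (pderiv F)) t + (real n + 1) * poly (pderiv F) t) * ?\<phi> t))
     = integral {0..1} (\<lambda>t. t ^ n * ((t * ?\<phi>'' t + (real n + 1) * ?\<phi>' t) * poly F t))"
    using F1 bc by (simp add: mult.commute)
  have "integral {0..1} (\<lambda>t. t ^ n * (?\<phi> t * poly (radial_op n F) t))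
     = integral {0..1} (\<lambda>t. -4 * (t ^ n * ((t * poly (pderiv (pderiv F)) t + (real n + 1) * poly (pderiv F) t) * ?\<phi> t)))"
    by (rule arg_cong[where f="integral {0..1}"], rule ext) (simp only: poly_radial_op mult_ac)
  also have "\<dots> = -4 * integral {0..1} (\<lambda>t. t ^ n * ((t * ?\<phi>'' t + (real n + 1) * ?\<phi>' t) * poly F t))"
    unfolding 1[symmetric] by (rule Henstock_Kurzweil_Integration.integral_mult_right)
  also have "(\<lambda>t. t ^ n * ((t * ?\<phi>'' t + (real n + 1) * ?\<phi>' t) * poly F t)) = (\<lambda>t. - kappa * (t ^ n * (?\<phi> t * poly F t)))"
    by (rule ext) (simp only: clifford_ode, simp only: mult_ac)
  also have "-4 * integral {0..1} \<dots> = 4 * kappa * integral {0..1} (\<lambda>t. t ^ n * (?\<phi> t * poly F t))"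
    by (subst Henstock_Kurzweil_Integration.integral_mult_right) simp
  finally show ?thesis .
qed

lemma integral_radial_op_0: "integral {0..1} (poly (radial_op 0 F)) = -4 * poly (pderiv F) 1"
proof -
  have "((\<lambda>t. -4 * (t * poly (pderiv F) t)) has_real_derivative poly (radial_op 0 F) t) (at t)" for t
    by (auto intro!: derivative_eq_intros poly_DERIV simp: poly_radial_op)
  from integral_01_FTC(1)[OF this] show ?thesis by simp
qed

text \<open>
  In frequency \<open>1\<close> the boundary term vanishes because \<open>C\<^sub>1(\<kappa>) = 0\<close>, in frequency \<open>0\<close> because the mean of \<open>p\<close>
  is zero, which says \<open>F'(1) = 0\<close> for the profile \<open>F\<close> of that mode.
\<close>

lemma eigfun_euler_lagrange:
  assumes i: "i \<in> eig_indices" and pair: "poisson_pair U p" and pm: "(LINT z|disk_area. p z) = 0"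
  shows "(LINT z|disk_area. eigfun i z * p z) = 4 * kappa * (LINT z|disk_area. eigfun i z * U z)"
proof -
  let ?M = "disk_area"
  from pair obtain N F where F: "\<forall>i. poly (F i) 1 = 0"
     "U = (\<lambda>z. \<Sum>i\<in>{..N} \<times> UNIV. mode_fun i (F i) z)"
     "p = (\<lambda>z. \<Sum>i\<in>{..N} \<times> UNIV. mode_fun i (radial_op (fst i) (F i)) z)"
    unfolding poisson_pair_def by (elim exE conjE)
  have "-4 * poly (pderiv (F (0, True))) 1 = 0"
    using pm integral_mode_sum[where N=N and a="\<lambda>i. radial_op (fst i) (F i)"] by (simp add: F(3) integral_radial_op_0)
  then have F0: "poly (pderiv (F (0, True))) 1 = 0" by simp
  have sum: "(LINT z|?M. eigfun i z * (\<Sum>j\<in>{..N} \<times> UNIV. mode_fun j (q j) z))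
     = (\<Sum>j\<in>{..N} \<times> UNIV. LINT z|?M. eigfun i z * (mode_fun j (q j) z))" for q
    unfolding sum_distrib_left
    by (rule Bochner_Integration.integral_sum) (intro ess_bdd_integrable ess_bdd_mult ess_bdd_eigfun ess_bdd_disk_poly disk_poly.mode)
  have "(LINT z|?M. eigfun i z * (mode_fun j (radial_op (fst j) (F j)) z))
     = 4 * kappa * (LINT z|?M. eigfun i z * (mode_fun j (F j) z))" for j
  proof (cases "i = j")
    case True
    have "clifford (fst i) kappa * poly (pderiv (F i)) 1 = 0"
      using i F0 kappa_props(2) by (auto simp: eig_indices_def)
    from radial_clifford_adjoint[OF F(1)[rule_format] this]
    show ?thesis unfolding integral_eigfun_mode using True by simp
  qed (simp add: integral_eigfun_mode)
  then show ?thesis unfolding F(2,3) sum by (simp add: sum_distrib_left)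
qed

lemma integral_eigfun_0:
  assumes "i \<in> eig_indices" shows "(LINT z|disk_area. eigfun i z) = 0"
proof -
  have "(LINT z|disk_area. eigfun i z) = (LINT z|disk_area. eigfun i z * (mode_fun (0, True) 1 z))"
    by (simp add: harm_def)
  also have "\<dots> = 0"
  proof (cases "i = (0, True)")
    case True
    from integral_01_FTC(1)[OF clifford_0_eq_DERIV] show ?thesis
      unfolding integral_eigfun_mode using True kappa_props(2) by simp
  next
    case False
    then show ?thesis unfolding integral_eigfun_mode by simp
  qed
  finally show ?thesis .
qed

text \<open>
  The coefficients of the power series solution of \<open>t F'' + (n + 1) F' + \<kappa> F = h\<close> with \<open>F(0) = \<alpha>\<close>.
\<close>

fun radial_series :: "nat \<Rightarrow> real poly \<Rightarrow> real \<Rightarrow> nat \<Rightarrow> real" where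
  "radial_series n h \<alpha> 0 = \<alpha>"
| "radial_series n h \<alpha> (Suc m) = (coeff h m - kappa * radial_series n h \<alpha> m) / ((real m + 1) * (real m + 1 + real n))"

definition radial_partial :: "nat \<Rightarrow> real poly \<Rightarrow> real \<Rightarrow> nat \<Rightarrow> real poly" where
  "radial_partial n h \<alpha> N = (\<Sum>m\<le>N. monom (radial_series n h \<alpha> m) m)"

lemma radial_series_tendsto_0: "radial_series n h \<alpha> \<longlonglongrightarrow> 0"
proof -
  obtain K :: nat where K: "2 * kappa \<le> real K" using real_arch_simple by blast
  have "summable (radial_series n h \<alpha>)"
  proof (rule summable_ratio_test[of "1/2" "max K (Suc (degree h))"])
    fix m assume m: "m \<ge> max K (Suc (degree h))"
    then have "coeff h m = 0" by (simp add: coeff_eq_0)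
    then have e: "norm (radial_series n h \<alpha> (Suc m)) = kappa / ((real m + 1) * (real m + 1 + real n)) * norm (radial_series n h \<alpha> m)"
      using kappa_props(1) by (simp add: abs_mult)
    have "real K * 1 \<le> (real m + 1) * (real m + 1 + real n)" using m by (intro mult_mono) auto
    then have "2 * kappa \<le> (real m + 1) * (real m + 1 + real n)" using K by linarith
    moreover have "0 < (real m + 1) * (real m + 1 + real n)" by (intro mult_pos_pos) auto
    ultimately have "kappa / ((real m + 1) * (real m + 1 + real n)) \<le> 1 / 2" by (simp add: pos_divide_le_eq)
    then show "norm (radial_series n h \<alpha> (Suc m)) \<le> 1 / 2 * norm (radial_series n h \<alpha> m)"
      unfolding e by (rule mult_right_mono) simp
  qed simp
  then show ?thesis by (rule summable_LIMSEQ_zero)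
qed

lemma coeff_radial_partial: "coeff (radial_partial n h \<alpha> N) m = (if m \<le> N then radial_series n h \<alpha> m else 0)"
proof -
  have "coeff (radial_partial n h \<alpha> N) m = (\<Sum>k\<le>N. if k = m then radial_series n h \<alpha> m else 0)"
    unfolding radial_partial_def coeff_sum coeff_monom by (intro sum.cong) auto
  then show ?thesis by simp
qed

lemma coeff_radial_op: "coeff (radial_op n F) m = -4 * ((real m + 1) * (real m + 1 + real n)) * coeff F (Suc m)"
proof (cases m)
  case 0
  then show ?thesis by (simp add: radial_op_def coeff_pderiv algebra_simps)
next
  case (Suc k)
  then show ?thesis by (simp add: radial_op_def coeff_pderiv algebra_simps)
qed

text \<open>
  A partial sum of the power series solves the equation up to a single monomial, whose coefficient
  tends to zero. So polynomial test functions suffice to exploit the series solution.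
\<close>

lemma radial_op_partial:
  assumes "N > degree h"
  shows "radial_op n (radial_partial n h \<alpha> N)
     = smult (-4) h + smult (4 * kappa) (radial_partial n h \<alpha> N) + monom (-4 * kappa * radial_series n h \<alpha> N) N"
proof (rule poly_eqI)
  fix m
  let ?d = "(real m + 1) * (real m + 1 + real n)"
  have d: "?d \<noteq> 0" by (simp add: add_nonneg_eq_0_iff)
  consider "m < N" | "m = N" | "m > N" by linarith
  then show "coeff (radial_op n (radial_partial n h \<alpha> N)) m = coeff (smult (-4) h + smult (4 * kappa) (radial_partial n h \<alpha> N) + monom (-4 * kappa * radial_series n h \<alpha> N) N) m"
  proof cases
    case 1
    have "?d * radial_series n h \<alpha> (Suc m) = coeff h m - kappa * radial_series n h \<alpha> m" using d by simp
    then have "-4 * ?d * radial_series n h \<alpha> (Suc m) = -4 * (coeff h m - kappa * radial_series n h \<alpha> m)"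
      by (simp only: mult.assoc)
    then show ?thesis using 1 by (simp only: coeff_radial_op coeff_radial_partial coeff_add coeff_smult coeff_monom) simp
  next
    case 2
    then show ?thesis using assms by (simp add: coeff_radial_op coeff_radial_partial coeff_eq_0)
  next
    case 3
    then show ?thesis using assms by (simp add: coeff_radial_op coeff_radial_partial coeff_eq_0)
  qed
qed

text \<open>
  The homogeneous equation is solved by a multiple of \<open>C\<^sub>n(\<kappa> t)\<close>.
\<close>

lemma radial_series_clifford: "radial_series n 0 1 m = fact n * (clifford_coeff n m * kappa ^ m)"
proof (induction m)
  case 0
  then show ?case by (simp add: clifford_coeff_def)
next
  case (Suc m)
  have "clifford_coeff n (Suc m) = - clifford_coeff n m / ((real m + 1) * (real m + 1 + real n))"
  proof -
    have "(-1) ^ Suc m / ((a * f) * (b * g)) = - ((-1) ^ m / (f * g)) / (a * b)" for a b f g :: real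
      by (simp add: mult_ac)
    from this[of "real m + 1" "fact m" "real m + 1 + real n" "fact (m + n)"]
    show ?thesis unfolding clifford_coeff_def by (simp add: add_ac)
  qed
  then show ?case by (simp add: Suc)
qed

text \<open>
  These functions are the kernel of the quadratic form of the energy inequality.
\<close>

locale euler_lagrange_solution =
  fixes w :: "complex \<Rightarrow> real"
  assumes bdd: "ess_bdd w" and mean: "(LINT z|disk_area. w z) = 0"
    and EL: "\<And>U p. poisson_pair U p \<Longrightarrow> (LINT z|disk_area. p z) = 0 \<Longrightarrow>
      (LINT z|disk_area. w z * p z) = 4 * kappa * (LINT z|disk_area. w z * U z)"
begin

definition moment :: "nat \<times> bool \<Rightarrow> real poly \<Rightarrow> real" where
  "moment i h = (LINT z|disk_area. w z * (mode_fun i h z))"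

lemma moment_add: "moment i (h + k) = moment i h + moment i k"
proof -
  have "moment i (h + k) = (LINT z|disk_area. w z * (mode_fun i h z) + w z * (mode_fun i k z))"
    unfolding moment_def by (intro Bochner_Integration.integral_cong) (simp_all add: algebra_simps)
  also have "\<dots> = moment i h + moment i k"
    unfolding moment_def by (intro Bochner_Integration.integral_add ess_bdd_integrable ess_bdd_mult bdd ess_bdd_disk_poly disk_poly.mode)
  finally show ?thesis .
qed

lemma moment_smult: "moment i (smult c h) = c * moment i h"
proof -
  have "moment i (smult c h) = (LINT z|disk_area. c * (w z * (mode_fun i h z)))"
    unfolding moment_def by (intro Bochner_Integration.integral_cong) (simp_all add: mult_ac)
  then show ?thesis unfolding moment_def by simp
qed

lemma moment_diff: "moment i (h - k) = moment i h - moment i k"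
  using moment_add[of i h "- k"] moment_smult[of i "-1" k] by simp

lemma moment_monom_bound: obtains L where "\<And>m. \<bar>moment i (monom 1 m)\<bar> \<le> L"
proof -
  let ?M = "disk_area"
  have "\<bar>moment i (monom 1 m)\<bar> \<le> (LINT z|?M. \<bar>w z\<bar>)" for m
  proof -
    have "\<bar>moment i (monom 1 m)\<bar> \<le> (LINT z|?M. \<bar>w z * (mode_fun i (monom 1 m) z)\<bar>)"
      unfolding moment_def by (rule integral_abs_bound)
    also have "\<dots> \<le> (LINT z|?M. \<bar>w z\<bar>)"
    proof (rule integral_mono)
      show "integrable ?M (\<lambda>z. \<bar>w z * (mode_fun i (monom 1 m) z)\<bar>)"
        by (intro integrable_abs ess_bdd_integrable ess_bdd_mult bdd ess_bdd_disk_poly disk_poly.mode)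
      show "integrable ?M (\<lambda>z. \<bar>w z\<bar>)" by (intro integrable_abs ess_bdd_integrable bdd)
      fix z :: complex assume "z \<in> space ?M"
      then have "\<bar>harm i z\<bar> \<le> 1" "\<bar>(nsq z) ^ m\<bar> \<le> 1"
        using harm_le_1[of z i] by (auto simp: power_le_one)
      then have "\<bar>harm i z * (nsq z) ^ m\<bar> \<le> 1 * 1" unfolding abs_mult by (intro mult_mono) auto
      then have "\<bar>w z\<bar> * \<bar>harm i z * (nsq z) ^ m\<bar> \<le> \<bar>w z\<bar> * 1" by (intro mult_left_mono) auto
      then show "\<bar>w z * (mode_fun i (monom 1 m) z)\<bar> \<le> \<bar>w z\<bar>"
        by (simp add: poly_monom abs_mult)
    qed
    finally show ?thesis .
  qed
  then show ?thesis by (rule that)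
qed

lemma moment_0False: "moment (0, False) h = 0"
  by (simp add: moment_def harm_def)

lemma moment_mean: "moment (0, True) 1 = 0"
  using mean by (simp add: moment_def harm_def)

text \<open>
  In frequency \<open>0\<close> the condition \<open>F'(1) = 0\<close> expresses that the test function has mean zero.
\<close>

lemma moment_EL:
  assumes "poly F 1 = 0" "fst i = 0 \<Longrightarrow> poly (pderiv F) 1 = 0"
  shows "moment i (radial_op (fst i) F) = 4 * kappa * moment i F"
  unfolding moment_def
proof (rule EL[OF poisson_pair_single[OF assms(1)]])
  let ?q = "radial_op (fst i) F"
  have c: "continuous_on {0..1} (poly ?q)" by (intro continuous_intros)
  have "(LINT z|disk_area. mode_fun i ?q z) = (LINT z|disk_area. harm i z * harm (0, True) z * poly ?q (nsq z))"
    by (simp add: harm_def)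
  also have "\<dots> = 0"
    unfolding harm_orthogonal[OF c] using assms(2) by (auto simp: integral_radial_op_0)
  finally show "(LINT z|disk_area. mode_fun i ?q z) = 0" .
qed

text \<open>
  Test with the partial sum of the power series, corrected by a constant so as to vanish at \<open>1\<close>. In the
  limit all moments of the mode are multiples of the lowest one.
\<close>

lemma moment_recursion_pos:
  assumes n: "fst i \<noteq> 0" and N: "N > degree h"
  shows "moment i h = kappa * poly (radial_partial (fst i) h \<alpha> N) 1 * moment i 1
      - kappa * radial_series (fst i) h \<alpha> N * moment i (monom 1 N)"
proof -
  let ?F = "radial_partial (fst i) h \<alpha> N"
  let ?G = "?F - smult (poly ?F 1) 1"
  have "moment i (radial_op (fst i) ?G) = 4 * kappa * moment i ?G"
    by (rule moment_EL) (use n in simp_all)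
  moreover have "radial_op (fst i) ?G = radial_op (fst i) ?F"
    using radial_op_const[of "fst i" "poly ?F 1"] by (simp add: radial_op_diff one_pCons)
  moreover have "monom (-4 * kappa * radial_series (fst i) h \<alpha> N) N = smult (-4 * kappa * radial_series (fst i) h \<alpha> N) (monom 1 N)"
    by (simp add: smult_monom)
  ultimately show ?thesis
    by (simp only: radial_op_partial[OF N] moment_add moment_diff moment_smult) (simp add: algebra_simps)
qed

text \<open>
  Here the partial sum has to be corrected by an affine function, since its derivative must vanish at
  \<open>1\<close> as well. As the lowest moment is the mean, which is zero, the moment of \<open>t\<close> takes over its role.
\<close>

lemma moment_recursion_0:
  assumes N: "N > degree h"
  shows "moment (0, True) h = kappa * poly (pderiv (radial_partial 0 h \<alpha> N)) 1 * moment (0, True) (monom 1 1)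
      - kappa * radial_series 0 h \<alpha> N * moment (0, True) (monom 1 N)"
proof -
  let ?i = "(0::nat, True)"
  let ?F = "radial_partial 0 h \<alpha> N"
  let ?c = "poly (pderiv ?F) 1"
  let ?G = "?F - (smult (poly ?F 1 - ?c) 1 + smult ?c (monom 1 1))"
  have "moment ?i (radial_op (fst ?i) ?G) = 4 * kappa * moment ?i ?G"
    by (rule moment_EL) (simp_all add: poly_monom pderiv_diff pderiv_add pderiv_smult pderiv_monom)
  moreover have "radial_op 0 ?G = radial_op 0 ?F + smult (4 * ?c) 1"
    by (simp add: radial_op_def pderiv_diff pderiv_add pderiv_smult pderiv_monom algebra_simps smult_add_right)
  moreover have "monom (-4 * kappa * radial_series 0 h \<alpha> N) N = smult (-4 * kappa * radial_series 0 h \<alpha> N) (monom 1 N)"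
    by (simp add: smult_monom)
  ultimately show ?thesis
    by (simp only: fst_conv radial_op_partial[OF N] moment_add moment_diff moment_smult moment_mean) (simp add: algebra_simps)
qed

lemma remainder_tendsto_0: "(\<lambda>N. kappa * radial_series n h \<alpha> N * moment i (monom 1 N)) \<longlonglongrightarrow> 0"
proof -
  obtain L where L: "\<And>m. \<bar>moment i (monom 1 m)\<bar> \<le> L" using moment_monom_bound by blast
  have "(\<lambda>N. kappa * radial_series n h \<alpha> N) \<longlonglongrightarrow> kappa * 0"
    by (intro tendsto_intros radial_series_tendsto_0)
  then have "(\<lambda>N. \<bar>kappa * radial_series n h \<alpha> N\<bar> * L) \<longlonglongrightarrow> 0"
    by (intro tendsto_mult_left_zero tendsto_rabs_zero) simp
  moreover have "norm (kappa * radial_series n h \<alpha> N * moment i (monom 1 N)) \<le> \<bar>kappa * radial_series n h \<alpha> N\<bar> * L" for N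
    unfolding real_norm_def abs_mult[of _ "moment _ _"] by (rule mult_left_mono[OF L]) simp
  ultimately show ?thesis by (rule Lim_null_comparison[rotated, OF _ always_eventually[OF allI]])
qed

text \<open>
  For \<open>h = 0\<close> the recursion forces the lowest moment to vanish unless \<open>C\<^sub>n(\<kappa>) = 0\<close>, and \<open>C\<^sub>n(\<kappa>) > 0\<close> for
  \<open>n \<ge> 2\<close>.
\<close>

lemma moment_ge_2:
  assumes n: "fst i \<ge> 2" shows "moment i 1 = 0"
proof -
  let ?n = "fst i"
  have lim: "(\<lambda>N. kappa * poly (radial_partial ?n 0 1 N) 1 * moment i 1 - kappa * radial_series ?n 0 1 N * moment i (monom 1 N))
     \<longlonglongrightarrow> kappa * (fact ?n * clifford ?n kappa) * moment i 1 - 0"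
  proof (intro tendsto_diff remainder_tendsto_0 tendsto_mult tendsto_const)
    have "(\<lambda>N. fact ?n * (\<Sum>m\<le>N. clifford_coeff ?n m * kappa ^ m)) \<longlonglongrightarrow> fact ?n * clifford ?n kappa"
      using clifford_sums[of ?n kappa] unfolding sums_def_le by (intro tendsto_intros)
    then show "(\<lambda>N. poly (radial_partial ?n 0 1 N) 1) \<longlonglongrightarrow> fact ?n * clifford ?n kappa"
      by (simp add: radial_partial_def poly_sum poly_monom radial_series_clifford sum_distrib_left)
  qed
  have ev: "eventually (\<lambda>N. kappa * poly (radial_partial ?n 0 1 N) 1 * moment i 1 - kappa * radial_series ?n 0 1 N * moment i (monom 1 N) = 0) sequentially"
    using eventually_gt_at_top[of 0]
  proof eventually_elim
    case (elim N)
    have "moment i 0 = 0" by (simp add: moment_def)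
    then show ?case using moment_recursion_pos[of i 0 N 1] n elim by simp
  qed
  have "kappa * (fact ?n * clifford ?n kappa) * moment i 1 = 0"
    using LIMSEQ_unique[OF lim tendsto_eventually[OF ev]] by simp
  then show ?thesis using kappa_props(1) clifford_pos_le[OF n, of kappa] by simp
qed

text \<open>
  The recursions leave only remainders that tend to zero.
\<close>

lemma moment_eq_0:
  assumes "moment (0, True) (monom 1 1) = 0" "\<And>b. moment (1, b) 1 = 0"
  shows "moment i h = 0"
proof -
  have lim: "x = 0" if "\<And>N. N > degree h \<Longrightarrow> x = - (kappa * radial_series n h 0 N * moment i (monom 1 N))" for x n
  proof -
    have "(\<lambda>N. - (kappa * radial_series n h 0 N * moment i (monom 1 N))) \<longlonglongrightarrow> - 0"
      by (intro tendsto_minus remainder_tendsto_0)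
    moreover have "eventually (\<lambda>N. - (kappa * radial_series n h 0 N * moment i (monom 1 N)) = x) sequentially"
      using eventually_gt_at_top[of "degree h"] by eventually_elim (use that in simp)
    ultimately have "(\<lambda>N. x) \<longlonglongrightarrow> 0" by (simp add: tendsto_cong)
    then show ?thesis by (simp add: LIMSEQ_const_iff)
  qed
  show ?thesis
  proof (cases "fst i = 0")
    case True
    show ?thesis
    proof (cases "snd i")
      case s: True
      have i: "i = (0, True)" using True s by (cases i) auto
      show ?thesis
        by (rule lim[of _ 0]) (subst i, subst moment_recursion_0[of h _ 0], auto simp: assms(1)[simplified] i)
    next
      case False
      then have "i = (0, False)" using True by (cases i) auto
      then show ?thesis by (simp add: moment_0False)
    qed
  next
    case False
    have m1: "moment i 1 = 0"
    proof (cases "fst i = 1")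
      case True then show ?thesis using assms(2)[of "snd i"] by (cases i) simp
    next
      case f: False then show ?thesis using False by (intro moment_ge_2) simp
    qed
    show ?thesis
      by (rule lim[of _ "fst i"]) (subst moment_recursion_pos[OF False, of h _ 0], auto simp: m1)
  qed
qed

lemma AE_0:
  assumes "moment (0, True) (monom 1 1) = 0" "\<And>b. moment (1, b) 1 = 0"
  shows "AE z in disk_area. w z = 0"
proof (rule AE_0_if_orthogonal_to_disk_polys[OF bdd])
  fix p assume "disk_poly p"
  then show "(LINT z|disk_area. w z * p z) = 0"
  proof induction
    case (mode i q)
    show ?case using moment_eq_0[OF assms, of i q] by (simp add: moment_def)
  next
    case (add f g)
    have "(LINT z|disk_area. w z * (f z + g z)) = (LINT z|disk_area. w z * f z) + (LINT z|disk_area. w z * g z)"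
      unfolding distrib_left
      by (intro Bochner_Integration.integral_add ess_bdd_integrable ess_bdd_mult bdd ess_bdd_disk_poly add.hyps)
    then show ?case using add.IH by simp
  qed
qed

end

section \<open>The equality case of the energy inequality\<close>

text \<open>
  The general member of \<open>V_space\<close>, with the factor \<open>j / 2\<close> of \<open>J\<^sub>1(jr) = (j r / 2) C\<^sub>1(\<kappa> r\<^sup>2)\<close> absorbed into the
  last two coefficients.
\<close>

definition Vfun :: "real \<Rightarrow> real \<Rightarrow> real \<Rightarrow> complex \<Rightarrow> real" where
  "Vfun a b c z = a * eigfun (0, True) z + b * eigfun (1, True) z + c * eigfun (1, False) z"

lemma continuous_on_Vfun [continuous_intros]: "continuous_on S (Vfun a b c)"
  unfolding Vfun_def[abs_def] by (intro continuous_intros)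

lemma ess_bdd_Vfun: "ess_bdd (Vfun a b c)"
  by (intro ess_bdd_continuous continuous_intros)

lemma Vfun_bessel:
  "a * bessel_J 0 (bessel_J1_zero * cmod z)
     + b * (bessel_J 1 (bessel_J1_zero * cmod z) * cos (Arg z))
     + c * (bessel_J 1 (bessel_J1_zero * cmod z) * sin (Arg z))
   = Vfun a (b * bessel_J1_zero / 2) (c * bessel_J1_zero / 2) z"
proof -
  have k: "(bessel_J1_zero * cmod z / 2)\<^sup>2 = kappa * nsq z"
    by (simp add: kappa_def power_mult_distrib power_divide)
  have p: "cmod z * cos (Arg z) = Re z" "cmod z * sin (Arg z) = Im z"
    using rcis_cmod_Arg[of z] by (metis Re_rcis, metis Im_rcis)
  show ?thesis
    unfolding bessel_J_clifford k Vfun_def eigfun_def harm_def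
    by (simp add: p[symmetric] algebra_simps)
qed

lemma V_space_iff: "v \<in> V_space \<longleftrightarrow> (\<exists>a b c. AE z in disk_area. v z = Vfun a b c z)"
proof
  assume "v \<in> V_space"
  then show "\<exists>a b c. AE z in disk_area. v z = Vfun a b c z"
    unfolding V_space_def Vfun_bessel by blast
next
  assume "\<exists>a b c. AE z in disk_area. v z = Vfun a b c z"
  then obtain a b c where v: "AE z in disk_area. v z = Vfun a b c z" by blast
  have scale: "(x * 2 / bessel_J1_zero) * bessel_J1_zero / 2 = x" for x
    using bessel_J1_zero_pos by simp
  have "AE z in disk_area. v z = Vfun a ((b * 2 / bessel_J1_zero) * bessel_J1_zero / 2)
      ((c * 2 / bessel_J1_zero) * bessel_J1_zero / 2) z"
    unfolding scale by (rule v)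
  then show "v \<in> V_space"
    unfolding V_space_def Vfun_bessel by blast
qed

lemma euler_lagrange_solution_diff:
  assumes v: "euler_lagrange_solution v" and u: "euler_lagrange_solution u"
  shows "euler_lagrange_solution (\<lambda>z. v z - c * u z)"
proof -
  let ?M = "disk_area"
  interpret v: euler_lagrange_solution v by (rule v)
  interpret u: euler_lagrange_solution u by (rule u)
  have lin: "(LINT z|?M. (v z - c * u z) * f z) = (LINT z|?M. v z * f z) - c * (LINT z|?M. u z * f z)" if f: "ess_bdd f" for f
  proof -
    have "(LINT z|?M. (v z - c * u z) * f z) = (LINT z|?M. v z * f z - c * (u z * f z))"
      by (intro Bochner_Integration.integral_cong) (simp_all add: algebra_simps)
    also have "\<dots> = (LINT z|?M. v z * f z) - (LINT z|?M. c * (u z * f z))"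
      by (intro Bochner_Integration.integral_diff ess_bdd_integrable ess_bdd_mult ess_bdd_const v.bdd u.bdd f)
    finally show ?thesis by simp
  qed
  show ?thesis
  proof
    show "ess_bdd (\<lambda>z. v z - c * u z)" by (intro ess_bdd_diff ess_bdd_mult ess_bdd_const v.bdd u.bdd)
    show "(LINT z|?M. v z - c * u z) = 0"
      using lin[OF ess_bdd_const[of 1]] v.mean u.mean by simp
    fix U p assume pair: "poisson_pair U p" and pm: "(LINT z|?M. p z) = 0"
    have b: "ess_bdd p" "ess_bdd U" using poisson_pair_disk_poly[OF pair] by (auto intro: ess_bdd_disk_poly)
    show "(LINT z|?M. (v z - c * u z) * p z) = 4 * kappa * (LINT z|?M. (v z - c * u z) * U z)"
      unfolding lin[OF b(1)] lin[OF b(2)] using v.EL[OF pair pm] u.EL[OF pair pm] by (simp add: algebra_simps)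
  qed
qed

lemma euler_lagrange_solution_eigfun: "i \<in> eig_indices \<Longrightarrow> euler_lagrange_solution (eigfun i)"
  by unfold_locales (auto intro: ess_bdd_eigfun integral_eigfun_0 eigfun_euler_lagrange)

lemma euler_lagrange_solution_Vfun: "euler_lagrange_solution (Vfun a b c)"
proof -
  have "euler_lagrange_solution (\<lambda>z. (((eigfun (0, True) z - (1 - a) * eigfun (0, True) z) - (- b) * eigfun (1, True) z) - (- c) * eigfun (1, False) z))"
    by (intro euler_lagrange_solution_diff euler_lagrange_solution_eigfun) (simp_all add: eig_indices_def)
  moreover have "(\<lambda>z. (((eigfun (0, True) z - (1 - a) * eigfun (0, True) z) - (- b) * eigfun (1, True) z) - (- c) * eigfun (1, False) z)) = Vfun a b c"
    by (rule ext) (simp add: Vfun_def algebra_simps)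
  ultimately show ?thesis by simp
qed

lemma integral_01_pos:
  fixes f :: "real \<Rightarrow> real"
  assumes "continuous_on {0..1} f" "\<And>t. t \<in> {0..1} \<Longrightarrow> 0 \<le> f t" "0 < f (1 / 2)"
  shows "0 < integral {0..1} f"
proof -
  have "0 \<le> integral {0..1} f" by (rule integral_nonneg) (use assms in \<open>auto intro: integrable_continuous_interval\<close>)
  moreover have "integral {0..1} f \<noteq> 0"
  proof
    assume "integral {0..1} f = 0"
    then have "f (1 / 2) = 0" using integral_eq_0_iff[of 0 1 f] assms by simp
    then show False using assms(3) by simp
  qed
  ultimately show ?thesis by simp
qed

lemma clifford_1_nonneg: "t \<in> {0..1} \<Longrightarrow> 0 \<le> clifford 1 (kappa * t)"
  and clifford_1_half_pos: "0 < clifford 1 (kappa * (1 / 2))"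
proof -
  show "0 < clifford 1 (kappa * (1 / 2))" using kappa_props(1) by (intro kappa_props(3)) auto
  assume t: "t \<in> {0..1}"
  show "0 \<le> clifford 1 (kappa * t)"
  proof (cases "t = 1")
    case True then show ?thesis using kappa_props(2) by simp
  next
    case False
    then have "kappa * t < kappa" using t kappa_props(1) by simp
    then show ?thesis using t kappa_props(1) by (intro less_imp_le[OF kappa_props(3)]) auto
  qed
qed

lemma integral_t_clifford_1_pos: "0 < integral {0..1} (\<lambda>t. t * clifford 1 (kappa * t))"
  by (rule integral_01_pos) (use clifford_1_nonneg clifford_1_half_pos in \<open>auto intro!: continuous_intros\<close>)

text \<open>
  Integrate \<open>t (t C\<^sub>1(\<kappa> t))'\<close> by parts. The value is nonzero, so the moment of \<open>t\<close> detects multiples of \<open>J\<^sub>0\<close>,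
  whose mean is zero.
\<close>

lemma integral_t_clifford_0: "integral {0..1} (\<lambda>t. t * clifford 0 (kappa * t)) = - integral {0..1} (\<lambda>t. t * clifford 1 (kappa * t))"
proof -
  have d: "((\<lambda>t. t * (t * clifford 1 (kappa * t))) has_real_derivative t * clifford 1 (kappa * t) + t * clifford 0 (kappa * t)) (at t)" for t
    using DERIV_mult[OF DERIV_ident clifford_0_eq_DERIV, of t] by (simp add: mult_ac)
  have i: "(\<lambda>t. t * clifford n (kappa * t)) integrable_on {0..1}" for n
    by (intro integrable_continuous_interval continuous_intros)
  have "integral {0..1} (\<lambda>t. t * clifford 1 (kappa * t) + t * clifford 0 (kappa * t)) = 0"
    using integral_01_FTC(1)[OF d] kappa_props(2) by simp
  then show ?thesis by (simp only: Henstock_Kurzweil_Integration.integral_add[OF i i])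
qed

text \<open>
  Subtract from \<open>v\<close> the member of \<open>V_space\<close> with the same three lowest moments. The difference solves the
  same linear equation, and all its moments vanish.
\<close>

lemma euler_lagrange_solution_in_V:
  assumes v: "euler_lagrange_solution v" shows "v \<in> V_space"
proof -
  let ?M = "disk_area"
  interpret v: euler_lagrange_solution v by (rule v)
  let ?I = "\<lambda>f i h. LINT z|?M. f z * (mode_fun i h z)"
  define a where "a = ?I v (0, True) (monom 1 1) / ?I (eigfun (0, True)) (0, True) (monom 1 1)"
  define b where "b = ?I v (1, True) 1 / ?I (eigfun (1, True)) (1, True) 1"
  define c where "c = ?I v (1, False) 1 / ?I (eigfun (1, False)) (1, False) 1"
  let ?w = "\<lambda>z. v z - 1 * Vfun a b c z"
  have w: "euler_lagrange_solution ?w"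
    by (rule euler_lagrange_solution_diff[OF v euler_lagrange_solution_Vfun])
  then interpret w: euler_lagrange_solution ?w .
  have nz: "?I (eigfun (0, True)) (0, True) (monom 1 1) \<noteq> 0" "?I (eigfun (1, True)) (1, True) 1 \<noteq> 0"
     "?I (eigfun (1, False)) (1, False) 1 \<noteq> 0"
    unfolding integral_eigfun_mode using integral_t_clifford_1_pos integral_t_clifford_0
    by (simp_all add: harm_weight_def poly_monom mult.commute[of _ "t::real" for t])
  have lin: "?I ?w i h = ?I v i h - (a * ?I (eigfun (0, True)) i h + b * ?I (eigfun (1, True)) i h + c * ?I (eigfun (1, False)) i h)" for i h
  proof -
    have m: "ess_bdd (\<lambda>z. mode_fun i h z)" by (intro ess_bdd_disk_poly disk_poly.mode)
    have int: "integrable ?M (\<lambda>z. f z * (mode_fun i h z))" if "ess_bdd f" for f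
      by (intro ess_bdd_integrable ess_bdd_mult m that)
    have "?I ?w i h = (LINT z|?M. v z * (mode_fun i h z) - ((a * (eigfun (0, True) z * (mode_fun i h z)) + b * (eigfun (1, True) z * (mode_fun i h z))) + c * (eigfun (1, False) z * (mode_fun i h z))))"
      by (intro Bochner_Integration.integral_cong) (simp_all add: Vfun_def algebra_simps)
    also have "\<dots> = ?I v i h - (a * ?I (eigfun (0, True)) i h + b * ?I (eigfun (1, True)) i h + c * ?I (eigfun (1, False)) i h)"
      by (simp only: Bochner_Integration.integral_diff Bochner_Integration.integral_add Bochner_Integration.integrable_add integrable_mult_right int[OF v.bdd] int[OF ess_bdd_eigfun] integral_mult_right_zero)
    finally show ?thesis .
  qed
  have off: "?I (eigfun i) j h = 0" if "i \<noteq> j" for i j h using that by (simp add: integral_eigfun_mode)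
  have "AE z in ?M. ?w z = 0"
  proof (rule w.AE_0)
    show "w.moment (0, True) (monom 1 1) = 0"
      unfolding w.moment_def lin using nz(1) by (simp add: off a_def del: One_nat_def)
    have T: "w.moment (1, True) 1 = 0"
      unfolding w.moment_def lin using nz(2) by (simp add: off b_def del: poly_1)
    have F: "w.moment (1, False) 1 = 0"
      unfolding w.moment_def lin using nz(3) by (simp add: off c_def del: poly_1)
    show "w.moment (1, b) 1 = 0" for b using T F by (cases b) auto
  qed
  then have "AE z in ?M. v z = Vfun a b c z" by eventually_elim simp
  then show ?thesis unfolding V_space_iff by blast
qed

lemma green_op_AE_cong:
  assumes "AE z in disk_area. v z = w z" "ess_bdd v" "ess_bdd w"
  shows "green_op v = green_op w"
proof -
  have "(LINT x|disk_area. v x * \<phi> x) = (LINT x|disk_area. w x * \<phi> x)" if "disk_test_function \<phi>" for \<phi>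
  proof (rule integral_cong_AE)
    have pb: "ess_bdd \<phi>" using that continuous_on_C_k[of 0 \<phi>] by (intro ess_bdd_continuous) (simp add: disk_test_function_def)
    show "(\<lambda>x. v x * \<phi> x) \<in> borel_measurable (disk_area)" "(\<lambda>x. w x * \<phi> x) \<in> borel_measurable (disk_area)"
      by (rule ess_bdd_measurable[OF ess_bdd_mult[OF assms(2) pb]], rule ess_bdd_measurable[OF ess_bdd_mult[OF assms(3) pb]])
    show "AE x in disk_area. v x * \<phi> x = w x * \<phi> x" using assms(1) by eventually_elim simp
  qed
  then have "dirichlet_solution v = dirichlet_solution w"
    using ess_bdd_integrable[OF assms(2)] ess_bdd_integrable[OF assms(3)]
    by (auto simp: dirichlet_solution_def fun_eq_iff)
  then show ?thesis by (simp add: green_op_def)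
qed

text \<open>
  The Euler-Lagrange equation and transposition show that \<open>4 \<kappa> \<G> e - e\<close> is orthogonal to polynomials of mean
  zero, hence to \<open>e\<close> itself.
\<close>

lemma energy_equality_Vfun:
  "4 * kappa * (LINT z|disk_area. Vfun a b c z * green_op (Vfun a b c) z)
    = (LINT z|disk_area. Vfun a b c z * Vfun a b c z)"
proof -
  let ?M = "disk_area" and ?e = "Vfun a b c"
  interpret e: euler_lagrange_solution ?e by (rule euler_lagrange_solution_Vfun)
  note gb = ess_bdd_green_op[OF e.bdd]
  show ?thesis
  proof (rule disk_poly_dense_mean_zero[OF e.bdd e.mean])
    fix p M
    assume p: "\<And>n. disk_poly (p n)" "\<And>n z. z \<in> cball 0 1 \<Longrightarrow> \<bar>p n z\<bar> \<le> M"
      "AE z in ?M. (\<lambda>n. p n z) \<longlonglongrightarrow> ?e z" "\<And>n. (LINT z|?M. p n z) = 0"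
    have "4 * kappa * (LINT z|?M. green_op ?e z * p n z) = (LINT z|?M. ?e z * p n z)" for n
    proof -
      obtain U where U: "poisson_pair U (p n)" using poisson_pair_exists[OF p(1)] .
      show ?thesis using e.EL[OF U p(4)] transposition[OF dirichlet_solution_green_op[OF e.bdd] U] by simp
    qed
    moreover have "(\<lambda>n. 4 * kappa * (LINT z|?M. green_op ?e z * p n z)) \<longlonglongrightarrow> 4 * kappa * (LINT z|?M. green_op ?e z * ?e z)"
      by (intro tendsto_mult tendsto_const integral_disk_poly_limit[OF gb e.bdd p(1) p(2) p(3)])
    moreover have "(\<lambda>n. LINT z|?M. ?e z * p n z) \<longlonglongrightarrow> (LINT z|?M. ?e z * ?e z)"
      by (rule integral_disk_poly_limit[OF e.bdd e.bdd p(1) p(2) p(3)])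
    ultimately have "4 * kappa * (LINT z|?M. green_op ?e z * ?e z) = (LINT z|?M. ?e z * ?e z)"
      using LIMSEQ_unique by simp
    then show ?thesis by (simp only: mult.commute[of "green_op _ _"])
  qed
qed

lemma ess_bdd_V_space: "v \<in> V_space \<Longrightarrow> ess_bdd v"
  unfolding V_space_iff
proof (elim exE)
  fix a b c assume "AE z in disk_area. v z = Vfun a b c z"
  then have "AE z in disk_area. Vfun a b c z = v z" by eventually_elim simp
  then show "ess_bdd v" by (rule ess_bdd_AE[OF ess_bdd_Vfun])
qed

lemma integral_mult_AE_cong:
  assumes "AE z in disk_area. v z = w z" "ess_bdd v" "ess_bdd w" "ess_bdd g"
  shows "(LINT z|disk_area. v z * g z) = (LINT z|disk_area. w z * g z)"
  by (rule integral_cong_AE)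
     (use assms in \<open>auto intro!: ess_bdd_measurable ess_bdd_mult elim: eventually_mono\<close>)

lemma V_space_props:
  assumes "v \<in> V_space"
  shows "(LINT z|disk_area. v z) = 0"
    and "4 * kappa * (LINT z|disk_area. v z * green_op v z) = (LINT z|disk_area. v z * v z)"
proof -
  let ?M = "disk_area"
  obtain a b c where v: "AE z in ?M. v z = Vfun a b c z" using assms unfolding V_space_iff by blast
  note vb = ess_bdd_V_space[OF assms] and eb = ess_bdd_Vfun[of a b c]
  interpret e: euler_lagrange_solution "Vfun a b c" by (rule euler_lagrange_solution_Vfun)
  show "(LINT z|?M. v z) = 0"
    using integral_mult_AE_cong[OF v vb eb ess_bdd_const[of 1]] e.mean by simp
  have g: "green_op v = green_op (Vfun a b c)" by (rule green_op_AE_cong[OF v vb eb])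
  have "4 * kappa * (LINT z|?M. v z * green_op v z) = 4 * kappa * (LINT z|?M. Vfun a b c z * green_op (Vfun a b c) z)"
    unfolding g using integral_mult_AE_cong[OF v vb eb ess_bdd_green_op[OF eb]] by simp
  also have "\<dots> = (LINT z|?M. Vfun a b c z * Vfun a b c z)" by (rule energy_equality_Vfun)
  also have "\<dots> = (LINT z|?M. v z * Vfun a b c z)"
    using integral_mult_AE_cong[OF v vb eb eb] by simp
  also have "\<dots> = (LINT z|?M. v z * v z)"
    using integral_mult_AE_cong[OF v vb eb vb] by (simp only: mult.commute[of "Vfun a b c _"])
  finally show "4 * kappa * (LINT z|?M. v z * green_op v z) = (LINT z|?M. v z * v z)" .
qed

lemma energy_equality_imp_V_space:
  assumes "ess_bdd v" "(LINT z|disk_area. v z) = 0"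
    "4 * kappa * (LINT z|disk_area. v z * green_op v z) = (LINT z|disk_area. v z * v z)"
  shows "v \<in> V_space"
proof (rule euler_lagrange_solution_in_V)
  show "euler_lagrange_solution v"
    by unfold_locales (use assms euler_lagrange[OF assms] in auto)
qed

section \<open>Equimeasurable maximisers are rotations of each other\<close>

lemma superlevel_lmeasurable:
  fixes v :: "complex \<Rightarrow> real"
  assumes "v \<in> borel_measurable (disk_area)"
  shows "{x \<in> unit_disk. v x > s} \<in> lmeasurable"
proof -
  have "v -` {s<..} \<inter> space (disk_area) \<in> sets (disk_area)"
    by (rule measurable_sets[OF assms]) simp
  moreover have "v -` {s<..} \<inter> space (disk_area) = {x \<in> unit_disk. v x > s}" by auto
  ultimately have "{x \<in> unit_disk. v x > s} \<in> sets (disk_area)" by simp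
  then have "{x \<in> unit_disk. v x > s} \<in> sets lebesgue" by (simp add: sets_restrict_space_iff)
  then show ?thesis by (rule bounded_set_imp_lmeasurable[rotated]) (rule bounded_subset[OF bounded_ball[of 0 1]], auto)
qed

text \<open>
  The half-lines \<open>{s<..}\<close> generate the Borel sets, so the superlevel sets determine all moments.
\<close>

lemma equimeasurable_distr:
  assumes v: "v \<in> borel_measurable (disk_area)" and w: "w \<in> borel_measurable (disk_area)"
    and eq: "\<And>s. measure lebesgue {x \<in> unit_disk. v x > s} = measure lebesgue {x \<in> unit_disk. w x > s}"
  shows "distr (disk_area) borel v = distr (disk_area) borel (w :: complex \<Rightarrow> real)"
proof (rule measure_eqI_lessThan)
  have e: "emeasure (distr (disk_area) borel f) {s<..} = ennreal (measure lebesgue {x \<in> unit_disk. f x > s})"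
    if f: "f \<in> borel_measurable (disk_area)" for f :: "complex \<Rightarrow> real" and s
  proof -
    have "emeasure (distr (disk_area) borel f) {s<..} = emeasure (disk_area) (f -` {s<..} \<inter> unit_disk)"
      using f by (simp add: emeasure_distr)
    also have "f -` {s<..} \<inter> unit_disk = {x \<in> unit_disk. f x > s}" by auto
    also have "emeasure (disk_area) {x \<in> unit_disk. f x > s} = emeasure lebesgue {x \<in> unit_disk. f x > s}"
      by (rule emeasure_restrict_space) auto
    also have "\<dots> = ennreal (measure lebesgue {x \<in> unit_disk. f x > s})"
      by (rule emeasure_eq_measure2) (rule superlevel_lmeasurable[OF f])
    finally show ?thesis .
  qed
  show "emeasure (distr (disk_area) borel v) {s<..} < \<infinity>" for s by (simp add: e[OF v])
  show "emeasure (distr (disk_area) borel v) {s<..} = emeasure (distr (disk_area) borel w) {s<..}" for s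
    by (simp only: e[OF v] e[OF w] eq)
qed simp_all

lemma equidistributed_ess_bdd:
  assumes v: "v \<in> borel_measurable (disk_area)" and w: "ess_bdd w"
    and d: "distr (disk_area) borel v = distr (disk_area) borel w"
  shows "ess_bdd v"
proof -
  obtain K where K: "AE x in disk_area. \<bar>w x\<bar> \<le> K" using w by (auto simp: ess_bdd_def)
  have "{y::real. \<bar>y\<bar> \<le> K} \<in> sets borel" by measurable
  then have iff: "(AE y in distr (disk_area) borel f. \<bar>y\<bar> \<le> K) \<longleftrightarrow> (AE x in disk_area. \<bar>f x\<bar> \<le> K)"
    if "f \<in> borel_measurable (disk_area)" for f :: "complex \<Rightarrow> real"
    using that by (intro AE_distr_iff) auto
  have "AE y in distr (disk_area) borel w. \<bar>y\<bar> \<le> K"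
    using K iff[OF ess_bdd_measurable[OF w]] by blast
  then have "AE x in disk_area. \<bar>v x\<bar> \<le> K"
    using iff[OF v] unfolding d by blast
  then show ?thesis using v by (auto simp: ess_bdd_def)
qed

lemma equidistributed_moments:
  assumes v: "v \<in> borel_measurable (disk_area)" and w: "w \<in> borel_measurable (disk_area)"
    and d: "distr (disk_area) borel v = distr (disk_area) borel w"
  shows "(LINT x|disk_area. v x ^ k) = (LINT x|disk_area. (w x :: real) ^ k)"
proof -
  have "(LINT x|disk_area. f x ^ k) = (LINT y|distr (disk_area) borel f. y ^ k)"
    if "f \<in> borel_measurable (disk_area)" for f :: "complex \<Rightarrow> real"
    by (rule integral_distr[symmetric]) (use that in measurable)
  then show ?thesis using v w d by simp
qed

lemma harm_simps: "harm (0, True) z = 1" "harm (1, True) z = Re z" "harm (1, False) z = Im z"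
  by (simp_all add: harm_def)

lemma Vfun_eq: "Vfun a b c z = a * clifford 0 (kappa * nsq z) + (b * Re z + c * Im z) * clifford 1 (kappa * nsq z)"
  by (simp add: Vfun_def eigfun_def harm_simps algebra_simps del: One_nat_def)

lemma integral_disk_odd:
  assumes f: "continuous_on (cball 0 1) f" and odd: "\<And>z. f (- z) = - f z"
  shows "(LINT z|disk_area. f z :: real) = 0"
  using integral_disk_rotate[OF f, of pi] by (simp add: odd)

text \<open>
  The square of \<open>b x + c y\<close> has mean \<open>(b\<^sup>2 + c\<^sup>2) t / 2\<close> over the circle \<open>|z|\<^sup>2 = t\<close>.
\<close>

lemma integral_disk_even_part:
  assumes G: "continuous_on {0..1} G" and H: "continuous_on {0..1} H"
  shows "(LINT z|disk_area. G (nsq z) + (b * Re z + c * Im z)\<^sup>2 * H (nsq z))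
    = pi * integral {0..1} G + pi / 2 * (b\<^sup>2 + c\<^sup>2) * integral {0..1} (\<lambda>t. t * H t)"
proof -
  let ?M = "disk_area"
  let ?t = "\<lambda>i j K z. harm i z * harm j z * K (nsq z)"
  let ?i = "(0::nat, True)" and ?j = "(1::nat, True)" and ?k = "(1::nat, False)"
  have int: "integrable ?M (?t i j K)" if "continuous_on {0..1} K" for i j K
    by (intro ess_bdd_integrable ess_bdd_continuous continuous_intros continuous_on_radial that)
  have "(LINT z|?M. G (nsq z) + (b * Re z + c * Im z)\<^sup>2 * H (nsq z))
    = (LINT z|?M. ?t ?i ?i G z + (b\<^sup>2 * ?t ?j ?j H z + (2 * b * c * ?t ?j ?k H z + c\<^sup>2 * ?t ?k ?k H z)))"
    by (intro Bochner_Integration.integral_cong) (simp_all only: harm_simps, simp_all add: power2_eq_square algebra_simps)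
  also have "\<dots> = (LINT z|?M. ?t ?i ?i G z) + (b\<^sup>2 * (LINT z|?M. ?t ?j ?j H z) + (2 * b * c * (LINT z|?M. ?t ?j ?k H z) + c\<^sup>2 * (LINT z|?M. ?t ?k ?k H z)))"
    by (simp only: Bochner_Integration.integral_add Bochner_Integration.integrable_add integrable_mult_right int[OF G] int[OF H] integral_mult_right_zero)
  also have "\<dots> = pi * integral {0..1} G + pi / 2 * (b\<^sup>2 + c\<^sup>2) * integral {0..1} (\<lambda>t. t * H t)"
    unfolding harm_orthogonal[OF G] harm_orthogonal[OF H] by (simp add: harm_weight_def algebra_simps)
  finally show ?thesis .
qed

lemma integral_disk_split_odd:
  assumes "continuous_on (cball 0 1) f" "continuous_on (cball 0 1) g" "\<And>z. g (- z) = - g z"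
    and "\<And>z. u z = f z + g z"
  shows "(LINT z|disk_area. u z :: real) = (LINT z|disk_area. f z)"
proof -
  have "(LINT z|disk_area. u z) = (LINT z|disk_area. f z) + (LINT z|disk_area. g z)"
    unfolding assms(4) by (intro Bochner_Integration.integral_add ess_bdd_integrable ess_bdd_continuous assms)
  then show ?thesis using integral_disk_odd[OF assms(2,3)] by simp
qed

abbreviation (input) profile0 :: "real \<Rightarrow> real" where "profile0 t \<equiv> clifford 0 (kappa * t)"
abbreviation (input) profile1 :: "real \<Rightarrow> real" where "profile1 t \<equiv> clifford 1 (kappa * t)"

lemma Vfun_moment_2:
  "(LINT z|disk_area. Vfun a b c z ^ 2)
    = pi * (a\<^sup>2 * integral {0..1} (\<lambda>t. (profile0 t)\<^sup>2)) + pi / 2 * (b\<^sup>2 + c\<^sup>2) * integral {0..1} (\<lambda>t. t * (profile1 t)\<^sup>2)"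
proof -
  have "(LINT z|disk_area. Vfun a b c z ^ 2)
    = (LINT z|disk_area. a\<^sup>2 * (profile0 (nsq z))\<^sup>2 + (b * Re z + c * Im z)\<^sup>2 * (profile1 (nsq z))\<^sup>2)"
  proof (rule integral_disk_split_odd[where g="\<lambda>z. 2 * a * profile0 (nsq z) * (b * Re z + c * Im z) * profile1 (nsq z)"])
    show "Vfun a b c z ^ 2 = a\<^sup>2 * (profile0 (nsq z))\<^sup>2 + (b * Re z + c * Im z)\<^sup>2 * (profile1 (nsq z))\<^sup>2
        + 2 * a * profile0 (nsq z) * (b * Re z + c * Im z) * profile1 (nsq z)" for z
      unfolding Vfun_eq by (simp only: power2_sum power_mult_distrib mult_ac add_ac)
  qed (intro continuous_intros | simp add: algebra_simps)+
  also have "\<dots> = pi * integral {0..1} (\<lambda>t. a\<^sup>2 * (profile0 t)\<^sup>2) + pi / 2 * (b\<^sup>2 + c\<^sup>2) * integral {0..1} (\<lambda>t. t * (profile1 t)\<^sup>2)"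
    by (rule integral_disk_even_part) (intro continuous_intros)+
  finally show ?thesis by simp
qed

lemma Vfun_moment_3:
  "(LINT z|disk_area. Vfun a b c z ^ 3)
    = pi * (a ^ 3 * integral {0..1} (\<lambda>t. profile0 t ^ 3)) + pi / 2 * (b\<^sup>2 + c\<^sup>2) * (3 * a * integral {0..1} (\<lambda>t. t * (profile0 t * (profile1 t)\<^sup>2)))"
proof -
  have cube: "(x + y) ^ 3 = x ^ 3 + 3 * x * y\<^sup>2 + (3 * x\<^sup>2 * y + y ^ 3)" for x y :: real
    by (simp add: power2_eq_square power3_eq_cube algebra_simps)
  have "(LINT z|disk_area. Vfun a b c z ^ 3)
    = (LINT z|disk_area. a ^ 3 * profile0 (nsq z) ^ 3 + (b * Re z + c * Im z)\<^sup>2 * (3 * a * (profile0 (nsq z) * (profile1 (nsq z))\<^sup>2)))"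
  proof (rule integral_disk_split_odd[where g="\<lambda>z. 3 * (a * profile0 (nsq z))\<^sup>2 * ((b * Re z + c * Im z) * profile1 (nsq z)) + ((b * Re z + c * Im z) * profile1 (nsq z)) ^ 3"])
    show "Vfun a b c z ^ 3 = a ^ 3 * profile0 (nsq z) ^ 3 + (b * Re z + c * Im z)\<^sup>2 * (3 * a * (profile0 (nsq z) * (profile1 (nsq z))\<^sup>2))
       + (3 * (a * profile0 (nsq z))\<^sup>2 * ((b * Re z + c * Im z) * profile1 (nsq z)) + ((b * Re z + c * Im z) * profile1 (nsq z)) ^ 3)" for z
      unfolding Vfun_eq cube by (simp only: power_mult_distrib) (simp only: mult_ac)
    have neg: "b * Re (- z) + c * Im (- z) = - (b * Re z + c * Im z)" for z by simp
    show "3 * (a * profile0 ((cmod (- z))\<^sup>2))\<^sup>2 * ((b * Re (- z) + c * Im (- z)) * profile1 ((cmod (- z))\<^sup>2)) + ((b * Re (- z) + c * Im (- z)) * profile1 ((cmod (- z))\<^sup>2)) ^ 3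
      = - (3 * (a * profile0 (nsq z))\<^sup>2 * ((b * Re z + c * Im z) * profile1 (nsq z)) + ((b * Re z + c * Im z) * profile1 (nsq z)) ^ 3)" for z
    proof -
      have "3 * A * ((- X) * P) + ((- X) * P) ^ 3 = - (3 * A * (X * P) + (X * P) ^ 3)" for A X P :: real
        by (simp add: power3_eq_cube)
      then show ?thesis unfolding neg norm_minus_cancel .
    qed
  qed (intro continuous_intros)+
  also have "\<dots> = pi * integral {0..1} (\<lambda>t. a ^ 3 * profile0 t ^ 3) + pi / 2 * (b\<^sup>2 + c\<^sup>2) * integral {0..1} (\<lambda>t. t * (3 * a * (profile0 t * (profile1 t)\<^sup>2)))"
    by (rule integral_disk_even_part) (intro continuous_intros)+
  also have "integral {0..1} (\<lambda>t. t * (3 * a * (profile0 t * (profile1 t)\<^sup>2))) = 3 * a * integral {0..1} (\<lambda>t. t * (profile0 t * (profile1 t)\<^sup>2))"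
    by (subst Henstock_Kurzweil_Integration.integral_mult_right[symmetric]) (simp only: mult_ac)
  finally show ?thesis by simp
qed

lemma profile0_DERIV: "(profile0 has_real_derivative - kappa * profile1 t) (at t)"
  using clifford_scaled_DERIV[of 1 0 kappa t] by simp

text \<open>
  Integrate by parts with \<open>C\<^sub>0 = (t C\<^sub>1)'\<close> and \<open>C\<^sub>0' = - \<kappa> C\<^sub>1\<close>; the boundary term vanishes since
  \<open>C\<^sub>1(\<kappa>) = 0\<close>. The cubic integral is treated in the same way.
\<close>

lemma profile_integral_2: "integral {0..1} (\<lambda>t. (profile0 t)\<^sup>2) = kappa * integral {0..1} (\<lambda>t. t * (profile1 t)\<^sup>2)"
proof -
  have i: "(\<lambda>t. (profile0 t)\<^sup>2) integrable_on {0..1}" "(\<lambda>t. kappa * (t * (profile1 t)\<^sup>2)) integrable_on {0..1}"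
    by (intro integrable_continuous_interval continuous_intros)+
  have d: "((\<lambda>t. (t * profile1 t) * profile0 t) has_real_derivative (profile0 t)\<^sup>2 - kappa * (t * (profile1 t)\<^sup>2)) (at t)" for t
    using DERIV_mult[OF clifford_0_eq_DERIV profile0_DERIV, of t] by (simp add: power2_eq_square algebra_simps)
  have "integral {0..1} (\<lambda>t. (profile0 t)\<^sup>2 - kappa * (t * (profile1 t)\<^sup>2)) = 0"
    using integral_01_FTC(1)[OF d] kappa_props(2) by simp
  then show ?thesis by (simp only: Henstock_Kurzweil_Integration.integral_diff[OF i]) simp
qed

lemma profile_integral_3: "integral {0..1} (\<lambda>t. profile0 t ^ 3) = 2 * kappa * integral {0..1} (\<lambda>t. t * (profile0 t * (profile1 t)\<^sup>2))"
proof -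
  have i: "(\<lambda>t. profile0 t ^ 3) integrable_on {0..1}" "(\<lambda>t. 2 * kappa * (t * (profile0 t * (profile1 t)\<^sup>2))) integrable_on {0..1}"
    by (intro integrable_continuous_interval continuous_intros)+
  have d: "((\<lambda>t. (t * profile1 t) * (profile0 t * profile0 t)) has_real_derivative profile0 t ^ 3 - 2 * kappa * (t * (profile0 t * (profile1 t)\<^sup>2))) (at t)" for t
    using DERIV_mult[OF clifford_0_eq_DERIV DERIV_mult[OF profile0_DERIV profile0_DERIV], of t]
    by (simp add: power2_eq_square power3_eq_cube algebra_simps)
  have "integral {0..1} (\<lambda>t. profile0 t ^ 3 - 2 * kappa * (t * (profile0 t * (profile1 t)\<^sup>2))) = 0"
    using integral_01_FTC(1)[OF d] kappa_props(2) by simp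
  then show ?thesis by (simp only: Henstock_Kurzweil_Integration.integral_diff[OF i]) (simp add: mult.assoc)
qed

lemma profile_integral_2_pos: "0 < integral {0..1} (\<lambda>t. t * (profile1 t)\<^sup>2)"
  by (rule integral_01_pos) (use clifford_1_half_pos in \<open>auto intro!: continuous_intros\<close>)

text \<open>
  The integrand changes sign, but \<open>3 t C\<^sub>0 C\<^sub>1\<^sup>2 - t C\<^sub>1\<^sup>3\<close> is the derivative of \<open>t\<^sup>2 C\<^sub>1\<^sup>3\<close>, which vanishes at both ends.
\<close>

lemma profile_integral_3_pos: "0 < integral {0..1} (\<lambda>t. t * (profile0 t * (profile1 t)\<^sup>2))"
proof -
  have i: "(\<lambda>t. t * (profile0 t * (profile1 t)\<^sup>2)) integrable_on {0..1}" "(\<lambda>t. t * profile1 t ^ 3) integrable_on {0..1}"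
    by (intro integrable_continuous_interval continuous_intros)+
  have p: "profile0 t = profile1 t - kappa * t * clifford 2 (kappa * t)" for t
    using clifford_recurrence[of 0 "kappa * t"] by (simp add: numeral_2_eq_2)
  have dp: "(profile1 has_real_derivative - kappa * clifford 2 (kappa * t)) (at t)" for t
    using clifford_scaled_DERIV[of 1 1 kappa t] by (simp add: numeral_2_eq_2)
  have d: "((\<lambda>t. (t * profile1 t) * (t * profile1 t) * profile1 t) has_real_derivative
      3 * (t * (profile0 t * (profile1 t)\<^sup>2)) - t * profile1 t ^ 3) (at t)" for t
  proof -
    have "((\<lambda>t. (t * profile1 t) * (t * profile1 t) * profile1 t) has_real_derivative
      (profile0 t * (t * profile1 t) + profile0 t * (t * profile1 t)) * profile1 t + (- kappa * clifford 2 (kappa * t)) * ((t * profile1 t) * (t * profile1 t))) (at t)"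
      by (rule DERIV_mult[OF DERIV_mult[OF clifford_0_eq_DERIV clifford_0_eq_DERIV] dp])
    moreover have "(profile0 t * (t * profile1 t) + profile0 t * (t * profile1 t)) * profile1 t + (- kappa * clifford 2 (kappa * t)) * ((t * profile1 t) * (t * profile1 t))
       = 3 * (t * (profile0 t * (profile1 t)\<^sup>2)) - t * profile1 t ^ 3"
      unfolding p by (simp add: power2_eq_square power3_eq_cube algebra_simps)
    ultimately show ?thesis by simp
  qed
  have "integral {0..1} (\<lambda>t. 3 * (t * (profile0 t * (profile1 t)\<^sup>2)) - t * profile1 t ^ 3) = 0"
    using integral_01_FTC(1)[OF d] kappa_props(2) by simp
  moreover have "integral {0..1} (\<lambda>t. 3 * (t * (profile0 t * (profile1 t)\<^sup>2)) - t * profile1 t ^ 3)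
     = 3 * integral {0..1} (\<lambda>t. t * (profile0 t * (profile1 t)\<^sup>2)) - integral {0..1} (\<lambda>t. t * profile1 t ^ 3)"
    by (intro integral_unique has_integral_diff has_integral_mult_right integrable_integral i)
  moreover have "0 < integral {0..1} (\<lambda>t. t * profile1 t ^ 3)"
    by (rule integral_01_pos) (use clifford_1_half_pos clifford_1_nonneg in \<open>auto intro!: continuous_intros mult_nonneg_nonneg zero_le_power\<close>)
  ultimately show ?thesis by linarith
qed

text \<open>
  With \<open>C = a\<^sup>2 + s\<close> fixed, \<open>2 a\<^sup>3 + 3 a s = a (3 C - a\<^sup>2)\<close> is strictly increasing in \<open>a\<close> on \<open>|a| \<le> \<surd>C\<close>.
\<close>

lemma cubic_moment_injective:
  fixes a a' s s' :: real
  assumes "s \<ge> 0" "s' \<ge> 0" and 2: "a\<^sup>2 + s = a'\<^sup>2 + s'" and 3: "2 * a ^ 3 + 3 * a * s = 2 * a' ^ 3 + 3 * a' * s'"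
  shows "a = a'" "s = s'"
proof -
  show aa: "a = a'"
  proof (rule ccontr)
    assume ne: "a \<noteq> a'"
    define C where "C = a\<^sup>2 + s"
    have s: "s = C - a\<^sup>2" "s' = C - a'\<^sup>2" using 2 by (simp_all add: C_def)
    \<comment> \<open>A second solution would force \<open>3 C = a\<^sup>2 + a a' + a'\<^sup>2\<close>, which is too large unless \<open>a = a'\<close>.\<close>
    have "(a - a') * (3 * C - (a\<^sup>2 + a * a' + a'\<^sup>2)) = 0"
      using 3 unfolding s by (simp add: power2_eq_square power3_eq_cube algebra_simps)
    then have "3 * C = a\<^sup>2 + a * a' + a'\<^sup>2" using ne by simp
    moreover have "2 * (a * a') = a\<^sup>2 + a'\<^sup>2 - (a - a')\<^sup>2" by (simp add: power2_diff)
    moreover have "(a - a')\<^sup>2 > 0" using ne by simp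
    moreover have "a\<^sup>2 \<le> C" "a'\<^sup>2 \<le> C" using assms(1,2) s by simp_all
    ultimately show False by linarith
  qed
  show "s = s'" using 2 by (simp add: aa)
qed

text \<open>
  In terms of \<open>s = (b\<^sup>2 + c\<^sup>2) / (2 \<kappa>)\<close> the second moment is a positive multiple of \<open>a\<^sup>2 + s\<close> and the third
  one of \<open>2 a\<^sup>3 + 3 a s\<close>. Odd powers of \<open>b x + c y\<close> do not contribute.
\<close>

lemma Vfun_moments_determine:
  assumes m2: "(LINT z|disk_area. Vfun a b c z ^ 2) = (LINT z|disk_area. Vfun a' b' c' z ^ 2)"
    and m3: "(LINT z|disk_area. Vfun a b c z ^ 3) = (LINT z|disk_area. Vfun a' b' c' z ^ 3)"
  shows "a = a'" "b\<^sup>2 + c\<^sup>2 = b'\<^sup>2 + c'\<^sup>2"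
proof -
  define Y2 where "Y2 = integral {0..1} (\<lambda>t. t * (profile1 t)\<^sup>2)"
  define Y3 where "Y3 = integral {0..1} (\<lambda>t. t * (profile0 t * (profile1 t)\<^sup>2))"
  have Y: "Y2 > 0" "Y3 > 0" unfolding Y2_def Y3_def by (rule profile_integral_2_pos profile_integral_3_pos)+
  have k: "kappa > 0" by (rule kappa_props(1))
  define s where "s = (b\<^sup>2 + c\<^sup>2) / (2 * kappa)"
  define s' where "s' = (b'\<^sup>2 + c'\<^sup>2) / (2 * kappa)"
  have bs: "b\<^sup>2 + c\<^sup>2 = 2 * kappa * s" "b'\<^sup>2 + c'\<^sup>2 = 2 * kappa * s'" using k by (simp_all add: s_def s'_def)
  have "(pi * kappa * Y2) * (a\<^sup>2 + s) = (pi * kappa * Y2) * (a'\<^sup>2 + s')"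
    using m2 unfolding Vfun_moment_2 profile_integral_2 Y2_def[symmetric] bs by (simp add: algebra_simps)
  then have 2: "a\<^sup>2 + s = a'\<^sup>2 + s'" using k Y by simp
  have "(pi * kappa * Y3) * (2 * a ^ 3 + 3 * a * s) = (pi * kappa * Y3) * (2 * a' ^ 3 + 3 * a' * s')"
    using m3 unfolding Vfun_moment_3 profile_integral_3 Y3_def[symmetric] bs by (simp add: algebra_simps)
  then have 3: "2 * a ^ 3 + 3 * a * s = 2 * a' ^ 3 + 3 * a' * s'" using k Y by simp
  have "s \<ge> 0" "s' \<ge> 0" using k by (simp_all add: s_def s'_def)
  note * = cubic_moment_injective[OF this 2 3]
  show "a = a'" by (rule *(1))
  show "b\<^sup>2 + c\<^sup>2 = b'\<^sup>2 + c'\<^sup>2" unfolding bs using *(2) by simp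
qed

lemma Vfun_rotate: "Vfun a b c (cis \<beta> * z) = Vfun a (b * cos \<beta> + c * sin \<beta>) (c * cos \<beta> - b * sin \<beta>) z"
  by (simp add: Vfun_eq norm_mult algebra_simps)

lemma rotation_exists:
  fixes b c b' c' :: real
  assumes "b\<^sup>2 + c\<^sup>2 = b'\<^sup>2 + c'\<^sup>2"
  obtains \<beta> where "b' = b * cos \<beta> + c * sin \<beta>" "c' = c * cos \<beta> - b * sin \<beta>"
proof (cases "b\<^sup>2 + c\<^sup>2 = 0")
  case True
  then have "b = 0" "c = 0" "b' = 0" "c' = 0" using assms by (simp_all add: sum_power2_eq_zero_iff)
  then show ?thesis using that[of 0] by simp
next
  case False
  define r where "r = b\<^sup>2 + c\<^sup>2"
  have r: "r \<noteq> 0" using False by (simp add: r_def)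
  \<comment> \<open>The quotient of the complex numbers \<open>b' - i c'\<close> and \<open>b - i c\<close>.\<close>
  let ?x = "(b * b' + c * c') / r" and ?y = "(c * b' - b * c') / r"
  have "(b * b' + c * c')\<^sup>2 + (c * b' - b * c')\<^sup>2 = (b\<^sup>2 + c\<^sup>2) * (b'\<^sup>2 + c'\<^sup>2)"
    by (simp add: power2_eq_square algebra_simps)
  also have "\<dots> = r\<^sup>2" unfolding assms[symmetric] r_def by (simp add: power2_eq_square)
  finally have "?x\<^sup>2 + ?y\<^sup>2 = 1" using r by (simp add: power_divide add_divide_distrib[symmetric])
  then obtain \<beta> where \<beta>: "?x = cos \<beta>" "?y = sin \<beta>" using sincos_total_2pi by metis
  have "b * (b * b' + c * c') + c * (c * b' - b * c') = r * b'" "c * (b * b' + c * c') - b * (c * b' - b * c') = r * c'"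
    by (simp_all add: r_def power2_eq_square algebra_simps)
  then have "b * ?x + c * ?y = b'" "c * ?x - b * ?y = c'"
    using r by (simp_all add: add_divide_distrib[symmetric] diff_divide_distrib[symmetric])
  then show ?thesis using that[of \<beta>] \<beta> by simp
qed

lemma superlevel_AE_cong:
  assumes "AE z in disk_area. v z = w z" "v \<in> borel_measurable (disk_area)" "w \<in> borel_measurable (disk_area)"
  shows "measure lebesgue {x \<in> unit_disk. v x > s} = measure lebesgue {x \<in> unit_disk. w x > (s::real)}"
proof (rule measure_eq_AE)
  have "AE z in lebesgue. z \<in> unit_disk \<longrightarrow> v z = w z" using assms(1) by (simp add: AE_lebesgue_on_disk_iff)
  then show "AE x in lebesgue. (x \<in> {x \<in> unit_disk. v x > s}) = (x \<in> {x \<in> unit_disk. w x > s})"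
    by eventually_elim auto
qed (use superlevel_lmeasurable assms in auto)

lemma rotation_orbit_subset:
  assumes \<omega>: "\<omega> \<in> V_space" and v: "v \<in> rotation_orbit \<omega>"
  shows "v \<in> V_space" "v \<in> rearrangement_class \<omega>"
proof -
  let ?M = "disk_area"
  obtain a b c where abc: "AE z in ?M. \<omega> z = Vfun a b c z" using \<omega> unfolding V_space_iff by blast
  obtain \<beta> where \<beta>: "AE z in ?M. v z = \<omega> (cis \<beta> * z)" using v by (auto simp: rotation_orbit_def)
  have r: "AE z in ?M. v z = Vfun a b c (cis \<beta> * z)"
    using AE_disk_rotate[OF abc, of \<beta>] \<beta> by eventually_elim simp
  then show V: "v \<in> V_space" unfolding V_space_iff Vfun_rotate by blast
  have vm: "v \<in> borel_measurable ?M" and \<omega>m: "\<omega> \<in> borel_measurable ?M"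
    by (intro ess_bdd_measurable ess_bdd_V_space V \<omega>)+
  have em: "Vfun a b c \<in> borel_measurable ?M" by (intro ess_bdd_measurable ess_bdd_Vfun)
  have em': "(\<lambda>z. Vfun a b c (cis \<beta> * z)) \<in> borel_measurable ?M"
    unfolding Vfun_rotate by (intro ess_bdd_measurable ess_bdd_Vfun)
  have "measure lebesgue {x \<in> unit_disk. v x > s} = measure lebesgue {x \<in> unit_disk. \<omega> x > s}" for s
  proof -
    let ?S = "{x \<in> unit_disk. Vfun a b c x > s}"
    have "open (unit_disk \<inter> {x. s < Vfun a b c x})"
      by (intro open_Int open_ball open_Collect_less continuous_intros)
    moreover have "unit_disk \<inter> {x. s < Vfun a b c x} = ?S" by auto
    ultimately have S: "?S \<in> sets borel" by simp
    have "measure lebesgue {x \<in> unit_disk. v x > s} = measure lebesgue {x \<in> unit_disk. Vfun a b c (cis \<beta> * x) > s}"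
      by (rule superlevel_AE_cong[OF r vm em'])
    also have "{x \<in> unit_disk. Vfun a b c (cis \<beta> * x) > s} = {x. cis \<beta> * x \<in> ?S}" by (auto simp: norm_mult)
    also have "measure lebesgue \<dots> = measure lebesgue ?S" by (rule measure_lebesgue_rotate[OF S])
    also have "\<dots> = measure lebesgue {x \<in> unit_disk. \<omega> x > s}"
      by (rule superlevel_AE_cong[OF abc \<omega>m em, symmetric])
    finally show ?thesis .
  qed
  then show "v \<in> rearrangement_class \<omega>" using vm by (simp add: rearrangement_class_def)
qed

theorem theorem1p5:
  fixes \<omega> :: "complex \<Rightarrow> real"
  assumes "\<omega> \<in> V_space"
  shows "rotation_orbit \<omega> =
    {v \<in> rearrangement_class \<omega>.
       ereal (kinetic_energy v) = (SUP w \<in> rearrangement_class \<omega>. ereal (kinetic_energy w))}"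
proof -
  let ?M = "disk_area"
  define E where "E = (LINT z|?M. \<omega> z ^ 2) / (8 * kappa)"
  have \<omega>b: "ess_bdd \<omega>" by (rule ess_bdd_V_space[OF assms])
  have k: "kappa > 0" by (rule kappa_props(1))
  have R: "ess_bdd v" "(LINT z|?M. v z) = 0" "\<And>k. (LINT z|?M. v z ^ k) = (LINT z|?M. \<omega> z ^ k)"
    if v: "v \<in> rearrangement_class \<omega>" for v
  proof -
    have vm: "v \<in> borel_measurable ?M" using v by (simp add: rearrangement_class_def)
    have d: "distr ?M borel v = distr ?M borel \<omega>"
      by (rule equimeasurable_distr[OF vm ess_bdd_measurable[OF \<omega>b]]) (use v in \<open>simp add: rearrangement_class_def\<close>)
    show "ess_bdd v" by (rule equidistributed_ess_bdd[OF vm \<omega>b d])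
    show mom: "(LINT z|?M. v z ^ k) = (LINT z|?M. \<omega> z ^ k)" for k
      by (rule equidistributed_moments[OF vm ess_bdd_measurable[OF \<omega>b] d])
    show "(LINT z|?M. v z) = 0" using mom[of 1] V_space_props(1)[OF assms] by simp
  qed
  have iff: "kinetic_energy v = E \<longleftrightarrow> 4 * kappa * (LINT z|?M. v z * green_op v z) = (LINT z|?M. v z * v z)"
    and le: "kinetic_energy v \<le> E" if v: "v \<in> rearrangement_class \<omega>" for v
  proof -
    have E: "E = (LINT z|?M. v z * v z) / (8 * kappa)"
      using R(3)[OF v, of 2] by (simp add: E_def power2_eq_square)
    show "kinetic_energy v = E \<longleftrightarrow> 4 * kappa * (LINT z|?M. v z * green_op v z) = (LINT z|?M. v z * v z)"
      using k by (auto simp: kinetic_energy_def E field_simps)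
    show "kinetic_energy v \<le> E"
      using energy_inequality[OF R(1)[OF v] R(2)[OF v]] k by (simp add: kinetic_energy_def E field_simps)
  qed
  have orb: "v \<in> rearrangement_class \<omega> \<and> kinetic_energy v = E" if "v \<in> rotation_orbit \<omega>" for v
    using rotation_orbit_subset[OF assms that] iff V_space_props(2) by blast
  have "\<omega> \<in> rotation_orbit \<omega>"
    unfolding rotation_orbit_def by (auto intro!: exI[of _ 0])
  then have "(SUP w \<in> rearrangement_class \<omega>. ereal (kinetic_energy w)) = ereal E"
    using orb[of \<omega>] le by (intro antisym SUP_least SUP_upper2[of \<omega>]) auto
  moreover have "v \<in> rotation_orbit \<omega>" if v: "v \<in> rearrangement_class \<omega>" and max: "kinetic_energy v = E" for v
  proof -
    have "v \<in> V_space"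
      by (rule energy_equality_imp_V_space[OF R(1,2)[OF v]]) (use iff[OF v] max in blast)
    then obtain a' b' c' where v': "AE z in ?M. v z = Vfun a' b' c' z" unfolding V_space_iff by blast
    obtain a b c where \<omega>': "AE z in ?M. \<omega> z = Vfun a b c z" using assms unfolding V_space_iff by blast
    have mom: "(LINT z|?M. f z ^ k) = (LINT z|?M. Vfun x y s z ^ k)"
      if "AE z in ?M. f z = Vfun x y s z" "ess_bdd f" for f x y s k
    proof (rule integral_cong_AE)
      show "(\<lambda>z. f z ^ k) \<in> borel_measurable ?M" "(\<lambda>z. Vfun x y s z ^ k) \<in> borel_measurable ?M"
        by (rule ess_bdd_measurable[OF ess_bdd_power[OF that(2)]], rule ess_bdd_measurable[OF ess_bdd_power[OF ess_bdd_Vfun]])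
      show "AE z in ?M. f z ^ k = Vfun x y s z ^ k" using that(1) by eventually_elim simp
    qed
    have "(LINT z|?M. Vfun a b c z ^ k) = (LINT z|?M. Vfun a' b' c' z ^ k)" for k
      using mom[OF v' R(1)[OF v], of k] mom[OF \<omega>' \<omega>b, of k] R(3)[OF v, of k] by simp
    from Vfun_moments_determine[OF this this]
    have a: "a = a'" and bc: "b\<^sup>2 + c\<^sup>2 = b'\<^sup>2 + c'\<^sup>2" .
    obtain \<beta> where "b' = b * cos \<beta> + c * sin \<beta>" "c' = c * cos \<beta> - b * sin \<beta>"
      using rotation_exists[OF bc] by blast
    then have "Vfun a' b' c' z = Vfun a b c (cis \<beta> * z)" for z by (simp add: Vfun_rotate a)
    then have "AE z in ?M. v z = \<omega> (cis \<beta> * z)"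
      using v' AE_disk_rotate[OF \<omega>', of \<beta>] by (auto elim: eventually_elim2)
    then show ?thesis by (auto simp: rotation_orbit_def)
  qed
  ultimately show ?thesis using orb by auto
qed

end
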